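(* Let $n\ge 3$ and let $p$ be an odd prime such that $p\ge n-2$ if $n$ is even and $p\ge 2n-4$ if $n$ is odd. Let $k$ be a perfect field of characteristic $p$, $R_{p,n+1}=k[x_0,\dots,x_{n+1}]/(x_0^2+\cdots+x_{n+1}^2)$ and $\mathbf m=(x_0,\dots,x_{n+1})$. Then $$1+m_{n+1}+\frac{2n-4}{p}\;\ge\; e_{HK}(R_{p,n+1},\mathbf m)\;\ge\;1+m_{n+1}.$$
   Context: For a Noetherian ring $R$ of dimension $d$ containing a field of characteristic $p>0$ and an ideal $I$ of finite colength, the Hilbert–Kunz multiplicity is $e_{HK}(R,I)=\lim_{s\to\infty}\ell(R/I^{[q]})/q^{d}$ with $q=p^s$ and $I^{[q]}$ the ideal generated by $q$-th powers of elements of $I$. The numbers $m_j$ are defined by the Taylor expansion $\sec(x)+\tan(x)=1+\sum_{j\ge1} m_j x^j$ for $|x|<\pi/2$. *)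

theory Defs
  imports "HOL-Analysis.Analysis" "HOL-Library.Poly_Mapping"
begin

type_synonym 'k mpoly = "(nat \<Rightarrow>\<^sub>0 nat) \<Rightarrow>\<^sub>0 'k"

definition Var :: "nat \<Rightarrow> 'k::comm_ring_1 mpoly" where
  "Var i = Poly_Mapping.single (Poly_Mapping.single i 1) 1"

definition Const :: "'k::comm_ring_1 \<Rightarrow> 'k mpoly" where
  "Const c = Poly_Mapping.single 0 c"

definition polys_in :: "nat \<Rightarrow> 'k::comm_ring_1 mpoly set" where
  "polys_in N = {f. \<forall>m\<in>Poly_Mapping.keys f. \<forall>i\<in>Poly_Mapping.keys m. i < N}"

definition ideal_gen :: "nat \<Rightarrow> 'k::comm_ring_1 mpoly set \<Rightarrow> 'k mpoly set" where
  "ideal_gen N G = {(\<Sum>j<r. c j * g j) | (r::nat) c g.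
      (\<forall>j<r. c j \<in> polys_in N \<and> g j \<in> G)}"

definition quot_dim :: "nat \<Rightarrow> 'k::field mpoly set \<Rightarrow> nat" where
  "quot_dim N J = Sup {card S | S. finite S \<and> S \<subseteq> polys_in N \<and>
      (\<forall>c :: 'k mpoly \<Rightarrow> 'k. (\<Sum>s\<in>S. Const (c s) * s) \<in> J \<longrightarrow> (\<forall>s\<in>S. c s = 0))}"

text \<open>Length of R/I^[q] where R = k[x_0..x_{N-1}]/(f) and I is the image of the ideal I'
  of the polynomial ring; R/I^[q] = k[x]/((f) + I'^[q]), and since this is a finite-dimensional
  local k-algebra with residue field k, its length equals its k-dimension.\<close>
definition hk_length :: "nat \<Rightarrow> 'k::field mpoly \<Rightarrow> 'k mpoly set \<Rightarrow> nat \<Rightarrow> nat" where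
  "hk_length N f I q = quot_dim N (ideal_gen N ({f} \<union> {g ^ q | g. g \<in> I}))"

definition e_HK :: "nat \<Rightarrow> nat \<Rightarrow> nat \<Rightarrow> 'k::field mpoly \<Rightarrow> 'k mpoly set \<Rightarrow> real" where
  "e_HK p d N f I = lim (\<lambda>s. real (hk_length N f I (p ^ s)) / real (p ^ s) ^ d)"

definition max_ideal :: "nat \<Rightarrow> 'k::comm_ring_1 mpoly set" where
  "max_ideal N = ideal_gen N {Var i | i. i < N}"

definition sec_tan_coeff :: "nat \<Rightarrow> real" where
  "sec_tan_coeff j = (deriv ^^ j) (\<lambda>x. 1 / cos x + tan x) 0 / fact j"

end

theory Submission
  imports Defs "HOL-Library.Function_Algebras"
begin

text \<open>
  Put $N = n + 2$ and $q = p^s$. By Macaulay duality the length of $R/\mathbf m^{[q]}$ is the nullity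
  of the sum of the double down-shifts on the functions on the box $[0,q)^N$; splitting each
  coordinate by parity turns this into a sum of nullities of sums of simple down-shifts on boxes
  whose side lengths are $(q \pm 1)/2$. As functions of the side lengths these nullities satisfy a
  discrete wave equation away from the multiples of $p$, while the Frobenius reduces a box with a side
  length divisible by $p$ to smaller boxes. Hence, up to a multilinear term, they are determined by the
  boxes with all but one side congruent to 1 modulo $p$. For these the nullity is computed directly:
  it deviates from linear interpolation by a sawtooth with nonnegative amplitudes $A, A'$. Iterated
  window sums of a sawtooth are square waves smoothed by $p$-windows, whose values at 0 have generating
  function $(\sec + \tan)(pt)$ after the substitution $t \mapsto \sin t$ (up to a factor cosine). So the length
  $D_s$ satisfies $D_{s+1} = p^{n+1} D_s + \nu_s (U - T)$ with explicit $U, T$ and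
  $T^s \le \nu_s \le p^{ns}$, and both bounds follow by summing two geometric series.
\<close>

section \<open>Linear algebra of function spaces\<close>

text \<open>Of the two amplitudes, only the difference \<open>A - A'\<close> gets a closed
  recursion: it is the alternating sum of the nullities over the side lengths \<open>b\<close> and
  \<open>b + 1\<close>, and the wave argument with alternating signs multiplies this sum by
  \<open>T\<close>, up to sign, in each Frobenius step. What enters the recursion of the lengths is
  the sum \<open>A + A'\<close>. Since both amplitudes are nonnegative, \<open>T ^ s\<close> bounds
  it from below; concavity of the kernel dimensions of successive powers of one operator bounds it
  from above. The wave equation needs data at two times. Time 0 is a side divisible by
  \<open>p\<close>, where the deviation from interpolation vanishes, so the sides
  \<open>p * b + 1\<close> at time 1 carry all the information. There the Frobenius cannot be
  applied to one shift alone. The way out is a matrix factorization \<open>Xi\<close> of X^2 + Z^p,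
  with X odd for a parity grading, which keeps its shape when a side \<open>p * b + 1\<close> is
  exchanged for a signed side \<open>2 * b + 1\<close>. The size of \<open>p\<close> against
  \<open>n\<close> matters in the final estimates, where it keeps the lower-order terms of the half
  waves small against the leading ones.\<close>

definition fscale :: "'k::field \<Rightarrow> ('i \<Rightarrow> 'k) \<Rightarrow> 'i \<Rightarrow> 'k" where
  "fscale c f = (\<lambda>x. c * f x)"

lemma fscale_apply: "fscale c f x = c * f x"
  by (simp add: fscale_def)

interpretation fv: vector_space fscale
  by unfold_locales (auto simp: fscale_def fun_eq_iff algebra_simps)

interpretation fvp: vector_space_pair fscale fscale
  by unfold_locales

abbreviation "vdim \<equiv> fv.dim"

definition flinear :: "(('i \<Rightarrow> 'k::field) \<Rightarrow> 'j \<Rightarrow> 'k) \<Rightarrow> bool" where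
  "flinear f \<longleftrightarrow> (\<forall>u v. f (u + v) = f u + f v) \<and> (\<forall>c v. f (fscale c v) = fscale c (f v))"

lemma flinear_iff: "flinear f \<longleftrightarrow> Vector_Spaces.linear fscale fscale f"
  unfolding Vector_Spaces.linear_iff flinear_def by (simp add: fv.vector_space_axioms)

lemma flinear_linear: "flinear f \<Longrightarrow> Vector_Spaces.linear fscale fscale f"
  by (simp add: flinear_iff)

lemma flinearI:
  assumes "\<And>u v x. f (u + v) x = f u x + f v x" "\<And>c v x. f (fscale c v) x = c * f v x"
  shows "flinear f"
  using assms by (auto simp: flinear_def fun_eq_iff fscale_apply)

lemma flinear_add: "flinear f \<Longrightarrow> f (u + v) = f u + f v"
  and flinear_scale: "flinear f \<Longrightarrow> f (fscale c v) = fscale c (f v)"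
  by (auto simp: flinear_def)

lemma flinear_0: "flinear f \<Longrightarrow> f 0 = 0"
  using flinear_scale[of f 0 0] by (simp add: fv.scale_zero_left)

lemma flinear_diff: "flinear f \<Longrightarrow> f (u - v) = f u - f v"
  using fvp.linear_diff flinear_linear by blast

lemma flinear_uminus: "flinear f \<Longrightarrow> f (- v) = - f v"
  using fvp.linear_neg flinear_linear by blast

lemma flinear_id: "flinear (\<lambda>v. v)"
  by (rule flinearI) (auto simp: fscale_apply)

lemma flinear_compose: "flinear f \<Longrightarrow> flinear g \<Longrightarrow> flinear (\<lambda>v. f (g v))"
  by (auto simp: flinear_def)

lemma flinear_plus: "flinear f \<Longrightarrow> flinear g \<Longrightarrow> flinear (\<lambda>v. f v + g v)"
  by (auto simp: flinear_def fv.scale_right_distrib)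

lemma flinear_minus: "flinear f \<Longrightarrow> flinear g \<Longrightarrow> flinear (\<lambda>v. f v - g v)"
  by (auto simp: flinear_def fv.scale_right_diff_distrib)

lemma flinear_funpow:
  fixes f :: "('i \<Rightarrow> 'k::field) \<Rightarrow> 'i \<Rightarrow> 'k"
  shows "flinear f \<Longrightarrow> flinear (f ^^ n)"
proof (induction n)
  case (Suc n)
  then show ?case using flinear_compose[where f = f and g = "f ^^ n"] by (simp add: comp_def)
qed (simp add: id_def flinear_id)

text \<open>\<open>fv.dim\<close> is 0 for a set whose span has no finite basis, so monotonicity and
  counting arguments need this guard.\<close>

definition fdim :: "('i \<Rightarrow> 'k::field) set \<Rightarrow> bool" where
  "fdim S \<longleftrightarrow> (\<exists>B. finite B \<and> S \<subseteq> fv.span B)"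

lemma fdim_subset: "fdim T \<Longrightarrow> S \<subseteq> T \<Longrightarrow> fdim S"
  unfolding fdim_def by blast

lemma fdim_basis:
  assumes "fdim S"
  obtains B where "finite B" "B \<subseteq> S" "fv.independent B" "S \<subseteq> fv.span B" "card B = vdim S"
proof -
  obtain B where B: "B \<subseteq> S" "fv.independent B" "S \<subseteq> fv.span B" "card B = vdim S"
    using fv.basis_exists by blast
  moreover obtain C where "finite C" "S \<subseteq> fv.span C"
    using assms unfolding fdim_def by blast
  then have "finite B"
    using fv.independent_span_bound[of C B] B by auto
  ultimately show thesis using that by blast
qed

lemma vdim_mono:
  assumes "fdim T" "S \<subseteq> T"
  shows "vdim S \<le> vdim T"
proof -
  obtain B where "finite B" "B \<subseteq> T" "T \<subseteq> fv.span B" "card B = vdim T"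
    using fdim_basis[OF assms(1)] by metis
  then show ?thesis using fv.dim_le_card[of S B] assms(2) by auto
qed

text \<open>This replaces direct sums: the maps \<open>f t\<close> are jointly an isomorphism from
  \<open>K\<close> onto the product of the \<open>A t\<close>. A basis of \<open>K\<close> arises by
  lifting every basis vector of every \<open>A t\<close>, padded with zeros in the other components.
  Most decompositions of kernels below are instances, with the kernel equations providing
  injectivity and surjectivity.\<close>

lemma vdim_family:
  fixes f :: "'a \<Rightarrow> ('i \<Rightarrow> 'k::field) \<Rightarrow> 'j \<Rightarrow> 'k"
  assumes K: "fv.subspace K" and I: "finite I"
    and lin: "\<And>t. t \<in> I \<Longrightarrow> flinear (f t)"
    and sub: "\<And>t. t \<in> I \<Longrightarrow> fv.subspace (A t)" and fd: "\<And>t. t \<in> I \<Longrightarrow> fdim (A t)"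
    and into: "\<And>t v. t \<in> I \<Longrightarrow> v \<in> K \<Longrightarrow> f t v \<in> A t"
    and inj: "\<And>v. v \<in> K \<Longrightarrow> (\<And>t. t \<in> I \<Longrightarrow> f t v = 0) \<Longrightarrow> v = 0"
    and surj: "\<And>a. (\<And>t. t \<in> I \<Longrightarrow> a t \<in> A t) \<Longrightarrow> \<exists>v\<in>K. \<forall>t\<in>I. f t v = a t"
  shows "fdim K \<and> vdim K = (\<Sum>t\<in>I. vdim (A t))"
proof -
  have "\<forall>t\<in>I. \<exists>B. finite B \<and> B \<subseteq> A t \<and> fv.independent B \<and> A t \<subseteq> fv.span B \<and> card B = vdim (A t)"
    using fdim_basis[OF fd] by metis
  then obtain B where B: "\<And>t. t \<in> I \<Longrightarrow> finite (B t)" "\<And>t. t \<in> I \<Longrightarrow> B t \<subseteq> A t"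
    "\<And>t. t \<in> I \<Longrightarrow> fv.independent (B t)" "\<And>t. t \<in> I \<Longrightarrow> A t \<subseteq> fv.span (B t)"
    "\<And>t. t \<in> I \<Longrightarrow> card (B t) = vdim (A t)"
    by metis
  define P where "P = Sigma I B"
  have finP: "finite P" using I B(1) by (auto simp: P_def)
  have ex: "\<exists>v. v \<in> K \<and> (\<forall>s\<in>I. f s v = (if s = fst x then snd x else 0))" if x: "x \<in> P" for x
  proof -
    have "(if s = fst x then snd x else 0) \<in> A s" if "s \<in> I" for s
    proof (cases "s = fst x")
      case True
      then show ?thesis using x B(2)[OF that] by (auto simp: P_def)
    next
      case False
      then show ?thesis using fv.subspace_0[OF sub[OF that]] by simp
    qed
    from surj[OF this] show ?thesis by blast
  qed
  define u where "u x = (SOME v. v \<in> K \<and> (\<forall>s\<in>I. f s v = (if s = fst x then snd x else 0)))" for x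
  have "\<forall>x\<in>P. u x \<in> K \<and> (\<forall>s\<in>I. f s (u x) = (if s = fst x then snd x else 0))"
    unfolding u_def using someI_ex[OF ex] by blast
  then have u: "\<And>x. x \<in> P \<Longrightarrow> u x \<in> K"
    "\<And>x s. x \<in> P \<Longrightarrow> s \<in> I \<Longrightarrow> f s (u x) = (if s = fst x then snd x else 0)"
    by auto
  have nz: "b \<noteq> 0" if "(t, b) \<in> P" for t b
    using that B(3) fv.dependent_zero by (fastforce simp: P_def)
  have inju: "inj_on u P"
  proof (rule inj_onI)
    fix x y assume xy: "x \<in> P" "y \<in> P" "u x = u y"
    have "fst x \<in> I" "fst y \<in> I" using xy by (auto simp: P_def)
    then have "snd x = (if fst x = fst y then snd y else 0)"
      using u(2)[OF xy(1), of "fst x"] u(2)[OF xy(2), of "fst x"] xy by simp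
    then show "x = y" using nz[of "fst x" "snd x"] xy
      by (cases x; cases y) (auto split: if_splits)
  qed
  have fsum: "f s (\<Sum>x\<in>P. fscale (c x) (u x)) = (\<Sum>b\<in>B s. fscale (c (s, b)) b)" if "s \<in> I" for s c
  proof -
    have "f s (\<Sum>x\<in>P. fscale (c x) (u x)) = (\<Sum>x\<in>P. fscale (c x) (f s (u x)))"
      using lin[OF that] by (simp add: fvp.linear_sum[OF flinear_linear] flinear_scale)
    also have "\<dots> = (\<Sum>x\<in>P. if s = fst x then fscale (c x) (snd x) else 0)"
      using u(2) that by (intro sum.cong) (auto simp: fv.scale_zero_right)
    also have "\<dots> = (\<Sum>t\<in>I. \<Sum>b\<in>B t. if s = t then fscale (c (t, b)) b else 0)"
      unfolding P_def using I B(1) by (simp add: sum.Sigma split_beta cong: if_cong)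
    also have "\<dots> = (\<Sum>t\<in>I. if s = t then (\<Sum>b\<in>B t. fscale (c (t, b)) b) else 0)"
      by (intro sum.cong) auto
    finally show ?thesis using that I by simp
  qed
  have ind: "fv.independent (u ` P)"
  proof (rule fv.independent_if_scalars_zero)
    fix g x assume g: "(\<Sum>x\<in>u ` P. fscale (g x) x) = 0" and "x \<in> u ` P"
    then obtain t b where tb: "x = u (t, b)" "(t, b) \<in> P" by auto
    have "(\<Sum>x\<in>P. fscale (g (u x)) (u x)) = 0"
      using g by (simp add: sum.reindex[OF inju])
    then have "(\<Sum>b\<in>B t. fscale (g (u (t, b))) b) = 0"
      using fsum[of t "\<lambda>x. g (u x)"] tb(2) lin flinear_0 by (fastforce simp: P_def)
    then have "g (u (t, b)) = 0"
      using fv.independentD[OF B(3), of t "B t" "\<lambda>b. g (u (t, b))" b] B(1) tb(2) by (auto simp: P_def)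
    then show "g x = 0" using tb by simp
  qed (use finP in auto)
  have span: "K \<subseteq> fv.span (u ` P)"
  proof
    fix v assume v: "v \<in> K"
    have "\<exists>c. f t v = (\<Sum>b\<in>B t. fscale (c b) b)" if "t \<in> I" for t
      using into[OF that v] B(4)[OF that] fv.span_finite[OF B(1)[OF that]] by auto
    then obtain c where c: "\<And>t. t \<in> I \<Longrightarrow> f t v = (\<Sum>b\<in>B t. fscale (c t b) b)" by metis
    define w where "w = (\<Sum>x\<in>P. fscale (c (fst x) (snd x)) (u x))"
    have wK: "w \<in> K" unfolding w_def
      by (intro fv.subspace_sum[OF K] fv.subspace_scale[OF K] u)
    have "f t (v - w) = 0" if "t \<in> I" for t
      using c[OF that] fsum[OF that, of "\<lambda>x. c (fst x) (snd x)"] lin[OF that]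
      by (simp add: w_def flinear_diff zero_fun_def)
    then have "v - w = 0" using inj fv.subspace_diff[OF K v wK] by blast
    then have "v = w" by (metis eq_iff_diff_eq_0)
    then show "v \<in> fv.span (u ` P)"
      by (simp only: w_def, intro fv.span_sum fv.span_scale fv.span_base) auto
  qed
  then have 1: "fdim K" using finP by (auto simp: fdim_def)
  have "vdim K = card (u ` P)"
    by (rule fv.dim_unique[OF _ span ind refl]) (use u(1) in blast)
  also have "\<dots> = card P" by (rule card_image[OF inju])
  also have "\<dots> = (\<Sum>t\<in>I. card (B t))" using I B(1) by (simp add: P_def card_SigmaI)
  finally show ?thesis using 1 B(5) by simp
qed

lemma vdim_iso:
  assumes "fv.subspace K" "flinear f" "fv.subspace A" "fdim A"
    and "\<And>v. v \<in> K \<Longrightarrow> f v \<in> A" "\<And>v. v \<in> K \<Longrightarrow> f v = 0 \<Longrightarrow> v = 0"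
    and "\<And>a. a \<in> A \<Longrightarrow> \<exists>v\<in>K. f v = a"
  shows "vdim K = vdim A"
  using vdim_family[of K "{()}" "\<lambda>_. f" "\<lambda>_. A"] assms by auto

lemma subspace_kernel:
  assumes "fv.subspace V" "flinear f" shows "fv.subspace {v\<in>V. f v = 0}"
  using assms(1)
  by (auto simp: fv.subspace_def flinear_0[OF assms(2)] flinear_add[OF assms(2)] flinear_scale[OF assms(2)])

lemma fdim_singleton_0: "fdim {0}"
  unfolding fdim_def by (rule exI[of _ "{}"]) auto

text \<open>A right inverse \<open>g\<close> of \<open>f\<close> on its image splits
  \<open>K\<close>: the two coordinates of \<open>v\<close> are \<open>f v\<close> and
  \<open>v - g (f v)\<close>.\<close>

lemma rank_nullity:
  fixes f :: "('i \<Rightarrow> 'k::field) \<Rightarrow> 'i \<Rightarrow> 'k"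
  assumes K: "fv.subspace K" "fdim K" and f: "flinear f"
  shows "vdim K = vdim {v\<in>K. f v = 0} + vdim (f ` K)"
proof -
  obtain g where g: "range g \<subseteq> K" "flinear g" "\<And>v. v \<in> f ` K \<Longrightarrow> f (g v) = v"
    using fvp.linear_exists_right_inverse_on[OF flinear_linear[OF f] K(1)]
    unfolding flinear_iff by blast
  define F where "F = (\<lambda>b::bool. if b then (\<lambda>v. v - g (f v)) else f)"
  define A where "A = (\<lambda>b. if b then {v\<in>K. f v = 0} else f ` K)"
  have "fdim (f ` K)"
  proof -
    obtain B where "finite B" "K \<subseteq> fv.span B" using K(2) unfolding fdim_def by blast
    then show ?thesis unfolding fdim_def
      using fvp.linear_spans_image[OF flinear_linear[OF f], of K B] by (intro exI[of _ "f ` B"]) auto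
  qed
  moreover have "fdim K \<and> vdim K = (\<Sum>b\<in>UNIV. vdim (A b))"
  proof (rule vdim_family[where f = F])
    show "flinear (F t)" for t
      using f flinear_minus[OF flinear_id flinear_compose[OF g(2) f]] by (cases t) (simp_all add: F_def)
    show "fv.subspace (A t)" for t
      using subspace_kernel[OF K(1) f] fvp.linear_subspace_image[OF flinear_linear[OF f] K(1)]
      by (cases t) (simp_all add: A_def)
    show "fdim (A t)" for t
      using fdim_subset[OF K(2)] calculation by (auto simp: A_def)
    show "F t v \<in> A t" if "v \<in> K" for t v
      using that g fv.subspace_diff[OF K(1)] by (auto simp: F_def A_def flinear_diff[OF f])
    show "v = 0" if "v \<in> K" "\<And>t. t \<in> UNIV \<Longrightarrow> F t v = 0" for v
      using that(2)[of True] that(2)[of False] by (auto simp: F_def flinear_0[OF g(2)])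
    show "\<exists>v\<in>K. \<forall>t\<in>UNIV. F t v = a t" if "\<And>t. t \<in> UNIV \<Longrightarrow> a t \<in> A t" for a
    proof
      have a: "a True \<in> K" "f (a True) = 0" "a False \<in> f ` K"
        using that[of True] that[of False] by (auto simp: A_def)
      have "f (a True + g (a False)) = a False"
        using a g(3) by (simp add: flinear_add[OF f])
      then show "\<forall>t\<in>UNIV. F t (a True + g (a False)) = a t"
        using a by (auto simp: F_def)
      show "a True + g (a False) \<in> K"
        using a g(1) by (intro fv.subspace_add[OF K(1)]) auto
    qed
  qed (use K in auto)
  ultimately show ?thesis by (simp add: A_def UNIV_bool)
qed

text \<open>\<open>f\<close> induces an injection of \<open>K\<close> modulo the preimage of
  \<open>M'\<close> into \<open>M\<close> modulo \<open>M'\<close>; the inequality expresses this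
  without quotient spaces and without subtraction of natural numbers.\<close>

lemma vdim_quot_inj:
  fixes f :: "('i \<Rightarrow> 'k::field) \<Rightarrow> 'i \<Rightarrow> 'k"
  assumes K: "fv.subspace K" "fdim K" and M: "fv.subspace M" "fdim M"
    and f: "flinear f" "f ` K \<subseteq> M" and M': "fv.subspace M'" "M' \<subseteq> M"
  shows "vdim K + vdim M' \<le> vdim {v\<in>K. f v \<in> M'} + vdim M"
proof -
  \<comment> \<open>Functions on \<open>bool \<times> 'i\<close> encode pairs from \<open>K\<close>
    and \<open>M'\<close>. The map \<open>G\<close> below adds \<open>f\<close> of the first to the
    second, so its rank and nullity give the claim.\<close>
  define slice where "slice = (\<lambda>b (w::bool \<times> 'i \<Rightarrow> 'k) x. w (b, x))"
  define W where "W = {w. slice True w \<in> K \<and> slice False w \<in> M'}"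
  define A where "A = (\<lambda>b. if b then K else M')"
  have lsl: "flinear (slice b)" for b by (rule flinearI) (auto simp: slice_def fscale_apply)
  note slice = flinear_0[OF lsl] flinear_add[OF lsl] flinear_scale[OF lsl]
  note ff = flinear_0[OF f(1)] flinear_add[OF f(1)] flinear_scale[OF f(1)]
  have sW: "fv.subspace W"
    using K(1) M'(1) by (auto simp: W_def fv.subspace_def slice simp del: plus_fun_apply)
  note fdM' = fdim_subset[OF M(2) M'(2)]
  have ext: "w = 0" if "slice True w = 0" "slice False w = 0" for w
  proof
    fix x show "w x = 0 x"
      using that by (cases x; cases "fst x") (simp_all add: slice_def fun_eq_iff)
  qed
  have W: "fdim W \<and> vdim W = (\<Sum>b\<in>UNIV. vdim (A b))"
  proof (rule vdim_family[where f = slice and K = W and I = UNIV and A = A, OF sW])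
    show "\<exists>v\<in>W. \<forall>t\<in>UNIV. slice t v = a t" if "\<And>t. t \<in> UNIV \<Longrightarrow> a t \<in> A t" for a
      using that[of True] that[of False]
      by (intro bexI[of _ "\<lambda>(b, x). a b x"]) (auto simp: A_def W_def slice_def)
    show "fdim (A t)" for t using K(2) fdM' by (auto simp: A_def)
  qed (use lsl K M' ext in \<open>auto simp: A_def W_def\<close>)
  define G where "G = (\<lambda>w (b, x). if b then f (slice True w) x + slice False w x else 0)"
  have lG: "flinear G"
    by (intro flinearI) (auto simp: G_def slice ff fscale_apply algebra_simps split: prod.splits)
  have slG: "slice True (G w) = f (slice True w) + slice False w" "slice False (G w) = 0" for w
    by (auto simp: G_def slice_def fun_eq_iff)
  have "vdim {w\<in>W. G w = 0} = vdim {v\<in>K. f v \<in> M'}"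
  proof (rule vdim_iso[where f = "slice True"])
    show "fv.subspace {w\<in>W. G w = 0}" by (rule subspace_kernel[OF sW lG])
    show "fv.subspace {v\<in>K. f v \<in> M'}"
      using K(1) M'(1) by (auto simp: fv.subspace_def ff)
    show "fdim {v\<in>K. f v \<in> M'}" by (rule fdim_subset[OF K(2)]) auto
    fix w assume w: "w \<in> {w\<in>W. G w = 0}"
    then have eq: "f (slice True w) = - slice False w"
      using slG(1)[of w] slice(1)[of True] by (simp add: eq_neg_iff_add_eq_0)
    then show "slice True w \<in> {v\<in>K. f v \<in> M'}"
      using w fv.subspace_neg[OF M'(1)] by (auto simp: W_def)
    show "w = 0" if "slice True w = 0"
      using ext[OF that] eq that by (simp add: ff)
  next
    fix a assume a: "a \<in> {v\<in>K. f v \<in> M'}"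
    define w where "w = (\<lambda>(b, x). if b then a x else - f a x)"
    have "slice True w = a" "slice False w = - f a" by (auto simp: w_def slice_def)
    moreover have "G w = 0"
      using ext[of "G w"] calculation by (simp add: slG)
    ultimately show "\<exists>v\<in>{w\<in>W. G w = 0}. slice True v = a"
      using a fv.subspace_neg[OF M'(1)] by (intro bexI[of _ w]) (auto simp: W_def)
  qed (rule lsl)
  moreover have "vdim (G ` W) \<le> vdim M"
  proof -
    have GM: "slice True ` G ` W \<subseteq> M"
    proof clarsimp
      fix w assume w: "w \<in> W"
      then have "f (slice True w) \<in> M" "slice False w \<in> M"
        using f(2) M'(2) by (auto simp: W_def)
      then show "slice True (G w) \<in> M" by (simp add: slG(1) fv.subspace_add[OF M(1)])
    qed
    have "vdim (slice True ` G ` W) = vdim (G ` W)"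
    proof (rule sym, rule vdim_iso[where f = "slice True"])
      show "fv.subspace (slice True ` G ` W)" "fv.subspace (G ` W)"
        using fvp.linear_subspace_image[OF flinear_linear[OF lG] sW]
          fvp.linear_subspace_image[OF flinear_linear[OF lsl]] by blast+
      show "fdim (slice True ` G ` W)" using fdim_subset[OF M(2) GM] .
      show "v = 0" if "v \<in> G ` W" "slice True v = 0" for v using that ext slG(2) by auto
    qed (use lsl in auto)
    then show ?thesis using vdim_mono[OF M(2) GM] by simp
  qed
  ultimately show ?thesis
    using rank_nullity[OF sW _ lG] W by (simp add: A_def UNIV_bool)
qed

lemma vdim_supported:
  fixes B :: "'i set"
  assumes "finite B"
  shows "fdim {v::'i \<Rightarrow> 'k::field. \<forall>x. x \<notin> B \<longrightarrow> v x = 0}"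
    and "vdim {v::'i \<Rightarrow> 'k::field. \<forall>x. x \<notin> B \<longrightarrow> v x = 0} = card B"
proof -
  let ?K = "{v::'i \<Rightarrow> 'k::field. \<forall>x. x \<notin> B \<longrightarrow> v x = 0}"
  \<comment> \<open>The functions on \<open>unit\<close> serve as the one-dimensional space attached
    to each point of \<open>B\<close>.\<close>
  have span1: "UNIV = fv.span {1 :: unit \<Rightarrow> 'k}"
    by (auto simp: fv.span_singleton fun_eq_iff image_iff fscale_apply)
  have "fv.independent {1 :: unit \<Rightarrow> 'k}"
    by (auto simp: fv.dependent_single fun_eq_iff)
  then have d1: "vdim (UNIV :: (unit \<Rightarrow> 'k) set) = 1"
    using span1 fv.dim_unique[of "{1}" UNIV 1] by (metis One_nat_def card.empty card.insert empty_iff finite.emptyI subset_UNIV order_refl)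
  have f1: "fdim (UNIV :: (unit \<Rightarrow> 'k) set)"
    unfolding fdim_def using span1 by (intro exI[of _ "{1 :: unit \<Rightarrow> 'k}"]) auto
  have *: "fdim ?K \<and> vdim ?K = (\<Sum>x\<in>B. vdim (UNIV :: (unit \<Rightarrow> 'k) set))"
    by (rule vdim_family[of ?K B "\<lambda>x v _. v x" "\<lambda>_. UNIV"])
      (use assms f1 in \<open>auto simp: fv.subspace_def fun_eq_iff fscale_apply intro!: flinearI
          exI[of _ "\<lambda>x. if x \<in> B then _ x () else 0"]\<close>)
  then show "fdim ?K" "vdim ?K = card B" using d1 by auto
qed

declare plus_fun_apply [simp del] zero_fun_apply [simp del] minus_apply [simp del] uminus_apply [simp del]

lemmas fun_app = plus_fun_apply zero_fun_apply minus_apply uminus_apply fscale_apply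

section \<open>Nullities of sums of shifts\<close>

type_synonym 'k lfun = "nat list \<Rightarrow> 'k"

definition slice :: "nat \<Rightarrow> 'k lfun \<Rightarrow> 'k lfun" where
  "slice x v = (\<lambda>ys. v (x # ys))"

definition glue :: "(nat \<Rightarrow> 'k::zero lfun) \<Rightarrow> 'k lfun" where
  "glue w = (\<lambda>xs. case xs of [] \<Rightarrow> 0 | x # ys \<Rightarrow> w x ys)"

lemma slice_glue [simp]: "slice x (glue w) = w x" and glue_Nil [simp]: "glue w [] = 0"
  by (auto simp: slice_def glue_def)

lemma flinear_slice: "flinear (slice x)"
  by (rule flinearI) (auto simp: slice_def fun_app)

lemmas slice_lin = flinear_add[OF flinear_slice] flinear_scale[OF flinear_slice] flinear_0[OF flinear_slice]

lemma lfun_Nil [simp]: "(0 :: 'k::zero lfun) [] = 0" "(u + v) [] = u [] + v []" "fscale c w [] = c * w []"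
  by (simp_all add: fun_app)

lemma lfun_eqI:
  assumes "u [] = v []" "\<And>x. slice x u = slice x v"
  shows "u = v"
proof
  fix xs show "u xs = v xs"
    using assms by (cases xs) (auto simp: slice_def fun_eq_iff fun_app)
qed

text \<open>In a list $L$ of pairs, the first components are side lengths of a box and the second
  components are step widths: \<open>shift L\<close> sums the down-shifts by the step widths, and it is
  meant for functions supported in the box. The values of \<open>shift L\<close> at lists that are not of the
  length of $L$ are irrelevant.\<close>

primrec shift :: "(nat \<times> nat) list \<Rightarrow> 'k::field lfun \<Rightarrow> 'k lfun" where
  "shift [] v = 0"
| "shift (a # L) v = glue (\<lambda>x. slice (x + snd a) v + shift L (slice x v))"

declare shift.simps [simp del]

lemma slice_shift [simp]: "slice x (shift (a # L) v) = slice (x + snd a) v + shift L (slice x v)"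
  and shift_Cons_Nil [simp]: "shift (a # L) v [] = 0"
  by (simp_all add: shift.simps)

lemma flinear_shift: "flinear (shift L)"
proof (induction L)
  case Nil
  then show ?case by (intro flinearI) (auto simp: fun_app shift.simps)
next
  case (Cons a L)
  have "shift (a # L) (u + v) = shift (a # L) u + shift (a # L) v" for u v :: "'a lfun"
    by (rule lfun_eqI) (simp_all add: slice_lin flinear_add[OF Cons] add_ac)
  moreover have "shift (a # L) (fscale c v) = fscale c (shift (a # L) v)" for c and v :: "'a lfun"
    by (rule lfun_eqI) (simp_all add: slice_lin flinear_scale[OF Cons] fv.scale_right_distrib)
  ultimately show ?case by (simp add: flinear_def)
qed

lemmas shift_lin = flinear_add[OF flinear_shift] flinear_scale[OF flinear_shift] flinear_0[OF flinear_shift]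
  flinear_uminus[OF flinear_shift]

definition boxfun :: "(nat \<times> nat) list \<Rightarrow> 'k::field lfun set" where
  "boxfun L = {v. \<forall>xs. \<not> list_all2 (\<lambda>a x. x < fst a) L xs \<longrightarrow> v xs = 0}"

lemma boxfun_Cons: "v \<in> boxfun (a # L) \<longleftrightarrow> v [] = 0 \<and> (\<forall>x. slice x v \<in> boxfun L) \<and> (\<forall>x\<ge>fst a. slice x v = 0)"
proof
  assume "v \<in> boxfun (a # L)" then show "v [] = 0 \<and> (\<forall>x. slice x v \<in> boxfun L) \<and> (\<forall>x\<ge>fst a. slice x v = 0)"
    by (auto simp: boxfun_def slice_def fun_eq_iff fun_app)
next
  assume *: "v [] = 0 \<and> (\<forall>x. slice x v \<in> boxfun L) \<and> (\<forall>x\<ge>fst a. slice x v = 0)"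
  show "v \<in> boxfun (a # L)" unfolding boxfun_def
  proof (clarsimp)
    fix xs assume "\<not> list_all2 (\<lambda>a x. x < fst a) (a # L) xs"
    then show "v xs = 0" using *
      by (cases xs) (auto simp: boxfun_def slice_def fun_eq_iff fun_app not_less)
  qed
qed

lemma subspace_boxfun: "fv.subspace (boxfun L)"
  by (auto simp: fv.subspace_def boxfun_def fun_app)

lemma finite_box:
  fixes L :: "(nat \<times> nat) list"
  shows "finite {xs. list_all2 (\<lambda>a x. x < fst a) L xs}"
proof (induction L)
  case (Cons a L)
  have "{xs. list_all2 (\<lambda>a x. x < fst a) (a # L) xs} =
    (\<lambda>(x, xs). x # xs) ` ({..<fst a} \<times> {xs. list_all2 (\<lambda>a x. x < fst a) L xs})"
    by (auto simp: list_all2_Cons1 image_iff)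
  moreover have "finite ({..<fst a} \<times> {xs. list_all2 (\<lambda>a x. x < fst a) L xs})" using Cons.IH by (intro finite_cartesian_product) auto
  ultimately show ?case by (metis (no_types, lifting) finite_imageI)
qed simp

lemma fdim_boxfun: "fdim (boxfun L)"
  using vdim_supported(1)[OF finite_box[of L]] by (simp add: boxfun_def)

lemma shift_boxfun: "v \<in> boxfun L \<Longrightarrow> shift L v \<in> boxfun L"
proof (induction L arbitrary: v)
  case Nil
  show ?case unfolding shift.simps(1) by (rule fv.subspace_0[OF subspace_boxfun])
next
  case (Cons a L)
  then show ?case
    using fv.subspace_add[OF subspace_boxfun[of L]] by (auto simp: boxfun_Cons shift_lin)
qed

lemma shift_funpow_boxfun: "v \<in> boxfun L \<Longrightarrow> (shift L ^^ n) v \<in> boxfun L"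
  by (induction n) (auto intro: shift_boxfun)

text \<open>For step widths 1 and side lengths a_i this is the length of k[x_1,...,x_m] modulo the
  powers x_i^(a_i) and the sum of the x_i: a down-shift is the transpose of multiplication by a
  variable, and for a square matrix the nullity, that of the transpose and the dimension of the
  cokernel agree.\<close>

definition snull :: "'k::field itself \<Rightarrow> (nat \<times> nat) list \<Rightarrow> nat" where
  "snull K L = vdim {v :: 'k lfun. v \<in> boxfun L \<and> shift L v = 0}"

lemma subspace_shift_kernel: "fv.subspace {v. v \<in> boxfun L \<and> shift L v = 0}"
  using subspace_kernel[OF subspace_boxfun flinear_shift] .

lemma fdim_shift_kernel: "fdim {v. v \<in> boxfun L \<and> shift L v = 0}"
  by (rule fdim_subset[OF fdim_boxfun]) auto

lemma fscale_minus_one: "fscale (- 1) v = - v"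
  by (auto simp: fun_app fun_eq_iff)

lemma slice_recursion:
  assumes "flinear T" "\<And>x. w (Suc x) + T (w x) = 0"
  shows "w x = fscale ((- 1) ^ x) ((T ^^ x) (w 0))"
proof (induction x)
  case (Suc x)
  have "w (Suc x) = - T (w x)" using assms(2)[of x] by (simp add: eq_neg_iff_add_eq_0)
  also have "\<dots> = fscale (- 1) (T (fscale ((- 1) ^ x) ((T ^^ x) (w 0))))"
    using Suc by (simp add: fscale_minus_one)
  finally show ?case by (simp add: flinear_scale[OF assms(1)] fv.scale_scale)
qed (simp add: fv.scale_one)

text \<open>Along the first coordinate the kernel equation is a first-order recursion, so slice 0
  determines the function, and the only condition left is that slice \<open>j\<close> vanishes.
  Algebraically, the linear form eliminates one variable.\<close>

lemma snull_power: "snull (K :: 'k::field itself) ((j, 1) # L) = vdim {v :: 'k lfun. v \<in> boxfun L \<and> (shift L ^^ j) v = 0}"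
  unfolding snull_def
proof (rule vdim_iso[where f = "slice 0"])
  let ?T = "shift L :: 'k lfun \<Rightarrow> 'k lfun"
  note lT = flinear_funpow[OF flinear_shift]
  show "fv.subspace {v :: 'k lfun. v \<in> boxfun L \<and> (?T ^^ j) v = 0}"
    using subspace_kernel[OF subspace_boxfun lT] .
  show "fdim {v :: 'k lfun. v \<in> boxfun L \<and> (?T ^^ j) v = 0}"
    by (rule fdim_subset[OF fdim_boxfun]) auto
  fix v :: "'k lfun" assume v: "v \<in> {v. v \<in> boxfun ((j, 1) # L) \<and> shift ((j, 1) # L) v = 0}"
  have rec: "slice (Suc x) v + ?T (slice x v) = 0" for x
  proof -
    have "slice x (shift ((j, 1) # L) v) = 0" using v by (simp add: slice_lin)
    then show ?thesis by simp
  qed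
  have form: "slice x v = fscale ((- 1) ^ x) ((?T ^^ x) (slice 0 v))" for x
    by (rule slice_recursion[OF flinear_shift]) (rule rec)
  have "slice j v = 0" using v by (simp add: boxfun_Cons)
  then have "(?T ^^ j) (slice 0 v) = 0" using form[of j] by (simp add: fv.scale_eq_0_iff)
  then show "slice 0 v \<in> {v. v \<in> boxfun L \<and> (?T ^^ j) v = 0}"
    using v by (simp add: boxfun_Cons)
  show "v = 0" if "slice 0 v = 0"
  proof (rule lfun_eqI)
    show "v [] = (0 :: 'k lfun) []" using v by (simp add: boxfun_Cons)
    show "slice x v = slice x 0" for x
      using form[of x] that by (simp add: flinear_0[OF lT] slice_lin)
  qed
next
  let ?T = "shift L :: 'k lfun \<Rightarrow> 'k lfun"
  note lT = flinear_funpow[OF flinear_shift]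
  fix a :: "'k lfun" assume a: "a \<in> {v. v \<in> boxfun L \<and> (?T ^^ j) v = 0}"
  have z: "(?T ^^ x) a = 0" if "x \<ge> j" for x
  proof -
    have "(?T ^^ x) a = (?T ^^ (x - j)) ((?T ^^ j) a)"
      using that by (simp flip: funpow_add[THEN fun_cong, unfolded o_apply])
    then show ?thesis using a by (simp add: flinear_0[OF lT])
  qed
  define v where "v = glue (\<lambda>x. fscale ((- 1) ^ x) ((?T ^^ x) a))"
  have "v \<in> boxfun ((j, 1) # L)"
    using a z fv.subspace_scale[OF subspace_boxfun shift_funpow_boxfun]
    by (auto simp: v_def boxfun_Cons)
  moreover have "shift ((j, 1) # L) v = 0"
    by (rule lfun_eqI) (simp_all add: v_def shift_lin slice_lin)
  moreover have "slice 0 v = a" by (simp add: v_def fv.scale_one)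
  ultimately show "\<exists>v\<in>{v. v \<in> boxfun ((j, 1) # L) \<and> shift ((j, 1) # L) v = 0}. slice 0 v = a" by blast
qed (use subspace_shift_kernel flinear_slice in auto)

lemma flinear_glue_slices: "flinear (\<lambda>v. glue (\<lambda>x. slice (g x) v))"
  by (rule flinearI) (auto simp: glue_def slice_def fun_app split: list.splits)

text \<open>A step of width \<open>e\<close> keeps the residue \<open>r\<close> of the first
  coordinate modulo \<open>e\<close>, so the kernel splits by residues. The side length
  \<open>(j + e - 1 - r) div e\<close> counts the numbers below \<open>j\<close> of residue
  \<open>r\<close>.\<close>

lemma snull_split:
  assumes e: "e > 0"
  shows "snull (K :: 'k::field itself) ((j, e) # L) = (\<Sum>r<e. snull K (((j + e - 1 - r) div e, 1) # L))"
proof -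
  define f :: "nat \<Rightarrow> 'k lfun \<Rightarrow> 'k lfun" where "f r v = glue (\<lambda>x. slice (e * x + r) v)" for r v
  define A :: "nat \<Rightarrow> 'k lfun set" where
    "A r = (let L' = ((j + e - 1 - r) div e, 1) # L in {v. v \<in> boxfun L' \<and> shift L' v = 0})" for r
  let ?K = "{v :: 'k lfun. v \<in> boxfun ((j, e) # L) \<and> shift ((j, e) # L) v = 0}"
  have ker: "slice (x + e) v + shift L (slice x v) = 0" if "shift ((j, e) # L) v = 0" for x and v :: "'k lfun"
  proof -
    have "slice x (shift ((j, e) # L) v) = 0" using that by (simp add: slice_lin)
    then show ?thesis by simp
  qed
  have cnt: "(j + e - 1 - r) div e \<le> x \<longleftrightarrow> j \<le> e * x + r" if "r < e" for r x
  proof -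
    have "(j + e - 1 - r) div e \<le> x \<longleftrightarrow> (j + e - 1 - r) div e < Suc x" by auto
    also have "\<dots> \<longleftrightarrow> j + e - 1 - r < Suc x * e"
      using e by (simp add: less_mult_imp_div_less div_less_iff_less_mult)
    also have "\<dots> \<longleftrightarrow> j \<le> e * x + r" using that by (auto simp: algebra_simps)
    finally show ?thesis .
  qed
  have "fdim ?K \<and> vdim ?K = (\<Sum>r\<in>{..<e}. vdim (A r))"
  proof (rule vdim_family[where f = f])
    show "fv.subspace ?K" by (rule subspace_shift_kernel)
    show "flinear (f t)" for t unfolding f_def by (rule flinear_glue_slices)
    show "fv.subspace (A t)" "fdim (A t)" for t
      by (auto simp: A_def Let_def subspace_shift_kernel fdim_shift_kernel simp del: One_nat_def)
    show "f t v \<in> A t" if "t \<in> {..<e}" "v \<in> ?K" for t v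
    proof -
      have "shift (((j + e - 1 - t) div e, 1) # L) (f t v) = 0"
      proof (rule lfun_eqI)
        fix x
        show "slice x (shift (((j + e - 1 - t) div e, 1) # L) (f t v)) = slice x 0"
          using ker[of v "e * x + t"] that(2) by (simp add: f_def slice_lin ac_simps)
      qed simp
      then show ?thesis
        using that cnt[of t] by (simp add: A_def boxfun_Cons Let_def f_def)
    qed
    show "v = 0" if "v \<in> ?K" "\<And>t. t \<in> {..<e} \<Longrightarrow> f t v = 0" for v
    proof (rule lfun_eqI)
      show "v [] = (0 :: 'k lfun) []" using that(1) by (simp add: boxfun_Cons)
      fix x
      have "slice (x div e) (f (x mod e) v) = 0" using that(2)[of "x mod e"] e by (simp add: slice_lin)
      then show "slice x v = slice x 0" by (simp add: f_def slice_lin)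
    qed
    show "\<exists>v\<in>?K. \<forall>t\<in>{..<e}. f t v = a t" if a: "\<And>t. t \<in> {..<e} \<Longrightarrow> a t \<in> A t" for a
    proof (intro bexI ballI)
      let ?v = "glue (\<lambda>x. slice (x div e) (a (x mod e)))"
      have a': "a (x mod e) \<in> boxfun (((j + e - 1 - x mod e) div e, 1) # L)"
          "shift (((j + e - 1 - x mod e) div e, 1) # L) (a (x mod e)) = 0" for x
        using a[of "x mod e"] e by (auto simp: A_def Let_def)
      show "f t ?v = a t" if "t \<in> {..<e}" for t
      proof (rule lfun_eqI)
        show "f t ?v [] = a t []" using a'(1)[of t] that by (simp add: f_def boxfun_Cons)
        show "slice x (f t ?v) = slice x (a t)" for x using that by (simp add: f_def)
      qed
      have rec: "slice (Suc x) (a (y mod e)) + shift L (slice x (a (y mod e))) = 0" for x y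
      proof -
        have "slice x (shift (((j + e - 1 - y mod e) div e, 1) # L) (a (y mod e))) = 0"
          by (simp only: a'(2) slice_lin)
        then show ?thesis by simp
      qed
      have "?v \<in> boxfun ((j, e) # L)"
        using a'(1) cnt[of "_ mod e"] e by (simp add: boxfun_Cons)
      moreover have "shift ((j, e) # L) ?v = 0"
      proof (rule lfun_eqI)
        show "slice x (shift ((j, e) # L) ?v) = slice x 0" for x
          using rec[of "x div e" x] e by (simp add: slice_lin)
      qed simp
      ultimately show "?v \<in> ?K" by blast
    qed
  qed simp
  then show ?thesis by (simp add: snull_def A_def Let_def)
qed

text \<open>Lists that are too short are left alone, which makes this an involution on all
  functions.\<close>

definition cswap :: "nat \<Rightarrow> 'k lfun \<Rightarrow> 'k lfun" where
  "cswap n v = (\<lambda>xs. v (if Suc n < length xs then xs[n := xs ! Suc n, Suc n := xs ! n] else xs))"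

lemma flinear_cswap: "flinear (cswap n)"
  by (rule flinearI) (auto simp: cswap_def fun_app)

lemma cswap_cswap: "cswap n (cswap n v) = v"
proof
  fix xs :: "nat list"
  have "(xs[n := xs ! Suc n, Suc n := xs ! n])[n := xs[n := xs ! Suc n, Suc n := xs ! n] ! Suc n,
      Suc n := xs[n := xs ! Suc n, Suc n := xs ! n] ! n] = xs" if "Suc n < length xs"
    using that by (intro nth_equalityI) (auto simp: nth_list_update)
  then show "cswap n (cswap n v) xs = v xs" by (auto simp: cswap_def)
qed

lemma slice_cswap_Suc: "slice x (cswap (Suc n) v) = cswap n (slice x v)"
  by (auto simp: slice_def cswap_def fun_eq_iff)

lemma slice_slice_cswap_0: "slice y (slice x (cswap 0 v)) = slice x (slice y v)"
  by (auto simp: slice_def cswap_def fun_eq_iff)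

lemma cswap_Nil: "cswap n v [] = v []"
  by (simp add: cswap_def)

lemma cswap_0_single: "cswap 0 v [x] = v [x]"
  by (simp add: cswap_def)

lemma cswap_shift:
  fixes v :: "'k::field lfun"
  assumes "v \<in> boxfun (P @ a # b # L)"
  shows "cswap (length P) v \<in> boxfun (P @ b # a # L) \<and>
    shift (P @ b # a # L) (cswap (length P) v) = cswap (length P) (shift (P @ a # b # L) v)"
  using assms
proof (induction P arbitrary: v)
  case Nil
  have z: "v [x] = 0" "v [] = 0" for x using Nil by (auto simp: boxfun_def)
  have boxfun: "cswap 0 v \<in> boxfun (b # a # L)"
    unfolding boxfun_Cons slice_slice_cswap_0 cswap_Nil
  proof (intro conjI allI impI)
    show "v [] = 0" by (rule z)
    show "slice x (cswap 0 v) [] = 0" for x using z by (simp add: slice_def cswap_0_single)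
    show "slice x (slice y v) \<in> boxfun L" for x y using Nil by (simp add: boxfun_Cons)
    show "slice x (slice y v) = 0" if "y \<ge> fst a" for x y using Nil that by (simp add: boxfun_Cons slice_lin)
    show "slice y (cswap 0 v) = 0" if "y \<ge> fst b" for y
    proof (rule lfun_eqI)
      show "slice y (cswap 0 v) [] = (0 :: 'k lfun) []" using z by (simp add: slice_def cswap_0_single)
      show "slice x (slice y (cswap 0 v)) = slice x 0" for x
        using Nil that by (simp add: slice_slice_cswap_0 boxfun_Cons slice_lin)
    qed
  qed
  have "shift (b # a # L) (cswap 0 v) = cswap 0 (shift (a # b # L) v)"
  proof (rule lfun_eqI)
    show "shift (b # a # L) (cswap 0 v) [] = cswap 0 (shift (a # b # L) v) []" by (simp add: cswap_Nil)
    show "slice x (shift (b # a # L) (cswap 0 v)) = slice x (cswap 0 (shift (a # b # L) v))" for x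
    proof (rule lfun_eqI)
      show "slice x (shift (b # a # L) (cswap 0 v)) [] = slice x (cswap 0 (shift (a # b # L) v)) []"
        using z by (simp add: cswap_0_single slice_def shift.simps glue_def)
      show "slice y (slice x (shift (b # a # L) (cswap 0 v))) = slice y (slice x (cswap 0 (shift (a # b # L) v)))" for y
        unfolding slice_slice_cswap_0 by (simp add: slice_lin slice_slice_cswap_0)
    qed
  qed
  then show ?case using boxfun by simp
next
  case (Cons c P)
  have "slice x v \<in> boxfun (P @ a # b # L)" for x using Cons.prems by (simp add: boxfun_Cons)
  note IH = Cons.IH[OF this]
  have "cswap (length (c # P)) v \<in> boxfun ((c # P) @ b # a # L)"
    using Cons.prems IH by (auto simp: boxfun_Cons slice_cswap_Suc cswap_Nil flinear_0[OF flinear_cswap])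
  moreover have "shift ((c # P) @ b # a # L) (cswap (length (c # P)) v) = cswap (length (c # P)) (shift ((c # P) @ a # b # L) v)"
    by (rule lfun_eqI) (use IH in \<open>simp_all add: slice_cswap_Suc cswap_Nil flinear_add[OF flinear_cswap]\<close>)
  ultimately show ?case by blast
qed

lemma snull_swap: "snull (K :: 'k::field itself) (P @ a # b # L) = snull K (P @ b # a # L)"
  unfolding snull_def
proof (rule vdim_iso[where f = "cswap (length P)"])
  fix v :: "'k lfun"
  show "cswap (length P) v \<in> {v. v \<in> boxfun (P @ b # a # L) \<and> shift (P @ b # a # L) v = 0}"
    if "v \<in> {v. v \<in> boxfun (P @ a # b # L) \<and> shift (P @ a # b # L) v = 0}"
    using that cswap_shift[of v P a b L] by (auto simp: flinear_0[OF flinear_cswap])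
  show "v = 0" if "cswap (length P) v = 0"
    using that cswap_cswap[of "length P" v] by (simp add: flinear_0[OF flinear_cswap])
  show "\<exists>w\<in>{v. v \<in> boxfun (P @ a # b # L) \<and> shift (P @ a # b # L) v = 0}. cswap (length P) w = v"
    if "v \<in> {v. v \<in> boxfun (P @ b # a # L) \<and> shift (P @ b # a # L) v = 0}"
    using that cswap_shift[of v P b a L]
    by (intro bexI[of _ "cswap (length P) v"]) (auto simp: flinear_0[OF flinear_cswap] cswap_cswap)
qed (use subspace_shift_kernel fdim_shift_kernel flinear_cswap in auto)

lemma swap_invariant_perm:
  fixes f :: "'a list \<Rightarrow> 'b"
  assumes sw: "\<And>P a b L. f (P @ a # b # L) = f (P @ b # a # L)" and "mset L = mset L'"
  shows "f L = f L'"
proof -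
  have mv: "f (P @ A @ x # B) = f (P @ x # A @ B)" for P A x B
  proof (induction A arbitrary: P)
    case (Cons a A)
    show ?case using Cons[of "P @ [a]"] sw[of P a x "A @ B"] by simp
  qed simp
  have "f (P @ L) = f (P @ L')" for P
    using assms(2)
  proof (induction L arbitrary: L' P)
    case (Cons a l)
    then have "a \<in> set L'" by (metis list.set_intros(1) set_mset_mset)
    then obtain A B where L': "L' = A @ a # B" by (meson split_list)
    with Cons.prems have "mset l = mset (A @ B)" by simp
    from Cons.IH[OF this, of "P @ [a]"] show ?case using mv[of P A a B] by (simp add: L')
  qed simp
  from this[of "[]"] show ?thesis by simp
qed

lemma snull_perm: "mset L = mset L' \<Longrightarrow> snull K L = snull K L'"
  using swap_invariant_perm[of "snull K", OF snull_swap] .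

text \<open>The binomial theorem for two commuting summands: the move along the first coordinate and
  \<open>shift L\<close>.\<close>

lemma slice_shift_funpow:
  "slice x ((shift (a # L) ^^ n) v) =
    (\<Sum>t\<le>n. fscale (of_nat (n choose t)) ((shift L ^^ (n - t)) (slice (x + snd a * t) v)))"
proof (induction n arbitrary: x)
  case 0
  then show ?case by (simp add: fv.scale_one)
next
  case (Suc n)
  let ?g = "\<lambda>n t. (shift L ^^ (n - t)) (slice (x + snd a * t) v)"
  have "slice x ((shift (a # L) ^^ Suc n) v) =
     slice (x + snd a) ((shift (a # L) ^^ n) v) + shift L (slice x ((shift (a # L) ^^ n) v))"
    by simp
  also have "slice (x + snd a) ((shift (a # L) ^^ n) v) =
      (\<Sum>t\<le>n. fscale (of_nat (n choose t)) (?g (Suc n) (Suc t)))"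
    unfolding Suc by (simp add: algebra_simps)
  also have "shift L (slice x ((shift (a # L) ^^ n) v)) =
      (\<Sum>t\<le>n. fscale (of_nat (n choose t)) (?g (Suc n) t))"
    unfolding Suc fvp.linear_sum[OF flinear_linear[OF flinear_shift]] shift_lin
    by (intro sum.cong refl) (simp add: Suc_diff_le)
  also have "(\<Sum>t\<le>n. fscale (of_nat (n choose t)) (?g (Suc n) t)) =
      ?g (Suc n) 0 + (\<Sum>t\<le>n. fscale (of_nat (n choose Suc t)) (?g (Suc n) (Suc t)))"
    (is "?l = ?r")
  proof -
    have "?l = (\<Sum>t\<le>Suc n. fscale (of_nat (n choose t)) (?g (Suc n) t))"
      by (simp add: binomial_eq_0)
    also have "\<dots> = ?r"
      by (subst sum.atMost_Suc_shift) (simp add: fv.scale_one)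
    finally show ?thesis .
  qed
  finally have "slice x ((shift (a # L) ^^ Suc n) v) = ?g (Suc n) 0 +
     (\<Sum>t\<le>n. fscale (of_nat (n choose t)) (?g (Suc n) (Suc t)) + fscale (of_nat (n choose Suc t)) (?g (Suc n) (Suc t)))"
    by (simp add: sum.distrib algebra_simps)
  also have "\<dots> = (\<Sum>t\<le>Suc n. fscale (of_nat (Suc n choose t)) (?g (Suc n) t))"
    by (subst sum.atMost_Suc_shift) (simp add: fv.scale_one fv.scale_left_distrib)
  finally show ?case .
qed

definition dilate :: "nat \<Rightarrow> (nat \<times> nat) list \<Rightarrow> (nat \<times> nat) list" where
  "dilate p L = map (\<lambda>a. (fst a, p * snd a)) L"

lemma boxfun_dilate: "boxfun (dilate p L) = boxfun L"
  by (simp add: boxfun_def dilate_def list_all2_map1)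

text \<open>Freshman's dream: the inner binomial coefficients vanish in \<open>'k\<close>, which
  leaves the \<open>p\<close>-fold step of each coordinate.\<close>

lemma shift_frobenius:
  assumes p: "prime p" "CHAR('k::field) = p"
  shows "(shift L ^^ p) (v :: 'k lfun) = shift (dilate p L) v"
proof (induction L arbitrary: v)
  case Nil
  \<comment> \<open>For the empty list the shift is 0, and its \<open>p\<close>-th power is 0 only
    because \<open>p\<close> is positive.\<close>
  have "p = Suc (p - 1)" using prime_gt_0_nat[OF p(1)] by simp
  then have "(shift [] ^^ p) v = shift [] ((shift [] ^^ (p - 1)) v)" by (metis comp_apply funpow.simps(2))
  then show ?case by (metis dilate_def list.map(1) shift.simps(1))
next
  case (Cons a L)
  have p': "p = Suc (p - 1)" using prime_gt_0_nat[OF p(1)] by simp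
  have ch: "of_nat (p choose t) = (0 :: 'k)" if "0 < t" "t < p" for t
    using that p dvd_choose_prime[of t p] by (simp add: of_nat_eq_0_iff_char_dvd)
  show ?case
  proof (rule lfun_eqI)
    have "(shift (a # L) ^^ p) v = shift (a # L) ((shift (a # L) ^^ (p - 1)) v)"
      using p' by (metis comp_apply funpow.simps(2))
    then show "(shift (a # L) ^^ p) v [] = shift (dilate p (a # L)) v []" by (simp add: dilate_def)
    fix x
    have "slice x ((shift (a # L) ^^ p) v) = (\<Sum>t\<in>{0, p}. fscale (of_nat (p choose t)) ((shift L ^^ (p - t)) (slice (x + snd a * t) v)))"
      unfolding slice_shift_funpow using ch
      by (intro sum.mono_neutral_right) (auto simp: fv.scale_zero_left)
    also have "\<dots> = slice x (shift (dilate p (a # L)) v)"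
      using p' Cons by (simp add: fv.scale_one dilate_def algebra_simps)
    finally show "slice x ((shift (a # L) ^^ p) v) = slice x (shift (dilate p (a # L)) v)" .
  qed
qed

text \<open>By \<open>snull_power\<close> the side divisible by \<open>p\<close> is an exponent; its
  factor \<open>p\<close> is absorbed by the Frobenius, which enlarges the other step
  widths.\<close>

lemma snull_frobenius:
  assumes "prime p" "CHAR('k::field) = p"
  shows "snull (K :: 'k itself) ((p * j, 1) # L) = snull K ((j, 1) # dilate p L)"
proof -
  have "shift L ^^ (p * j) = (shift (dilate p L) :: 'k lfun \<Rightarrow> 'k lfun) ^^ j"
    using shift_frobenius[OF assms, of L] by (metis ext funpow_mult)
  then show ?thesis unfolding snull_power by (simp add: boxfun_dilate)
qed

text \<open>Step width \<open>p\<close> makes the nullity affine in the remainder \<open>r\<close>,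
  both endpoints \<open>r = 0\<close> and \<open>r = p\<close> included; the interpolation terms
  below come from this.\<close>

lemma snull_split_residues:
  assumes "p > 0" "r \<le> p"
  shows "snull K ((p * b + r, p) # L) = r * snull K ((b + 1, 1) # L) + (p - r) * snull K ((b, 1) # L)"
proof -
  have "(p * b + r + p - 1 - t) div p = (if t < r then b + 1 else b)" if "t < p" for t
  proof (cases "t < r")
    case True
    then have "p * b + r + p - 1 - t = p * (b + 1) + (r - 1 - t)" using assms that by simp
    also have "\<dots> div p = b + 1" using assms True by (intro div_nat_eqI) auto
    finally show ?thesis using True by simp
  next
    case False
    then have "p * b + r + p - 1 - t = p * b + (p - 1 - (t - r))" using assms that by simp
    also have "\<dots> div p = b" using assms by (simp add: div_nat_eqI)
    finally show ?thesis using False by simp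
  qed
  then have "snull K ((p * b + r, p) # L) = (\<Sum>t<p. if t < r then snull K ((b + 1, 1) # L) else snull K ((b, 1) # L))"
    unfolding snull_split[OF assms(1)] by (intro sum.cong) auto
  also have "\<dots> = (\<Sum>t\<in>{..<p} \<inter> {t. t < r}. snull K ((b + 1, 1) # L)) + (\<Sum>t\<in>{..<p} \<inter> - {t. t < r}. snull K ((b, 1) # L))"
    by (subst sum.If_cases) auto
  also have "{..<p} \<inter> {t. t < r} = {..<r}" using assms by auto
  also have "{..<p} \<inter> - {t. t < r} = {r..<p}" using assms by auto
  finally show ?thesis by simp
qed

text \<open>A Clebsch-Gordan rule. With T the shift along \<open>L\<close> and v0, v1 the slices
  over the side of length 2, the kernel of the \<open>i\<close>-th power is given by T^i v1 = 0 and
  T^i v0 + i T^(i-1) v1 = 0. As \<open>i\<close> is invertible, v0 and T v0 + i v1 are independent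
  coordinates, ranging over the kernels of T^(i+1) and T^(i-1). Used for two different sides it
  yields the wave equation.\<close>

lemma snull_wave:
  assumes i: "of_nat i \<noteq> (0 :: 'k::field)"
  shows "snull (K :: 'k itself) ((2, 1) # (i, 1) # L) = snull K ((i + 1, 1) # L) + snull K ((i - 1, 1) # L)"
proof -
  let ?T = "shift L :: 'k lfun \<Rightarrow> 'k lfun" and ?L = "(2, 1) # L"
  have i0: "i = Suc (i - 1)" using i by (cases i) auto
  have "snull K ((2, 1) # (i, 1) # L) = snull K ((i, 1) # ?L)" by (rule snull_perm) simp
  also have "\<dots> = vdim {v :: 'k lfun. v \<in> boxfun ?L \<and> (shift ?L ^^ i) v = 0}" by (rule snull_power)
  also have "\<dots> = (\<Sum>c\<in>(UNIV :: bool set). vdim {u :: 'k lfun. u \<in> boxfun L \<and> (?T ^^ (if c then i + 1 else i - 1)) u = 0})"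
  proof -
    define f where "f c v = (if c then slice 0 v else ?T (slice 0 v) + fscale (of_nat i) (slice 1 v))" for c :: bool and v
    let ?K = "{v :: 'k lfun. v \<in> boxfun ?L \<and> (shift ?L ^^ i) v = 0}"
    let ?A = "\<lambda>c. {u :: 'k lfun. u \<in> boxfun L \<and> (?T ^^ (if c then i + 1 else i - 1)) u = 0}"
    note lT = flinear_funpow[OF flinear_shift]
    have pw: "slice 0 ((shift ?L ^^ i) v) = (?T ^^ i) (slice 0 v) + fscale (of_nat i) ((?T ^^ (i - 1)) (slice 1 v))"
      "slice 1 ((shift ?L ^^ i) v) = (?T ^^ i) (slice 1 v)" "slice (Suc (Suc x)) ((shift ?L ^^ i) v) = 0" "(shift ?L ^^ i) v [] = 0"
      if "v \<in> boxfun ?L" for v :: "'k lfun" and x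
    proof -
      have z: "slice x v = 0" if "x \<ge> 2" for x using \<open>v \<in> boxfun ?L\<close> that by (simp add: boxfun_Cons)
      have z': "(?T ^^ n) (slice x v) = 0" if "x \<ge> 2" for x n using z[OF that] by (simp add: flinear_0[OF lT])
      have "slice 0 ((shift ?L ^^ i) v) = (\<Sum>t\<in>{0, 1}. fscale (of_nat (i choose t)) ((?T ^^ (i - t)) (slice t v)))"
        unfolding slice_shift_funpow using i0 z'
        by (intro sum.mono_neutral_cong_right) (auto simp: fv.scale_zero_right)
      then show "slice 0 ((shift ?L ^^ i) v) = (?T ^^ i) (slice 0 v) + fscale (of_nat i) ((?T ^^ (i - 1)) (slice 1 v))"
        by (simp add: fv.scale_one)
      have "slice 1 ((shift ?L ^^ i) v) = (\<Sum>t\<in>{0}. fscale (of_nat (i choose t)) ((?T ^^ (i - t)) (slice (1 + t) v)))"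
        unfolding slice_shift_funpow using z'
        by (intro sum.mono_neutral_cong_right) (auto simp: fv.scale_zero_right)
      then show "slice 1 ((shift ?L ^^ i) v) = (?T ^^ i) (slice 1 v)" by (simp add: fv.scale_one)
      show "slice (Suc (Suc x)) ((shift ?L ^^ i) v) = 0"
        unfolding slice_shift_funpow using z' by (intro sum.neutral) (auto simp: fv.scale_zero_right)
      show "(shift ?L ^^ i) v [] = 0" using shift_funpow_boxfun[OF that] by (simp add: boxfun_Cons)
    qed
    have lf: "flinear (f c)" for c
      by (cases c) (auto simp: f_def flinear_def slice_lin shift_lin fv.scale_right_distrib fv.scale_left_commute algebra_simps)
    have comm: "(?T ^^ n) (?T u) = (?T ^^ Suc n) u" for n u by (simp add: funpow_swap1)
    have TTi: "(?T ^^ i) u = (?T ^^ (i - 1)) (?T u)" for u using i0 comm by metis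
    have "fdim ?K \<and> vdim ?K = (\<Sum>c\<in>UNIV. vdim (?A c))"
    proof (rule vdim_family[where f = f])
      show "fv.subspace ?K" by (rule subspace_kernel[OF subspace_boxfun lT])
      show "fv.subspace (?A t)" for t by (rule subspace_kernel[OF subspace_boxfun lT])
      show "fdim (?A t)" for t by (rule fdim_subset[OF fdim_boxfun]) auto
      show "flinear (f t)" for t by (rule lf)
      show "f t v \<in> ?A t" if v: "v \<in> ?K" for t v
      proof -
        have boxfun: "slice 0 v \<in> boxfun L" "slice 1 v \<in> boxfun L" using v by (auto simp: boxfun_Cons)
        have e: "(?T ^^ i) (slice 0 v) + fscale (of_nat i) ((?T ^^ (i - 1)) (slice 1 v)) = 0" "(?T ^^ i) (slice 1 v) = 0"
          using v pw[of v] by (auto simp: slice_lin)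
        have "(?T ^^ (i - 1)) (f False v) = 0"
          using e(1) by (simp add: f_def flinear_add[OF lT] flinear_scale[OF lT] TTi)
        moreover have "(?T ^^ (i + 1)) (slice 0 v) = 0"
        proof -
          have "?T ((?T ^^ i) (slice 0 v) + fscale (of_nat i) ((?T ^^ (i - 1)) (slice 1 v))) = 0" using e(1) by (simp add: shift_lin)
          moreover have "?T ((?T ^^ (i - 1)) (slice 1 v)) = (?T ^^ i) (slice 1 v)" by (subst (2) i0) simp
          ultimately show ?thesis using e(2) by (simp add: shift_lin fv.scale_zero_right)
        qed
        ultimately show ?thesis
          using fv.subspace_add[OF subspace_boxfun shift_boxfun[OF boxfun(1)] fv.subspace_scale[OF subspace_boxfun boxfun(2)]] boxfun
          by (cases t) (simp_all add: f_def)
      qed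
      show "v = 0" if v: "v \<in> ?K" "\<And>t. t \<in> UNIV \<Longrightarrow> f t v = 0" for v
      proof (rule lfun_eqI)
        have "slice 0 v = 0" using v(2)[of True] by (simp add: f_def)
        moreover have "slice 1 v = 0"
          using v(2)[of False] i calculation by (simp add: f_def shift_lin fv.scale_eq_0_iff)
        ultimately show "slice x v = slice x 0" for x
          using v(1) by (cases "x \<ge> 2"; cases "x = 0"; cases "x = 1") (auto simp: boxfun_Cons slice_lin)
      qed (use v in \<open>simp add: boxfun_Cons fun_app\<close>)
      show "\<exists>v\<in>?K. \<forall>t\<in>UNIV. f t v = a t" if a: "\<And>t. t \<in> UNIV \<Longrightarrow> a t \<in> ?A t" for a
      proof -
        define u1 where "u1 = fscale (1 / of_nat i) (a False - ?T (a True))"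
        define v where "v = glue (\<lambda>x. if x = 0 then a True else if x = 1 then u1 else 0)"
        have aa: "a True \<in> boxfun L" "a False \<in> boxfun L" "(?T ^^ (i + 1)) (a True) = 0" "(?T ^^ (i - 1)) (a False) = 0"
          using a[of True] a[of False] by auto
        have "u1 \<in> boxfun L" unfolding u1_def
          by (intro fv.subspace_scale[OF subspace_boxfun] fv.subspace_diff[OF subspace_boxfun] aa shift_boxfun)
        then have v: "v \<in> boxfun ?L"
          using aa fv.subspace_0[OF subspace_boxfun] by (auto simp: v_def boxfun_Cons)
        have iu: "fscale (of_nat i) u1 = a False - ?T (a True)"
          using i by (simp add: u1_def fv.scale_scale fv.scale_one)
        have sv: "slice 0 v = a True" "slice 1 v = u1" by (auto simp: v_def)
        have "(?T ^^ i) (fscale (of_nat i) u1) = ?T ((?T ^^ (i - 1)) (a False)) - (?T ^^ (i + 1)) (a True)"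
          unfolding iu flinear_diff[OF lT] using i0 comm by (metis Suc_eq_plus1 comp_apply funpow.simps(2))
        then have "fscale (of_nat i) ((?T ^^ i) u1) = 0"
          using aa by (simp add: flinear_scale[OF lT] shift_lin)
        then have 1: "(?T ^^ i) u1 = 0" using i by (simp add: fv.scale_eq_0_iff)
        have 0: "(?T ^^ i) (a True) + fscale (of_nat i) ((?T ^^ (i - 1)) u1) = 0"
        proof -
          have "fscale (of_nat i) ((?T ^^ (i - 1)) u1) = (?T ^^ (i - 1)) (fscale (of_nat i) u1)"
            by (simp add: flinear_scale[OF lT])
          also have "\<dots> = - (?T ^^ i) (a True)"
            using aa unfolding iu flinear_diff[OF lT] TTi by simp
          finally show ?thesis by simp
        qed
        have "(shift ?L ^^ i) v = 0"
        proof (rule lfun_eqI)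
          show "slice x ((shift ?L ^^ i) v) = slice x 0" for x
          proof -
            consider "x = 0" | "x = 1" | y where "x = Suc (Suc y)" by (metis One_nat_def not0_implies_Suc)
            then show ?thesis using pw[OF v] 0 1 sv by cases (simp_all add: slice_lin)
          qed
        qed (use pw[OF v] in simp)
        moreover have "f t v = a t" for t
          using sv iu by (cases t) (simp_all add: f_def)
        ultimately show ?thesis using v by blast
      qed
    qed simp
    then show ?thesis by simp
  qed
  also have "\<dots> = snull K ((i + 1, 1) # L) + snull K ((i - 1, 1) # L)"
    unfolding snull_power by (simp add: UNIV_bool)
  finally show ?thesis .
qed

section \<open>Operators on an initial segment of the coordinates\<close>

text \<open>The first $i$ coordinates carry a sign: \<open>XX i\<close> is the sum of their down-shifts with the signs
  that make its square the sum of the double down-shifts, and \<open>parity i e\<close> projects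
  to the part on which the sum of the first $i$ coordinates has the parity of $e$. \<open>ZZ i L\<close> applies \<open>shift L\<close>
  to the remaining coordinates.\<close>

primrec sliceat :: "nat \<Rightarrow> nat \<Rightarrow> 'k::field lfun \<Rightarrow> 'k lfun" where
  "sliceat 0 x v = slice x v"
| "sliceat (Suc i) x v = glue (\<lambda>y. sliceat i x (slice y v))"

primrec glueat :: "nat \<Rightarrow> (nat \<Rightarrow> 'k::field lfun) \<Rightarrow> 'k lfun" where
  "glueat 0 w = glue w"
| "glueat (Suc i) w = glue (\<lambda>y. glueat i (\<lambda>x. slice y (w x)))"

primrec ZZ :: "nat \<Rightarrow> (nat \<times> nat) list \<Rightarrow> 'k::field lfun \<Rightarrow> 'k lfun" where
  "ZZ 0 L v = shift L v"
| "ZZ (Suc i) L v = glue (\<lambda>y. ZZ i L (slice y v))"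

primrec XX :: "nat \<Rightarrow> 'k::field lfun \<Rightarrow> 'k lfun" where
  "XX 0 v = 0"
| "XX (Suc i) v = glue (\<lambda>y. slice (Suc y) v + fscale ((- 1) ^ y) (XX i (slice y v)))"

primrec parity :: "nat \<Rightarrow> nat \<Rightarrow> 'k::field lfun \<Rightarrow> 'k lfun" where
  "parity 0 e v = (if even e then v else 0)"
| "parity (Suc i) e v = glue (\<lambda>y. parity i (e + y) (slice y v))"

declare sliceat.simps [simp del] glueat.simps [simp del] ZZ.simps [simp del] XX.simps [simp del] parity.simps [simp del]

lemma slice_Suc_ops [simp]:
  "slice y (sliceat (Suc i) x v) = sliceat i x (slice y v)"
  "slice y (glueat (Suc i) w) = glueat i (\<lambda>x. slice y (w x))"
  "slice y (ZZ (Suc i) L v) = ZZ i L (slice y v)"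
  "slice y (XX (Suc i) v) = slice (Suc y) v + fscale ((- 1) ^ y) (XX i (slice y v))"
  "slice y (parity (Suc i) e v) = parity i (e + y) (slice y v)"
  by (simp_all add: sliceat.simps glueat.simps ZZ.simps XX.simps parity.simps)

lemma Suc_ops_Nil [simp]:
  "sliceat (Suc i) x v [] = 0" "glueat (Suc i) w [] = 0" "ZZ (Suc i) L v [] = 0" "XX (Suc i) v [] = 0"
  "parity (Suc i) e v [] = 0"
  by (simp_all add: sliceat.simps glueat.simps ZZ.simps XX.simps parity.simps)

lemma lfun_linearI:
  assumes "\<And>u v. f (u + v) [] = f u [] + f v []" "\<And>c v. f (fscale c v) [] = c * f v []"
    and "\<And>y. flinear (\<lambda>v. slice y (f v))"
  shows "flinear f"
  unfolding flinear_def
proof (intro conjI allI)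
  show "f (u + v) = f u + f v" for u v
    using flinear_add[OF assms(3)] by (intro lfun_eqI[of "f (u + v)"]) (simp_all add: assms slice_lin)
  show "f (fscale c v) = fscale c (f v)" for c v
    using flinear_scale[OF assms(3)] by (intro lfun_eqI[of "f (fscale c v)"]) (simp_all add: assms slice_lin)
qed

lemma flinear_sliceat: "flinear (sliceat i x)"
proof (induction i)
  case 0
  show ?case using flinear_slice[of x] by (simp add: sliceat.simps)
next
  case (Suc i)
  show ?case
    by (rule lfun_linearI) (simp_all add: flinear_compose[OF Suc flinear_slice])
qed

lemma flinear_ZZ: "flinear (ZZ i L)"
proof (induction i)
  case 0
  show ?case using flinear_shift[of L] by (simp add: ZZ.simps)
next
  case (Suc i)
  show ?case
    by (rule lfun_linearI) (simp_all add: flinear_compose[OF Suc flinear_slice])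
qed

lemma flinear_zero: "flinear (\<lambda>v. 0)"
  by (simp add: flinear_def fv.scale_zero_right)

lemma flinear_fscale: "flinear f \<Longrightarrow> flinear (\<lambda>v. fscale c (f v))"
  by (simp add: flinear_def fv.scale_right_distrib fv.scale_left_commute)

lemma flinear_XX: "flinear (XX i)"
proof (induction i)
  case 0
  show ?case using flinear_zero by (simp add: XX.simps)
next
  case (Suc i)
  show ?case
    by (rule lfun_linearI)
      (simp_all add: flinear_plus[OF flinear_slice flinear_fscale[OF flinear_compose[OF Suc flinear_slice]]])
qed

lemma flinear_parity: "flinear (parity i e)"
proof (induction i arbitrary: e)
  case 0
  show ?case using flinear_zero flinear_id by (cases "even e") (simp_all add: parity.simps)
next
  case (Suc i)
  show ?case
    by (rule lfun_linearI) (simp_all add: flinear_compose[OF Suc flinear_slice])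
qed

lemmas op_lin =
  flinear_add[OF flinear_sliceat] flinear_scale[OF flinear_sliceat] flinear_0[OF flinear_sliceat]
  flinear_add[OF flinear_ZZ] flinear_scale[OF flinear_ZZ] flinear_0[OF flinear_ZZ]
  flinear_add[OF flinear_XX] flinear_scale[OF flinear_XX] flinear_0[OF flinear_XX]
  flinear_add[OF flinear_parity] flinear_scale[OF flinear_parity] flinear_0[OF flinear_parity]

lemma ops_boxfun:
  assumes "v \<in> boxfun (R @ L)"
  shows "ZZ (length R) L v \<in> boxfun (R @ L)" "XX (length R) v \<in> boxfun (R @ L)" "parity (length R) e v \<in> boxfun (R @ L)"
proof -
  show "ZZ (length R) L v \<in> boxfun (R @ L)" using assms
    by (induction R arbitrary: v) (auto simp: ZZ.simps(1) shift_boxfun boxfun_Cons op_lin)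
  show "XX (length R) v \<in> boxfun (R @ L)" using assms
  proof (induction R arbitrary: v)
    case Nil
    show ?case by (simp add: XX.simps(1) fv.subspace_0[OF subspace_boxfun])
  next
    case (Cons a R)
    then show ?case
      by (auto simp: boxfun_Cons op_lin fv.scale_zero_right
          intro!: fv.subspace_add[OF subspace_boxfun] fv.subspace_scale[OF subspace_boxfun])
  qed
  show "parity (length R) e v \<in> boxfun (R @ L)" using assms
  proof (induction R arbitrary: v e)
    case Nil
    then show ?case by (simp add: parity.simps(1) fv.subspace_0[OF subspace_boxfun])
  qed (auto simp: boxfun_Cons op_lin)
qed

lemma ZZ_funpow_boxfun: "v \<in> boxfun (R @ L) \<Longrightarrow> (ZZ (length R) L ^^ n) v \<in> boxfun (R @ L)"
  by (induction n) (auto intro: ops_boxfun)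

lemma XX_parity: "XX i (parity i e v) = parity i (Suc e) (XX i v)"
proof (induction i arbitrary: e v)
  case 0
  show ?case by (simp add: XX.simps(1) op_lin)
next
  case (Suc i)
  show ?case by (rule lfun_eqI) (simp_all add: Suc op_lin)
qed

lemma parity_Suc_Suc: "parity i (Suc (Suc e)) v = parity i e v"
proof (induction i arbitrary: e v)
  case 0
  show ?case by (simp add: parity.simps(1))
next
  case (Suc i)
  show ?case by (rule lfun_eqI) (simp_all add: Suc)
qed

lemma ZZ_parity: "ZZ i L (parity i e v) = parity i e (ZZ i L v)"
proof (induction i arbitrary: e v)
  case 0
  show ?case by (simp add: ZZ.simps(1) parity.simps(1) shift_lin)
next
  case (Suc i)
  show ?case by (rule lfun_eqI) (simp_all add: Suc)
qed

lemma XX_ZZ: "XX i (ZZ i L v) = ZZ i L (XX i v)"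
proof (induction i arbitrary: v)
  case 0
  show ?case by (simp add: XX.simps(1) op_lin)
next
  case (Suc i)
  show ?case by (rule lfun_eqI) (simp_all add: Suc op_lin)
qed

lemma parity_parity: "parity i e (parity i e v) = parity i e v" "parity i e (parity i (Suc e) v) = 0"
proof -
  show "parity i e (parity i e v) = parity i e v"
  proof (induction i arbitrary: e v)
    case (Suc i)
    show ?case by (rule lfun_eqI) (simp_all add: Suc)
  qed (simp add: parity.simps(1))
  show "parity i e (parity i (Suc e) v) = 0"
  proof (induction i arbitrary: e v)
    case (Suc i)
    show ?case by (rule lfun_eqI) (simp_all add: Suc slice_lin)
  qed (simp add: parity.simps(1))
qed

lemma parity_sum: "v \<in> boxfun (R @ L) \<Longrightarrow> parity (length R) e v + parity (length R) (Suc e) v = v"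
proof (induction R arbitrary: v e)
  case (Cons a R)
  show ?case
  proof (rule lfun_eqI)
    show "slice x (parity (length (a # R)) e v + parity (length (a # R)) (Suc e) v) = slice x v" for x
      using Cons.IH[of "slice x v" "e + x"] Cons.prems by (simp add: slice_lin boxfun_Cons)
  qed (use Cons.prems in \<open>simp add: boxfun_Cons\<close>)
qed (simp add: parity.simps(1))

lemma sliceat_ZZ: "sliceat i x (ZZ i (a # L) v) = sliceat i (x + snd a) v + ZZ i L (sliceat i x v)"
proof (induction i arbitrary: v)
  case 0
  show ?case by (simp add: sliceat.simps(1) ZZ.simps(1))
next
  case (Suc i)
  show ?case by (rule lfun_eqI) (simp_all add: Suc slice_lin)
qed

lemma sliceat_XX: "sliceat i x (XX i v) = XX i (sliceat i x v)"
proof (induction i arbitrary: v)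
  case 0
  show ?case by (simp add: XX.simps(1) op_lin)
next
  case (Suc i)
  show ?case by (rule lfun_eqI) (simp_all add: Suc op_lin)
qed

lemma sliceat_parity: "sliceat i x (parity i e v) = parity i e (sliceat i x v)"
proof (induction i arbitrary: v e)
  case 0
  show ?case by (simp add: parity.simps(1) op_lin)
next
  case (Suc i)
  show ?case by (rule lfun_eqI) (simp_all add: Suc op_lin)
qed

lemma sliceat_boxfun:
  assumes "v \<in> boxfun (R @ a # L)"
  shows "sliceat (length R) x v \<in> boxfun (R @ L)" "x \<ge> fst a \<Longrightarrow> sliceat (length R) x v = 0"
proof -
  show "sliceat (length R) x v \<in> boxfun (R @ L)" using assms
    by (induction R arbitrary: v) (auto simp: sliceat.simps(1) boxfun_Cons op_lin)
  show "sliceat (length R) x v = 0" if "x \<ge> fst a" using assms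
  proof (induction R arbitrary: v)
    case (Cons b R)
    show ?case by (rule lfun_eqI) (use Cons in \<open>simp_all add: boxfun_Cons slice_lin\<close>)
  qed (use that in \<open>simp add: sliceat.simps(1) boxfun_Cons\<close>)
qed

lemma sliceat_eq_0:
  assumes "v \<in> boxfun (R @ a # L)" "\<And>x. sliceat (length R) x v = 0"
  shows "v = 0"
  using assms
proof (induction R arbitrary: v)
  case Nil
  show ?case by (rule lfun_eqI) (use Nil in \<open>simp_all add: boxfun_Cons sliceat.simps slice_lin\<close>)
next
  case (Cons b R)
  show ?case
  proof (rule lfun_eqI)
    fix y
    have "sliceat (length R) x (slice y v) = 0" for x
      using arg_cong[OF Cons.prems(2)[of x], of "slice y"] by (simp add: slice_lin)
    then show "slice y v = slice y 0" using Cons.IH[of "slice y v"] Cons.prems(1) by (simp add: boxfun_Cons slice_lin)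
  qed (use Cons.prems in \<open>simp add: boxfun_Cons\<close>)
qed

lemma glueat_boxfun:
  assumes "\<And>x. w x \<in> boxfun (R @ L)" "\<And>x. x \<ge> fst a \<Longrightarrow> w x = 0"
  shows "glueat (length R) w \<in> boxfun (R @ a # L)"
  using assms
proof (induction R arbitrary: w)
  case Nil
  then show ?case by (simp add: glueat.simps boxfun_Cons)
next
  case (Cons b R)
  have z: "glueat i (\<lambda>x. 0) = 0" for i
    by (induction i) (rule lfun_eqI; simp add: glueat.simps(1) slice_lin)+
  show ?case using Cons.prems Cons.IH[of "\<lambda>x. slice _ (w x)"]
    by (auto simp: boxfun_Cons slice_lin z)
qed

lemma sliceat_glueat:
  assumes "\<And>x. w x \<in> boxfun (R @ L)"
  shows "sliceat (length R) x (glueat (length R) w) = w x"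
  using assms
proof (induction R arbitrary: w)
  case Nil
  then show ?case by (simp add: glueat.simps sliceat.simps)
next
  case (Cons b R)
  show ?case
    by (rule lfun_eqI) (use Cons.prems Cons.IH[of "\<lambda>x. slice _ (w x)"] in \<open>simp_all add: boxfun_Cons\<close>)
qed

text \<open>The signs of neighbouring slices are opposite, so the mixed terms cancel: the signed
  shifts anticommute, and only double shifts remain.\<close>

lemma XX_XX_Suc: "slice y (XX (Suc i) (XX (Suc i) v)) = slice (y + 2) v + XX i (XX i (slice y v))"
  by (simp add: op_lin fv.scale_right_distrib)

lemma ZZ_frobenius:
  assumes "prime p" "CHAR('k::field) = p"
  shows "(ZZ i L ^^ p) (v :: 'k lfun) = ZZ i (dilate p L) v"
proof (induction i arbitrary: v)
  case 0
  show ?case using shift_frobenius[OF assms, of L v] by (simp add: ZZ.simps(1)[abs_def])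
next
  case (Suc i)
  have s: "slice y ((ZZ (Suc i) L ^^ n) v) = (ZZ i L ^^ n) (slice y v)" for n y
    by (induction n) auto
  have "p = Suc (p - 1)" using prime_gt_0_nat[OF assms(1)] by simp
  then have "(ZZ (Suc i) L ^^ p) v [] = 0" by (metis Suc_ops_Nil(3) comp_apply funpow.simps(2))
  then show ?case by (intro lfun_eqI[of "(ZZ (Suc i) L ^^ p) v"]) (simp_all add: s Suc)
qed

text \<open>The action of a shift on the sequence of slices along a coordinate of step width 1.
  Sequences are not cut off at the side length, so difference equations can be solved for all
  indices, and the side length becomes a vanishing condition.\<close>

definition step :: "('k::field lfun \<Rightarrow> 'k lfun) \<Rightarrow> (nat \<Rightarrow> 'k lfun) \<Rightarrow> nat \<Rightarrow> 'k lfun" where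
  "step Z w = (\<lambda>x. w (Suc x) + Z (w x))"

lemma step_power:
  assumes Z: "flinear Z"
  shows "(step Z ^^ n) w x = (\<Sum>t\<le>n. fscale (of_nat (n choose t)) ((Z ^^ (n - t)) (w (x + t))))"
proof (induction n arbitrary: x)
  case 0
  then show ?case by (simp add: fv.scale_one)
next
  case (Suc n)
  let ?g = "\<lambda>n t. (Z ^^ (n - t)) (w (x + t))"
  have "(step Z ^^ Suc n) w x = (step Z ^^ n) w (Suc x) + Z ((step Z ^^ n) w x)"
    by (simp add: step_def)
  also have "(step Z ^^ n) w (Suc x) = (\<Sum>t\<le>n. fscale (of_nat (n choose t)) (?g (Suc n) (Suc t)))"
    unfolding Suc by simp
  also have "Z ((step Z ^^ n) w x) = (\<Sum>t\<le>n. fscale (of_nat (n choose t)) (?g (Suc n) t))"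
    unfolding Suc fvp.linear_sum[OF flinear_linear[OF Z]] flinear_scale[OF Z]
    by (intro sum.cong refl) (simp add: Suc_diff_le)
  also have "\<dots> = ?g (Suc n) 0 + (\<Sum>t\<le>n. fscale (of_nat (n choose Suc t)) (?g (Suc n) (Suc t)))"
    (is "?l = ?r")
  proof -
    have "?l = (\<Sum>t\<le>Suc n. fscale (of_nat (n choose t)) (?g (Suc n) t))"
      by (simp add: binomial_eq_0)
    also have "\<dots> = ?r"
      by (subst sum.atMost_Suc_shift) (simp add: fv.scale_one)
    finally show ?thesis .
  qed
  finally have "(step Z ^^ Suc n) w x = ?g (Suc n) 0 +
     (\<Sum>t\<le>n. fscale (of_nat (n choose t)) (?g (Suc n) (Suc t)) + fscale (of_nat (n choose Suc t)) (?g (Suc n) (Suc t)))"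
    by (simp add: sum.distrib algebra_simps)
  also have "\<dots> = (\<Sum>t\<le>Suc n. fscale (of_nat (Suc n choose t)) (?g (Suc n) t))"
    by (subst sum.atMost_Suc_shift) (simp add: fv.scale_one fv.scale_left_distrib)
  finally show ?case .
qed

lemma step_power_comp:
  assumes "flinear T" "\<And>v. T (Z v) = Z (T v)"
  shows "(step Z ^^ n) (\<lambda>x. T (w x)) x = T ((step Z ^^ n) w x)"
proof (induction n arbitrary: x)
  case (Suc n)
  then show ?case by (simp add: step_def flinear_add[OF assms(1)] assms(2))
qed simp

lemma sliceat_ZZ_funpow:
  "sliceat i x ((ZZ i ((j, 1) # L) ^^ n) v) = (step (ZZ i L) ^^ n) (\<lambda>x. sliceat i x v) x"
  by (induction n arbitrary: x) (simp_all add: sliceat_ZZ step_def)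

section \<open>Matrix factorizations and difference equations in characteristic p\<close>

locale char_p =
  fixes K :: "'k::field itself" and p :: nat
  assumes p_prime: "prime p" and p_odd: "odd p" and char_K: "CHAR('k) = p"
begin

lemma p_ge_3: "p \<ge> 3"
  using p_prime p_odd prime_ge_2_nat[of p] by (cases "p = 2") auto

lemma choose_eq_0: "0 < t \<Longrightarrow> t < p \<Longrightarrow> of_nat (p choose t) = (0 :: 'k)"
  using char_K p_prime dvd_choose_prime[of t p] by (simp add: of_nat_eq_0_iff_char_dvd)

lemma step_frobenius:
  fixes Z :: "'k lfun \<Rightarrow> 'k lfun"
  assumes "flinear Z"
  shows "(step Z ^^ p) w x = w (x + p) + (Z ^^ p) (w x)"
proof -
  have "(step Z ^^ p) w x = (\<Sum>t\<in>{0, p}. fscale (of_nat (p choose t)) ((Z ^^ (p - t)) (w (x + t))))"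
    unfolding step_power[OF assms] using choose_eq_0
    by (intro sum.mono_neutral_right) (auto simp: fv.scale_zero_left)
  then show ?thesis using p_ge_3 by (simp add: fv.scale_one add.commute)
qed

text \<open>Removing a coordinate of side length $pb + 1$ from the kernel of \<open>Xi\<close> leaves sequences of even and odd
  parts $e, d$ that are solutions (\<open>sol\<close>) of a pair of difference equations; the composite of these equations is a $p$-th power, so by
  the Frobenius both sequences are shifted by $p$ by applying \<open>- YY i (dilate p L)\<close>. The result
  is the kernel of \<open>Xi (Suc i)\<close> with one more signed coordinate, of side length $2b + 1$, plus $p - 2$ copies of a
  kernel of a power of \<open>YY\<close>. Iteration converts every coordinate into a signed one.\<close>

definition Xi :: "nat \<Rightarrow> (nat \<times> nat) list \<Rightarrow> 'k lfun \<Rightarrow> 'k lfun" where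
  "Xi i L v = XX i v + parity i 0 (ZZ i L v) - parity i 1 ((ZZ i L ^^ (p - 1)) v)"

definition YY :: "nat \<Rightarrow> (nat \<times> nat) list \<Rightarrow> 'k lfun \<Rightarrow> 'k lfun" where
  "YY i L v = XX i (XX i v) + ZZ i L v"

definition sol :: "nat \<Rightarrow> (nat \<times> nat) list \<Rightarrow> (nat \<Rightarrow> 'k lfun) \<Rightarrow> (nat \<Rightarrow> 'k lfun) \<Rightarrow> bool" where
  "sol i L e d \<longleftrightarrow> (\<forall>x. step (ZZ i L) e x = - XX i (d x)) \<and> (\<forall>x. (step (ZZ i L) ^^ (p - 1)) d x = XX i (e x))"

lemmas lZn = flinear_funpow[OF flinear_ZZ]

lemma flinear_Xi: "flinear (Xi i L)"
  unfolding Xi_def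
  by (intro flinear_minus flinear_plus flinear_XX flinear_compose[OF flinear_parity flinear_ZZ]
      flinear_compose[OF flinear_parity lZn])

lemma flinear_YY: "flinear (YY i L)"
  unfolding YY_def
  by (intro flinear_plus flinear_compose[OF flinear_XX flinear_XX] flinear_ZZ)

lemmas lYn = flinear_funpow[OF flinear_YY]

lemma Xi_boxfun: "v \<in> boxfun (R @ L) \<Longrightarrow> Xi (length R) L v \<in> boxfun (R @ L)"
  unfolding Xi_def
  by (intro fv.subspace_diff[OF subspace_boxfun] fv.subspace_add[OF subspace_boxfun] ops_boxfun ZZ_funpow_boxfun)

lemma YY_boxfun:
  assumes "v \<in> boxfun (R @ L)" "boxfun L = (boxfun L' :: 'k lfun set)"
  shows "YY (length R) L' v \<in> boxfun (R @ L)"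
proof -
  have "boxfun (R @ L) = (boxfun (R @ L') :: 'k lfun set)"
    using assms(2) by (induction R) (auto simp: boxfun_Cons set_eq_iff)
  then have "ZZ (length R) L' v \<in> boxfun (R @ L)"
    using ops_boxfun(1)[of v R L'] assms(1) by simp
  then show ?thesis
    using assms(1) unfolding YY_def by (intro fv.subspace_add[OF subspace_boxfun] ops_boxfun)
qed

lemma ZZ_funpow_comm:
  "XX i ((ZZ i L ^^ n) v) = (ZZ i L ^^ n) (XX i v)"
  "parity i e ((ZZ i L ^^ n) v) = (ZZ i L ^^ n) (parity i e v)"
  by (induction n) (simp_all add: XX_ZZ flip: ZZ_parity)

lemma ZZ_dilate: "ZZ i (dilate p L) v = (ZZ i L ^^ p) (v :: 'k lfun)"
  using ZZ_frobenius[OF p_prime char_K] by simp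

text \<open>Applying the step operator to the second equation and inserting the first turns
  \<open>p\<close> steps on \<open>d\<close> into minus the square of \<open>XX\<close>; the
  Frobenius for \<open>step\<close> then isolates the term \<open>p\<close> places ahead. For
  \<open>e\<close> the two equations are used in the opposite order.\<close>

lemma YY_shift:
  assumes "sol i L e d"
  shows "e (x + p) = - YY i (dilate p L) (e x)" "d (x + p) = - YY i (dilate p L) (d x)"
proof -
  let ?P = "step (ZZ i L)"
  have p: "p = Suc (p - 1)" using p_ge_3 by simp
  have e: "?P e = (\<lambda>x. - XX i (d x))" and d: "(?P ^^ (p - 1)) d = (\<lambda>x. XX i (e x))"
    using assms by (auto simp: sol_def)
  have "(?P ^^ p) d x = ?P ((?P ^^ (p - 1)) d) x"
    using p by (metis comp_apply funpow.simps(2))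
  also have "\<dots> = XX i (?P e x)" unfolding d by (simp add: step_def op_lin XX_ZZ)
  finally have "(?P ^^ p) d x = - XX i (XX i (d x))"
    unfolding e by (simp add: flinear_uminus[OF flinear_XX])
  then show "d (x + p) = - YY i (dilate p L) (d x)"
    unfolding step_frobenius[OF flinear_ZZ] YY_def ZZ_dilate by (simp add: eq_neg_iff_add_eq_0 algebra_simps)
  have lm: "flinear (\<lambda>v. - XX i v)"
    using flinear_minus[OF flinear_zero flinear_XX] by simp
  have "(?P ^^ p) e x = (?P ^^ (p - 1)) (?P e) x"
    using p by (metis comp_apply funpow_Suc_right)
  also have "\<dots> = - XX i ((?P ^^ (p - 1)) d x)"
    unfolding e by (rule step_power_comp[OF lm]) (simp add: XX_ZZ flinear_uminus[OF flinear_ZZ])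
  finally have "(?P ^^ p) e x = - XX i (XX i (e x))" unfolding d .
  then show "e (x + p) = - YY i (dilate p L) (e x)"
    unfolding step_frobenius[OF flinear_ZZ] YY_def ZZ_dilate by (simp add: eq_neg_iff_add_eq_0 algebra_simps)
qed

lemma YY_shift_mult:
  assumes "sol i L e d"
  shows "e (p * b + x) = fscale ((- 1) ^ b) ((YY i (dilate p L) ^^ b) (e x))"
    "d (p * b + x) = fscale ((- 1) ^ b) ((YY i (dilate p L) ^^ b) (d x))"
proof (induction b)
  case (Suc b)
  have eq: "p * Suc b + x = (p * b + x) + p" by simp
  case 1
  then show ?case using Suc unfolding eq YY_shift[OF assms] by (simp add: flinear_scale[OF flinear_YY])
  case 2
  then show ?case using Suc unfolding eq YY_shift[OF assms] by (simp add: flinear_scale[OF flinear_YY])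
qed (simp_all add: fv.scale_one)

lemma step_top: "(step (ZZ i L) ^^ n) d x =
    (\<Sum>t<n. fscale (of_nat (n choose t)) ((ZZ i L ^^ (n - t)) (d (x + t)))) + d (x + n)"
  by (simp only: step_power[OF flinear_ZZ] lessThan_Suc_atMost[symmetric] sum.lessThan_Suc binomial_n_n
      diff_self_eq_0 funpow_0 of_nat_1 fv.scale_one)

text \<open>The equations are solved for their terms of highest index: one value of \<open>e\<close>
  and \<open>p - 1\<close> consecutive values of \<open>d\<close> determine all later ones.\<close>

lemma sol_next:
  assumes "sol i L e d"
  shows "e (Suc x) = - (ZZ i L (e x) + XX i (d x))"
    and "d (x + (p - 1)) = XX i (e x) - (\<Sum>t<p - 1. fscale (of_nat ((p - 1) choose t)) ((ZZ i L ^^ (p - 1 - t)) (d (x + t))))"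
proof -
  have "e (Suc x) + ZZ i L (e x) = - XX i (d x)" using assms by (simp add: sol_def step_def)
  then show "e (Suc x) = - (ZZ i L (e x) + XX i (d x))" by (simp add: algebra_simps eq_neg_iff_add_eq_0)
  have "(step (ZZ i L) ^^ (p - 1)) d x = XX i (e x)" using assms by (simp add: sol_def)
  then show "d (x + (p - 1)) = XX i (e x) - (\<Sum>t<p - 1. fscale (of_nat ((p - 1) choose t)) ((ZZ i L ^^ (p - 1 - t)) (d (x + t))))"
    unfolding step_top by (simp only: eq_diff_eq add.commute)
qed

lemma solI:
  assumes "\<And>x. e (Suc x) = - (ZZ i L (e x) + XX i (d x))"
    and "\<And>x. d (x + (p - 1)) = XX i (e x) - (\<Sum>t<p - 1. fscale (of_nat ((p - 1) choose t)) ((ZZ i L ^^ (p - 1 - t)) (d (x + t))))"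
  shows "sol i L e d"
  unfolding sol_def
proof (intro conjI allI)
  show "step (ZZ i L) e x = - XX i (d x)" for x by (simp add: step_def assms(1))
  show "(step (ZZ i L) ^^ (p - 1)) d x = XX i (e x)" for x
    unfolding step_top assms(2) by (simp only: add_diff_eq add_diff_cancel_left')
qed

lemma sol_invariant:
  assumes s: "sol i L e d" and A: "fv.subspace A" "fv.subspace B"
    and X: "\<And>v. v \<in> A \<Longrightarrow> XX i v \<in> B" "\<And>v. v \<in> B \<Longrightarrow> XX i v \<in> A"
    and Z: "\<And>v. v \<in> A \<Longrightarrow> ZZ i L v \<in> A" "\<And>v. v \<in> B \<Longrightarrow> ZZ i L v \<in> B"
    and init: "e j \<in> A" "\<And>t. t < p - 1 \<Longrightarrow> d (j + t) \<in> B"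
  shows "e (j + x) \<in> A \<and> d (j + x) \<in> B"
proof -
  have Zn: "(ZZ i L ^^ n) v \<in> B" if "v \<in> B" for n v using that Z(2) by (induction n) auto
  have "e (j + x) \<in> A \<and> (\<forall>t<p - 1. d (j + x + t) \<in> B)"
  proof (induction x)
    case (Suc x)
    have "0 < p - 1" using p_ge_3 by simp
    then have d0: "d (j + x) \<in> B" using Suc by (metis add.right_neutral)
    have "e (Suc (j + x)) \<in> A"
      unfolding sol_next(1)[OF s]
      using Suc d0 by (intro fv.subspace_neg[OF A(1)] fv.subspace_add[OF A(1)] X Z) auto
    moreover have top: "d (j + x + (p - 1)) \<in> B"
      unfolding sol_next(2)[OF s]
      using Suc by (intro fv.subspace_diff[OF A(2)] fv.subspace_sum[OF A(2)] fv.subspace_scale[OF A(2)] X Zn) auto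
    moreover have "d (j + Suc x + t) \<in> B" if "t < p - 1" for t
    proof (cases "Suc t < p - 1")
      case True
      then have "d (j + x + Suc t) \<in> B" using Suc by blast
      then show ?thesis by simp
    next
      case False
      then have "j + Suc x + t = j + x + (p - 1)" using that by simp
      then show ?thesis using top by metis
    qed
    ultimately show ?case by simp
  qed (use init in auto)
  moreover have "0 < p - 1" using p_ge_3 by simp
  ultimately show ?thesis by (metis add.right_neutral)
qed

lemma sol_zero:
  assumes "sol i L e d" "e j = 0" "\<And>t. t < p - 1 \<Longrightarrow> d (j + t) = 0" "x \<ge> j"
  shows "e x = 0 \<and> d x = 0"
  using sol_invariant[OF assms(1), of "{0}" "{0}" j "x - j"] assms by (simp add: op_lin)

lemma sol_exists: "\<exists>e d. sol i L e d \<and> e 0 = e0 \<and> (\<forall>t<p - 1. d t = d0 t)"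
proof -
  define G where "G e s = XX i e - (\<Sum>t<p - 1. fscale (of_nat ((p - 1) choose t)) ((ZZ i L ^^ (p - 1 - t)) (s t)))"
    for e and s :: "nat \<Rightarrow> 'k lfun"
  \<comment> \<open>The state at \<open>x\<close> consists of \<open>e x\<close> and a function
    whose first \<open>p - 1\<close> values are those of \<open>d\<close> from \<open>x\<close> on;
    its values beyond this window are irrelevant.\<close>
  define st where "st = rec_nat (e0, d0) (\<lambda>_ (e, s). (- (ZZ i L e + XX i (s 0)),
      \<lambda>t. if Suc t < p - 1 then s (Suc t) else G e s))"
  have st0: "st 0 = (e0, d0)" by (simp add: st_def)
  have stS: "st (Suc x) = (- (ZZ i L (fst (st x)) + XX i (snd (st x) 0)),
      \<lambda>t. if Suc t < p - 1 then snd (st x) (Suc t) else G (fst (st x)) (snd (st x)))" for x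
    by (simp add: st_def case_prod_beta cong: if_cong)
  define e where "e x = fst (st x)" for x
  define d where "d x = snd (st x) 0" for x
  have window: "snd (st x) t = d (x + t)" if "t < p - 1" for x t
    using that
  proof (induction t arbitrary: x)
    case (Suc t)
    then have "snd (st x) (Suc t) = snd (st (Suc x)) t" by (simp add: stS)
    then show ?case using Suc.IH[of "Suc x"] Suc.prems by simp
  qed (simp add: d_def)
  have "sol i L e d"
  proof (rule solI)
    show "e (Suc x) = - (ZZ i L (e x) + XX i (d x))" for x by (simp add: e_def d_def stS)
    fix x
    have pp: "p - 2 < p - 1" "Suc (p - 2) = p - 1" using p_ge_3 by auto
    have "d (x + (p - 1)) = d (Suc x + (p - 2))" using pp by (metis add_Suc_right add_Suc)
    also have "\<dots> = snd (st (Suc x)) (p - 2)" using window[OF pp(1), of "Suc x"] by simp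
    also have "\<dots> = G (e x) (snd (st x))" using pp by (simp add: stS e_def)
    also have "\<dots> = XX i (e x) - (\<Sum>t<p - 1. fscale (of_nat ((p - 1) choose t)) ((ZZ i L ^^ (p - 1 - t)) (d (x + t))))"
      unfolding G_def using window by simp
    finally show "d (x + (p - 1)) = \<dots>" .
  qed
  moreover have "e 0 = e0" by (simp add: e_def st0)
  moreover have "d t = d0 t" if "t < p - 1" for t using window[OF that, of 0] by (simp add: st0)
  ultimately show ?thesis by blast
qed

lemma parity_parts:
  "parity i 0 (parity i 0 v) = parity i 0 v" "parity i 1 (parity i 1 v) = parity i 1 v"
  "parity i 0 (parity i 1 v) = 0" "parity i 1 (parity i 0 v) = 0"
  "XX i (parity i 0 v) = parity i 1 (XX i v)" "XX i (parity i 1 v) = parity i 0 (XX i v)"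
  using parity_parity[of i 0] parity_parity[of i 1] parity_Suc_Suc[of i 0] XX_parity[of i 0 v] XX_parity[of i 1 v]
  by (simp_all add: parity_Suc_Suc[of i 0, simplified])

lemma parity_sum01: "v \<in> boxfun (R @ L) \<Longrightarrow> parity (length R) 0 v + parity (length R) 1 v = v"
  using parity_sum[of v R L 0] by simp

text \<open>\<open>XX\<close> reverses the parity and \<open>ZZ\<close> keeps it, so the kernel
  equation separates into one equation for the even and one for the odd component of each
  slice.\<close>

lemma Xi_kernel_iff:
  assumes v: "v \<in> boxfun (R @ (j, 1) # L)" and i: "i = length R"
  shows "Xi i ((j, 1) # L) v = 0 \<longleftrightarrow> sol i L (\<lambda>x. parity i 0 (sliceat i x v)) (\<lambda>x. parity i 1 (sliceat i x v))"
proof -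
  let ?P = "step (ZZ i L)"
  define w where "w = (\<lambda>x. sliceat i x v)"
  define U where "U x = sliceat i x (Xi i ((j, 1) # L) v)" for x
  have Pc: "(?P ^^ n) (\<lambda>x. parity i e (w x)) x = parity i e ((?P ^^ n) w x)" for n e x
    by (rule step_power_comp[OF flinear_parity]) (simp add: ZZ_parity)
  have P1: "?P (\<lambda>x. parity i e (w x)) x = parity i e (?P w x)" for e x using Pc[of 1] by simp
  have U: "U x = XX i (w x) + parity i 0 (?P w x) - parity i 1 ((?P ^^ (p - 1)) w x)" for x
    using sliceat_ZZ_funpow[of i x "p - 1" j L v] sliceat_ZZ_funpow[of i x 1 j L v]
    by (simp add: U_def Xi_def flinear_diff[OF flinear_sliceat] op_lin sliceat_XX sliceat_parity w_def)
  have ww: "w x = parity i 0 (w x) + parity i 1 (w x)" for x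
    using parity_sum01[OF sliceat_boxfun(1)[OF v]] i by (simp add: w_def)
  have "Xi i ((j, 1) # L) v = 0 \<longleftrightarrow> (\<forall>x. U x = 0)"
    using sliceat_eq_0[OF Xi_boxfun[OF v]] i by (auto simp: U_def op_lin)
  also have "\<dots> \<longleftrightarrow> (\<forall>x. parity i 0 (U x) = 0 \<and> parity i 1 (U x) = 0)"
  proof -
    have "U x \<in> boxfun (R @ L)" for x unfolding U_def i by (rule sliceat_boxfun(1)[OF Xi_boxfun[OF v]])
    then have "U x = parity i 0 (U x) + parity i 1 (U x)" for x using parity_sum01[of "U x" R L] i by metis
    then show ?thesis by (metis op_lin(12) add.right_neutral)
  qed
  also have "\<dots> \<longleftrightarrow> (\<forall>x. XX i (parity i 1 (w x)) + ?P (\<lambda>x. parity i 0 (w x)) x = 0 \<and>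
      XX i (parity i 0 (w x)) - (?P ^^ (p - 1)) (\<lambda>x. parity i 1 (w x)) x = 0)"
    by (simp add: U flinear_diff[OF flinear_parity] op_lin parity_parts parity_parts[unfolded One_nat_def] Pc P1)
  also have "\<dots> \<longleftrightarrow> sol i L (\<lambda>x. parity i 0 (w x)) (\<lambda>x. parity i 1 (w x))"
    by (auto simp: sol_def eq_neg_iff_add_eq_0 algebra_simps)
  finally show ?thesis by (simp add: w_def)
qed

text \<open>Kernel elements are the solutions that vanish from index \<open>j\<close> on, and a
  solution is free in \<open>e 0\<close> and the first \<open>p - 1\<close> values of
  \<open>d\<close>. As \<open>e 0\<close> and \<open>d 0\<close> have different parities, they are
  packed into the single function at \<open>t = 0\<close>. The assumption \<open>char\<close>
  translates vanishing at \<open>j\<close> into conditions on these initial data.\<close>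

lemma Xi_kernel_dim:
  fixes A :: "nat \<Rightarrow> 'k lfun set"
  assumes i: "i = length R"
    and sub: "\<And>t. t < p - 1 \<Longrightarrow> fv.subspace (A t)" and AV: "\<And>t. t < p - 1 \<Longrightarrow> A t \<subseteq> boxfun (R @ L)"
    and odd: "\<And>t u. 1 \<le> t \<Longrightarrow> t < p - 1 \<Longrightarrow> u \<in> A t \<Longrightarrow> parity i 0 u = 0"
    and char: "\<And>e d. sol i L e d \<Longrightarrow>
       (\<And>x. e x \<in> boxfun (R @ L) \<and> parity i 1 (e x) = 0 \<and> d x \<in> boxfun (R @ L) \<and> parity i 0 (d x) = 0) \<Longrightarrow>
       (e j = 0 \<and> (\<forall>t<p - 1. d (j + t) = 0)) \<longleftrightarrow> (e 0 + d 0 \<in> A 0 \<and> (\<forall>t. 1 \<le> t \<and> t < p - 1 \<longrightarrow> d t \<in> A t))"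
  shows "vdim {v. v \<in> boxfun (R @ (j, 1) # L) \<and> Xi i ((j, 1) # L) v = 0} = (\<Sum>t<p - 1. vdim (A t))"
proof -
  let ?K = "{v. v \<in> boxfun (R @ (j, 1) # L) \<and> Xi i ((j, 1) # L) v = 0}"
  define f where "f t v = (if t = 0 then sliceat i 0 v else parity i 1 (sliceat i t v))" for t :: nat and v :: "'k lfun"
  have lf: "flinear (f t)" for t
    using flinear_sliceat[of i 0] flinear_compose[OF flinear_parity flinear_sliceat, of i 1 i t]
    by (cases "t = 0") (simp_all add: f_def[abs_def])
  have p1: "0 < p - 1" using p_ge_3 by simp
  have solK: "sol i L (\<lambda>x. parity i 0 (sliceat i x v)) (\<lambda>x. parity i 1 (sliceat i x v))"
    and par: "parity i 0 (sliceat i x v) \<in> boxfun (R @ L) \<and> parity i 1 (parity i 0 (sliceat i x v)) = 0 \<and>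
      parity i 1 (sliceat i x v) \<in> boxfun (R @ L) \<and> parity i 0 (parity i 1 (sliceat i x v)) = 0"
    and spl: "parity i 0 (sliceat i x v) + parity i 1 (sliceat i x v) = sliceat i x v"
    if "v \<in> ?K" for v x
    using that Xi_kernel_iff[OF _ i, of v j L] sliceat_boxfun(1)[of v R "(j, 1)" L x] ops_boxfun(3)[of _ R L] parity_parts
      parity_sum01[of "sliceat i x v" R L] i by auto
  have "fdim ?K \<and> vdim ?K = (\<Sum>t\<in>{..<p - 1}. vdim (A t))"
  proof (rule vdim_family[where f = f])
    show "fv.subspace ?K" by (rule subspace_kernel[OF subspace_boxfun flinear_Xi])
    show "flinear (f t)" for t by (rule lf)
    show "fv.subspace (A t)" if "t \<in> {..<p - 1}" for t using sub that by simp
    show "fdim (A t)" if "t \<in> {..<p - 1}" for t using fdim_subset[OF fdim_boxfun AV] that by simp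
    show "f t v \<in> A t" if t: "t \<in> {..<p - 1}" and v: "v \<in> ?K" for t v
    proof -
      have z: "sliceat i x v = 0" if "x \<ge> j" for x using sliceat_boxfun(2)[of v R "(j, 1)" L x] v i that by simp
      have "parity i 0 (sliceat i 0 v) + parity i 1 (sliceat i 0 v) \<in> A 0 \<and> (\<forall>t. 1 \<le> t \<and> t < p - 1 \<longrightarrow> parity i 1 (sliceat i t v) \<in> A t)"
        using char[OF solK[OF v] par[OF v]] z by (simp add: op_lin)
      then show ?thesis using t spl[OF v] by (auto simp: f_def)
    qed
    show "v = 0" if v: "v \<in> ?K" and f: "\<And>t. t \<in> {..<p - 1} \<Longrightarrow> f t v = 0" for v
    proof -
      have "sliceat i 0 v = 0" using f[of 0] p1 by (simp add: f_def)
      moreover have "parity i 1 (sliceat i t v) = 0" if "t < p - 1" for t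
        using f[of t] that calculation by (cases "t = 0") (auto simp: f_def op_lin)
      ultimately have "parity i 0 (sliceat i x v) = 0 \<and> parity i 1 (sliceat i x v) = 0" for x
        using sol_zero[OF solK[OF v], of 0 x] by (simp add: op_lin)
      then have "sliceat i x v = 0" for x using spl[OF v, of x] by simp
      then show "v = 0" using sliceat_eq_0[of v R "(j, 1)" L] v i by simp
    qed
    show "\<exists>v\<in>?K. \<forall>t\<in>{..<p - 1}. f t v = a t" if a: "\<And>t. t \<in> {..<p - 1} \<Longrightarrow> a t \<in> A t" for a
    proof -
      have pulse: "a 0 \<in> A 0" "a 0 \<in> boxfun (R @ L)" using a[of 0] AV[of 0] p1 by auto
      obtain e d where ed: "sol i L e d" "e 0 = parity i 0 (a 0)" "\<And>t. t < p - 1 \<Longrightarrow> d t = (if t = 0 then parity i 1 (a 0) else a t)"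
        using sol_exists[of i L "parity i 0 (a 0)" "\<lambda>t. if t = 0 then parity i 1 (a 0) else a t"] by auto
      let ?A = "{v. v \<in> boxfun (R @ L) \<and> parity i 1 v = 0}" and ?B = "{v. v \<in> boxfun (R @ L) \<and> parity i 0 v = 0}"
      have inv: "e x \<in> ?A \<and> d x \<in> ?B" for x
      proof -
        have "e (0 + x) \<in> ?A \<and> d (0 + x) \<in> ?B"
        proof (rule sol_invariant[OF ed(1)])
          show "fv.subspace ?A" "fv.subspace ?B" by (rule subspace_kernel[OF subspace_boxfun flinear_parity])+
          show "XX i v \<in> ?B" if "v \<in> ?A" for v using that ops_boxfun(2)[of v R L] i parity_parts(6)[of i v] by (simp add: op_lin)
          show "XX i v \<in> ?A" if "v \<in> ?B" for v using that ops_boxfun(2)[of v R L] i parity_parts(5)[of i v] by (simp add: op_lin)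
          show "ZZ i L v \<in> ?A" if "v \<in> ?A" for v using that ops_boxfun(1)[of v R L] i ZZ_parity[of i L 1 v] by (simp add: op_lin)
          show "ZZ i L v \<in> ?B" if "v \<in> ?B" for v using that ops_boxfun(1)[of v R L] i ZZ_parity[of i L 0 v] by (simp add: op_lin)
          show "e 0 \<in> ?A" using ops_boxfun(3)[OF pulse(2)] i parity_parts by (simp add: ed)
          show "d (0 + t) \<in> ?B" if "t < p - 1" for t
            using that a[of t] AV[of t] odd[of t "a t"] ops_boxfun(3)[OF pulse(2)] i parity_parts by (auto simp: ed(3))
        qed
        then show ?thesis by simp
      qed
      have e0d0: "e 0 + d 0 = a 0" using ed(2,3) p1 parity_sum01[OF pulse(2)] i by simp
      have "e j = 0 \<and> (\<forall>t<p - 1. d (j + t) = 0)"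
        using char[OF ed(1)] inv e0d0 a pulse ed(3) by simp
      then have z: "e x = 0 \<and> d x = 0" if "x \<ge> j" for x using sol_zero[OF ed(1) _ _ that] by blast
      define v where "v = glueat i (\<lambda>x. e x + d x)"
      have w: "e x + d x \<in> boxfun (R @ L)" for x using inv[of x] fv.subspace_add[OF subspace_boxfun] by blast
      have vsp: "v \<in> boxfun (R @ (j, 1) # L)" unfolding v_def i by (rule glueat_boxfun[OF w]) (simp add: z)
      have sv: "sliceat i x v = e x + d x" for x unfolding v_def i by (rule sliceat_glueat[OF w])
      have e: "parity i 0 (sliceat i x v) = e x" and d: "parity i 1 (sliceat i x v) = d x" for x
        unfolding sv using inv[of x] parity_sum01[of "e x" R L] parity_sum01[of "d x" R L] i by (simp_all add: op_lin)
      have "v \<in> ?K" using Xi_kernel_iff[OF vsp i] vsp ed(1) unfolding e d by simp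
      moreover have "f t v = a t" if "t < p - 1" for t
        using that e0d0 ed(3)[OF that] d[of t] by (cases "t = 0") (simp_all add: f_def sv[of 0])
      ultimately show ?thesis by blast
    qed
  qed simp
  then show ?thesis by simp
qed

end

lemma subspace_kernel2:
  assumes "fv.subspace V" "flinear f" "flinear g"
  shows "fv.subspace {u. u \<in> V \<and> f u = 0 \<and> g u = 0}"
  using subspace_kernel[OF subspace_kernel[OF assms(1,2)] assms(3)] by (simp add: conj_assoc)

lemma ZZ_Nil: "ZZ i [] v = 0"
proof (induction i arbitrary: v)
  case (Suc i)
  show ?case by (rule lfun_eqI) (simp_all add: Suc slice_lin)
qed (simp add: ZZ.simps(1) shift.simps)

lemma funpow_commute: "(\<And>v. T (f v) = f (T v)) \<Longrightarrow> T ((f ^^ n) v) = (f ^^ n) (T v)"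
  by (induction n) simp_all

lemma vdim_parity_split:
  fixes T0 T1 :: "'k::field lfun \<Rightarrow> 'k lfun"
  assumes V: "V = boxfun (R @ L)" and i: "i = length R" and T: "flinear T0" "flinear T1"
  shows "vdim {u. u \<in> V \<and> T0 (parity i 0 u) = 0 \<and> T1 (parity i 1 u) = 0} =
    vdim {u. u \<in> V \<and> parity i 1 u = 0 \<and> T0 u = 0} + vdim {u. u \<in> V \<and> parity i 0 u = 0 \<and> T1 u = 0}"
proof -
  define A where "A b = (if b then {u. u \<in> V \<and> parity i 1 u = 0 \<and> T0 u = 0} else {u. u \<in> V \<and> parity i 0 u = 0 \<and> T1 u = 0})" for b
  let ?K = "{u. u \<in> V \<and> T0 (parity i 0 u) = 0 \<and> T1 (parity i 1 u) = 0}"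
  define f :: "bool \<Rightarrow> 'k lfun \<Rightarrow> 'k lfun" where "f b = parity i (if b then 0 else 1)" for b
  have sV: "fv.subspace V" unfolding V by (rule subspace_boxfun)
  have E: "parity i 0 u + parity i 1 u = u" if "u \<in> V" for u
    using parity_sum[of u R L 0] that by (simp add: V i)
  have EE: "parity i 0 (parity i 0 v) = parity i 0 v" "parity i 1 (parity i 1 v) = parity i 1 v"
      "parity i 0 (parity i 1 v) = 0" "parity i 1 (parity i 0 v) = 0" for v
    using parity_parity[of i 0] parity_parity[of i 1] by (simp_all add: parity_Suc_Suc[of i 0, simplified])
  have "fdim ?K \<and> vdim ?K = (\<Sum>b\<in>UNIV. vdim (A b))"
  proof (rule vdim_family[where f = f])
    show "fv.subspace ?K"
      by (rule subspace_kernel2[OF sV flinear_compose[OF T(1) flinear_parity] flinear_compose[OF T(2) flinear_parity]])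
    show "flinear (f b)" for b unfolding f_def by (rule flinear_parity)
    show "fv.subspace (A b)" for b
      unfolding A_def using subspace_kernel2[OF sV flinear_parity T(1)] subspace_kernel2[OF sV flinear_parity T(2)] by simp
    show "fdim (A b)" for b
      by (rule fdim_subset[OF fdim_boxfun[of "R @ L"]]) (auto simp: A_def V)
    show "f b v \<in> A b" if "v \<in> ?K" for b v
      using that ops_boxfun(3)[of v R L] by (cases b) (auto simp: f_def A_def V i EE[unfolded i] EE[unfolded i One_nat_def])
    show "v = 0" if "v \<in> ?K" "\<And>b. b \<in> UNIV \<Longrightarrow> f b v = 0" for v
      using that(2)[of True] that(2)[of False] E[of v] that(1) by (simp add: f_def)
    show "\<exists>v\<in>?K. \<forall>b\<in>UNIV. f b v = a b" if "\<And>b. b \<in> UNIV \<Longrightarrow> a b \<in> A b" for a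
    proof -
      have a: "a True \<in> V" "parity i 1 (a True) = 0" "T0 (a True) = 0" "a False \<in> V" "parity i 0 (a False) = 0" "T1 (a False) = 0"
        using that[of True] that[of False] by (auto simp: A_def)
      have e: "parity i 0 (a True) = a True" "parity i 1 (a False) = a False"
        using E[OF a(1)] E[OF a(4)] a by simp_all
      show ?thesis
        using a e fv.subspace_add[OF sV a(1) a(4)]
        by (intro bexI[of _ "a True + a False"]) (auto simp: f_def flinear_add[OF flinear_parity] flinear_0[OF T(1)] flinear_0[OF T(2)] simp del: One_nat_def)
    qed
  qed simp
  then show ?thesis by (simp add: A_def UNIV_bool add.commute)
qed

context char_p
begin

abbreviation "YYp i L \<equiv> YY i (dilate p L)"

lemma YYp_comm:
  "XX i (YYp i L v) = YYp i L (XX i v)" "parity i e (YYp i L v) = YYp i L (parity i e v)"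
  "ZZ i L (YYp i L v) = YYp i L (ZZ i L v)"
  by (simp_all add: YY_def op_lin ZZ_dilate ZZ_funpow_comm XX_ZZ XX_parity parity_Suc_Suc funpow_swap1)

lemmas Ypn_comm = funpow_commute[of "XX i" "YYp i L" for i L, OF YYp_comm(1)]
  funpow_commute[of "parity i e" "YYp i L" for i e L, OF YYp_comm(2)]
  funpow_commute[of "ZZ i L" "YYp i L" for i L, OF YYp_comm(3)]

lemma Ypn_Zn: "(ZZ i L ^^ m) ((YYp i L ^^ n) v) = (YYp i L ^^ n) ((ZZ i L ^^ m) v)"
  by (induction m) (simp_all add: Ypn_comm)

lemma Xi_split:
  assumes "parity i 0 e = e" "parity i 1 e = 0" "parity i 0 d = 0" "parity i 1 d = d"
  shows "Xi i L (e + d) = (ZZ i L e + XX i d) + (XX i e - (ZZ i L ^^ (p - 1)) d)"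
    "parity i 0 (ZZ i L e + XX i d) = ZZ i L e + XX i d" "parity i 1 (ZZ i L e + XX i d) = 0"
    "parity i 0 (XX i e - (ZZ i L ^^ (p - 1)) d) = 0"
    "parity i 1 (XX i e - (ZZ i L ^^ (p - 1)) d) = XX i e - (ZZ i L ^^ (p - 1)) d"
proof -
  have X: "parity i 0 (XX i d) = XX i d" "parity i 1 (XX i d) = 0" "parity i 0 (XX i e) = 0" "parity i 1 (XX i e) = XX i e"
    using parity_parts(5,6)[of i e] parity_parts(5,6)[of i d] assms by (simp_all add: op_lin)
  have Z: "parity i 0 (ZZ i L e) = ZZ i L e" "parity i 1 (ZZ i L e) = 0"
    using ZZ_parity[of i L 0 e] ZZ_parity[of i L 1 e] assms by (simp_all add: op_lin)
  have Zd: "parity i 0 (ZZ i L d) = 0" using ZZ_parity[of i L 0 d] assms by (simp add: op_lin)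
  have Zn: "parity i 0 ((ZZ i L ^^ m) d) = 0" "parity i 1 ((ZZ i L ^^ m) d) = (ZZ i L ^^ m) d"
     "parity i 1 ((ZZ i L ^^ m) e) = 0" for m
    unfolding ZZ_funpow_comm assms by (simp_all add: flinear_0[OF lZn])
  show "Xi i L (e + d) = (ZZ i L e + XX i d) + (XX i e - (ZZ i L ^^ (p - 1)) d)"
    unfolding Xi_def by (simp add: op_lin flinear_add[OF lZn] Z Zd Zn Zn[unfolded One_nat_def])
  show "parity i 0 (ZZ i L e + XX i d) = ZZ i L e + XX i d" "parity i 1 (ZZ i L e + XX i d) = 0"
    using X Z by (simp_all add: op_lin)
  show "parity i 0 (XX i e - (ZZ i L ^^ (p - 1)) d) = 0"
    "parity i 1 (XX i e - (ZZ i L ^^ (p - 1)) d) = XX i e - (ZZ i L ^^ (p - 1)) d"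
    using X Zn by (simp_all add: flinear_diff[OF flinear_parity])
qed

lemma parity_fix:
  assumes "u \<in> boxfun (R @ L)" "i = length R"
  shows "parity i 1 u = 0 \<Longrightarrow> parity i 0 u = u" "parity i 0 u = 0 \<Longrightarrow> parity i 1 u = u"
  using parity_sum01[OF assms(1)] assms(2) by simp_all

lemma minus_one_scale_0: "fscale ((- 1) ^ b) v = 0 \<longleftrightarrow> v = (0 :: 'k lfun)"
  by (simp add: fv.scale_eq_0_iff)

text \<open>From index \<open>p * b + 1\<close> on, the sequences are, up to sign, the power
  \<open>Y\<close> of \<open>YYp i L\<close> applied to the terms from index 1 on. This gives
  conditions on \<open>e 1\<close> and on \<open>d t\<close> for t from 1 to p - 1. The condition on
  \<open>e 1\<close> and that on \<open>d (p - 1)\<close> combine to \<open>Y\<close> of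
  \<open>Xi i L\<close> at the initial data; the others give the \<open>p - 2\<close>
  copies.\<close>

lemma Xi_kernel_step:
  assumes i: "i = length R"
  shows "vdim {v. v \<in> boxfun (R @ (p * b + 1, 1) # L) \<and> Xi i ((p * b + 1, 1) # L) v = 0} =
    vdim {u. u \<in> boxfun (R @ L) \<and> (YYp i L ^^ b) (Xi i L u) = 0} +
    (p - 2) * vdim {u. u \<in> boxfun (R @ L) \<and> parity i 0 u = 0 \<and> (YYp i L ^^ b) u = 0}"
proof -
  define Y where "Y = YYp i L ^^ b"
  have lY: "flinear Y" unfolding Y_def by (rule lYn)
  define A0 where "A0 = {u. u \<in> boxfun (R @ L) \<and> Y (Xi i L u) = 0}"
  define A1 where "A1 = {u. u \<in> boxfun (R @ L) \<and> parity i 0 u = 0 \<and> Y u = 0}"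
  have "vdim {v. v \<in> boxfun (R @ (p * b + 1, 1) # L) \<and> Xi i ((p * b + 1, 1) # L) v = 0} =
     (\<Sum>t<p - 1. vdim (if t = 0 then A0 else A1))"
  proof (rule Xi_kernel_dim[OF i])
    show "fv.subspace (if t = 0 then A0 else A1)" for t :: nat
      using subspace_kernel[OF subspace_boxfun flinear_compose[OF lY flinear_Xi]] subspace_kernel2[OF subspace_boxfun flinear_parity lY]
      by (simp add: A0_def A1_def)
    show "(if t = 0 then A0 else A1) \<subseteq> boxfun (R @ L)" for t :: nat by (auto simp: A0_def A1_def)
    show "parity i 0 u = 0" if "1 \<le> t" "u \<in> (if t = 0 then A0 else A1)" for t :: nat and u
      using that by (auto simp: A1_def split: if_splits)
    fix e d assume s: "sol i L e d"
      and par: "\<And>x. e x \<in> boxfun (R @ L) \<and> parity i 1 (e x) = 0 \<and> d x \<in> boxfun (R @ L) \<and> parity i 0 (d x) = 0"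
    have fe: "parity i 0 (e x) = e x" "parity i 1 (d x) = d x" for x
      using parity_fix[OF _ i, of "e x" L] parity_fix[OF _ i, of "d x" L] par[of x] by auto
    let ?a = "ZZ i L (e 0) + XX i (d 0)" and ?c = "XX i (e 0) - (ZZ i L ^^ (p - 1)) (d 0)"
    note spl = Xi_split[of i "e 0" "d 0" L]
    have par0: "parity i 1 (e 0) = 0" "parity i 0 (d 0) = 0" using par by auto
    note spl = Xi_split[OF fe(1) par0(1) par0(2) fe(2), of L]
    have EY: "parity i r (Y u) = Y (parity i r u)" for r u unfolding Y_def by (rule Ypn_comm)
    have YXi: "Y (Xi i L (e 0 + d 0)) = 0 \<longleftrightarrow> Y ?a = 0 \<and> Y ?c = 0"
    proof
      assume *: "Y (Xi i L (e 0 + d 0)) = 0"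
      have E: "parity i 0 (?a + ?c) = ?a" "parity i 1 (?a + ?c) = ?c"
        using flinear_add[OF flinear_parity, of i 0 ?a ?c] flinear_add[OF flinear_parity, of i 1 ?a ?c]
        unfolding spl(2-5) by (simp_all only: add_0_left add_0_right)
      have "parity i r (Y (?a + ?c)) = 0" for r
        using * unfolding spl(1) by (simp only: op_lin)
      then show "Y ?a = 0 \<and> Y ?c = 0" using EY[of 0 "?a + ?c"] EY[of 1 "?a + ?c"] unfolding E by simp
    next
      assume "Y ?a = 0 \<and> Y ?c = 0" then show "Y (Xi i L (e 0 + d 0)) = 0"
        unfolding spl(1) by (simp add: flinear_add[OF lY])
    qed
    have e1: "Y (e 1) = 0 \<longleftrightarrow> Y ?a = 0"
      using sol_next(1)[OF s, of 0] by (simp add: flinear_uminus[OF lY] flinear_diff[OF lY] flinear_add[OF lY] del: add_uminus_conv_diff minus_add_distrib)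
    \<comment> \<open>In the recursion for \<open>d (p - 1)\<close> the terms with t > 0 are killed
      by \<open>Y\<close>, and t = 0 leaves the odd component of \<open>Xi\<close>.\<close>
    have dp: "Y (d (p - 1)) = 0 \<longleftrightarrow> Y ?c = 0" if z: "\<And>t. 1 \<le> t \<Longrightarrow> t < p - 1 \<Longrightarrow> Y (d t) = 0"
    proof -
      let ?S = "\<lambda>t. fscale (of_nat ((p - 1) choose t)) ((ZZ i L ^^ (p - 1 - t)) (d t))"
      have p1: "p - 1 = Suc (p - 2)" using p_ge_3 by simp
      have "(\<Sum>t<p - 1. Y (?S t)) = (\<Sum>t\<in>{0}. Y (?S t))"
      proof (rule sum.mono_neutral_right)
        show "\<forall>t\<in>{..<p - 1} - {0}. Y (?S t) = 0"
        proof
          fix t assume t: "t \<in> {..<p - 1} - {0}"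
          have "Y (?S t) = fscale (of_nat ((p - 1) choose t)) ((ZZ i L ^^ (p - 1 - t)) (Y (d t)))"
            unfolding flinear_scale[OF lY] unfolding Y_def Ypn_Zn ..
          also have "\<dots> = 0" using z[of t] t by (simp add: flinear_0[OF lZn] fv.scale_zero_right)
          finally show "Y (?S t) = 0" .
        qed
      qed (use p1 in auto)
      then have "(\<Sum>t<p - 1. Y (?S t)) = Y ((ZZ i L ^^ (p - 1)) (d 0))" by (simp add: fv.scale_one)
      then have "Y (d (p - 1)) = Y ?c"
        using sol_next(2)[OF s, of 0] by (simp add: flinear_diff[OF lY] fvp.linear_sum[OF flinear_linear[OF lY]])
      then show ?thesis by simp
    qed
    have shift: "e (p * b + 1) = 0 \<longleftrightarrow> Y (e 1) = 0" "d (p * b + 1 + t) = 0 \<longleftrightarrow> Y (d (1 + t)) = 0" for t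
      using YY_shift_mult(1)[OF s, of b 1] YY_shift_mult(2)[OF s, of b "1 + t"]
      by (simp_all add: Y_def minus_one_scale_0)
    have all: "(\<forall>t<p - 1. Y (d (1 + t)) = 0) \<longleftrightarrow> (\<forall>t. 1 \<le> t \<and> t < p - 1 \<longrightarrow> Y (d t) = 0) \<and> Y (d (p - 1)) = 0"
    proof (safe)
      fix t assume *: "\<forall>t<p - 1. Y (d (1 + t)) = 0"
      show "Y (d t) = 0" if "1 \<le> t" "t < p - 1" using *[rule_format, of "t - 1"] that by simp
      show "Y (d (p - 1)) = 0" using *[rule_format, of "p - 2"] p_ge_3 by (simp add: numeral_2_eq_2 Suc_diff_Suc)
    next
      fix t assume *: "\<forall>t. 1 \<le> t \<and> t < p - 1 \<longrightarrow> Y (d t) = 0" "Y (d (p - 1)) = 0" and t: "t < p - 1"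
      show "Y (d (1 + t)) = 0"
      proof (cases "1 + t < p - 1")
        case False
        then have "1 + t = p - 1" using t by simp
        then show ?thesis using * by simp
      qed (use * in auto)
    qed
    show "(e (p * b + 1) = 0 \<and> (\<forall>t<p - 1. d (p * b + 1 + t) = 0)) \<longleftrightarrow>
      (e 0 + d 0 \<in> (if (0 :: nat) = 0 then A0 else A1) \<and> (\<forall>t. 1 \<le> t \<and> t < p - 1 \<longrightarrow> d t \<in> (if t = 0 then A0 else A1)))"
    proof -
      have mem: "e 0 + d 0 \<in> A0 \<longleftrightarrow> Y (Xi i L (e 0 + d 0)) = 0" "d t \<in> A1 \<longleftrightarrow> Y (d t) = 0" for t
        using fv.subspace_add[OF subspace_boxfun] par by (auto simp: A0_def A1_def)
      have "(\<forall>t. 1 \<le> t \<and> t < p - 1 \<longrightarrow> d t \<in> (if t = 0 then A0 else A1)) \<longleftrightarrow> (\<forall>t. 1 \<le> t \<and> t < p - 1 \<longrightarrow> Y (d t) = 0)"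
        using mem(2) by auto
      then show ?thesis unfolding shift all e1 if_P[OF refl] mem(1) YXi using dp by blast
    qed
  qed
  also have "\<dots> = vdim A0 + (p - 2) * vdim A1"
  proof -
    have "{..<p - 1} = insert 0 {1..<p - 1}" using p_ge_3 by auto
    then show ?thesis by (simp add: numeral_2_eq_2)
  qed
  finally show ?thesis by (simp add: A0_def A1_def Y_def)
qed

lemma parity_parity: "parity i (2 * n + e) u = parity i e u"
  by (induction n) (simp_all add: parity_Suc_Suc)

lemma slice_ZZ_funpow: "slice y ((ZZ (Suc i) L ^^ n) v) = (ZZ i L ^^ n) (slice y v)"
  by (induction n) simp_all

lemma Xi_YYp: "Xi i L (YYp i L v) = YYp i L (Xi i L v)"
proof -
  have "(ZZ i L ^^ m) (YYp i L v) = YYp i L ((ZZ i L ^^ m) v)" for m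
    by (induction m) (simp_all add: YYp_comm)
  then show ?thesis
    unfolding Xi_def by (simp add: flinear_diff[OF flinear_YY] flinear_add[OF flinear_YY] YYp_comm)
qed

lemmas Xi_Ypn = funpow_commute[of "Xi i L" "YYp i L" for i L, OF Xi_YYp]

text \<open>The other factor in a matrix factorization of \<open>YYp i L\<close>.\<close>

definition Xi_adj :: "nat \<Rightarrow> (nat \<times> nat) list \<Rightarrow> 'k lfun \<Rightarrow> 'k lfun" where
  "Xi_adj i L u = XX i u - parity i 1 (ZZ i L u) + parity i 0 ((ZZ i L ^^ (p - 1)) u)"

lemma flinear_Xi_adj: "flinear (Xi_adj i L)"
  unfolding Xi_adj_def by (intro flinear_minus flinear_plus flinear_XX flinear_compose[OF flinear_parity flinear_ZZ]
    flinear_compose[OF flinear_parity lZn])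

text \<open>On pairs of an even and an odd component, with X = \<open>XX i\<close> and Z =
  \<open>ZZ i L\<close>, the matrix of \<open>Xi\<close> has the rows (Z, X) and (X, -Z^(p-1)), that
  of \<open>Xi_adj\<close> the rows (Z^(p-1), X) and (X, -Z). Their product is X^2 + Z^p times the
  identity, and Z^p is \<open>ZZ i (dilate p L)\<close>.\<close>

lemma Xi_adj_Xi:
  assumes u: "u \<in> boxfun (R @ L)" and i: "i = length R"
  shows "Xi_adj i L (Xi i L u) = YYp i L u"
proof -
  define e where "e = parity i 0 u"
  define d where "d = parity i 1 u"
  have ed: "parity i 0 e = e" "parity i 1 e = 0" "parity i 0 d = 0" "parity i 1 d = d"
    unfolding e_def d_def by (rule parity_parts)+
  have ue: "u = e + d" using parity_sum01[OF u] i by (simp add: e_def d_def)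
  let ?Zp = "ZZ i L ^^ (p - 1)"
  define a where "a = ZZ i L e + XX i d"
  define c where "c = XX i e - ?Zp d"
  note s = Xi_split[OF ed, of L, folded a_def c_def]
  have Z: "parity i 1 (ZZ i L a) = 0" "parity i 1 (ZZ i L c) = ZZ i L c"
    using ZZ_parity[of i L 1 a] ZZ_parity[of i L 1 c] s by (simp_all add: op_lin)
  have Zn: "parity i 0 (?Zp a) = ?Zp a" "parity i 0 (?Zp c) = 0"
    unfolding ZZ_funpow_comm s by (simp_all add: flinear_0[OF lZn])
  have p: "p = Suc (p - 1)" using p_ge_3 by simp
  have Zp: "?Zp (ZZ i L v) = (ZZ i L ^^ p) v" "ZZ i L (?Zp v) = (ZZ i L ^^ p) v" for v
    using p by (metis comp_apply funpow_Suc_right, metis comp_apply funpow.simps(2))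
  have "Xi_adj i L (Xi i L u) = XX i a + XX i c - ZZ i L c + ?Zp a"
    unfolding ue s(1) Xi_adj_def by (simp add: op_lin flinear_add[OF lZn] Z Z[unfolded One_nat_def] Zn Zn[unfolded One_nat_def])
  also have "\<dots> = XX i (XX i e) + XX i (XX i d) + ((ZZ i L ^^ p) e + (ZZ i L ^^ p) d)"
    unfolding a_def c_def
    by (simp add: op_lin flinear_add[OF lZn] flinear_diff[OF flinear_XX] flinear_diff[OF flinear_ZZ] XX_ZZ Zp Zp[unfolded One_nat_def] ZZ_funpow_comm(1))
  finally show ?thesis by (simp add: ue YY_def ZZ_dilate op_lin flinear_add[OF lZn] algebra_simps)
qed

lemma slice_Xi_Suc:
  "slice (2 * t) (Xi (Suc i) L v) = slice (2 * t + 1) v + Xi i L (slice (2 * t) v)"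
  "slice (2 * t + 1) (Xi (Suc i) L v) = slice (2 * t + 2) v - Xi_adj i L (slice (2 * t + 1) v)"
proof -
  have E: "parity i (2 * t) u = parity i 0 u" "parity i (Suc (2 * t)) u = parity i 1 u" "parity i (Suc (Suc (2 * t))) u = parity i 0 u" for u
    using parity_parity[of i t 0 u] parity_parity[of i t 1 u] by (simp_all add: parity_Suc_Suc)
  show "slice (2 * t) (Xi (Suc i) L v) = slice (2 * t + 1) v + Xi i L (slice (2 * t) v)"
    by (simp add: Xi_def flinear_diff[OF flinear_slice] slice_lin slice_ZZ_funpow E fv.scale_one)
  show "slice (2 * t + 1) (Xi (Suc i) L v) = slice (2 * t + 2) v - Xi_adj i L (slice (2 * t + 1) v)"
    by (simp add: Xi_def Xi_adj_def flinear_diff[OF flinear_slice] slice_lin slice_ZZ_funpow E fv.scale_one)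
qed

text \<open>Along the first signed coordinate the kernel equation alternates between
  \<open>- Xi i L\<close> and \<open>Xi_adj i L\<close>, so two steps apply
  \<open>- YYp i L\<close>. The support condition sets in at the odd index \<open>2 * b + 1\<close>,
  which is why a factor \<open>Xi\<close> is left over.\<close>

lemma Xi_kernel_super:
  assumes i: "i = length R"
  shows "vdim {v. v \<in> boxfun ((2 * b + 1, 1) # R @ L) \<and> Xi (Suc i) L v = 0} =
    vdim {u. u \<in> boxfun (R @ L) \<and> (YYp i L ^^ b) (Xi i L u) = 0}"
proof (rule vdim_iso[where f = "slice 0"])
  let ?K = "{v. v \<in> boxfun ((2 * b + 1, 1) # R @ L) \<and> Xi (Suc i) L v = 0}"
  let ?A = "{u. u \<in> boxfun (R @ L) \<and> (YYp i L ^^ b) (Xi i L u) = 0}"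
  let ?Y = "YYp i L"
  show "fv.subspace ?K" by (rule subspace_kernel[OF subspace_boxfun flinear_Xi])
  show "flinear (slice 0)" by (rule flinear_slice)
  show "fv.subspace ?A" by (rule subspace_kernel[OF subspace_boxfun flinear_compose[OF lYn flinear_Xi]])
  show "fdim ?A" by (rule fdim_subset[OF fdim_boxfun]) auto
  have Ysp: "(?Y ^^ t) u \<in> boxfun (R @ L)" if "u \<in> boxfun (R @ L)" for t and u :: "'k lfun"
    using that YY_boxfun[of _ R L "dilate p L"] i by (induction t) (simp_all add: boxfun_dilate)
  fix v assume v: "v \<in> ?K"
  have u0: "slice 0 v \<in> boxfun (R @ L)" using v by (simp add: boxfun_Cons)
  have odd: "slice (2 * t + 1) v = - Xi i L (slice (2 * t) v)" for t
  proof -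
    have "slice (2 * t) (Xi (Suc i) L v) = 0" using v by (simp add: slice_lin)
    then show ?thesis unfolding slice_Xi_Suc by (simp add: eq_neg_iff_add_eq_0)
  qed
  have even: "slice (2 * t) v = fscale ((- 1) ^ t) ((?Y ^^ t) (slice 0 v))" for t
  proof (induction t)
    case (Suc t)
    have "slice (2 * t + 1) (Xi (Suc i) L v) = 0" using v by (simp add: slice_lin)
    then have "slice (2 * t + 2) v = Xi_adj i L (slice (2 * t + 1) v)" unfolding slice_Xi_Suc by simp
    also have "\<dots> = - Xi_adj i L (Xi i L (slice (2 * t) v))" unfolding odd by (rule flinear_uminus[OF flinear_Xi_adj])
    also have "\<dots> = - ?Y (slice (2 * t) v)"
      using v by (subst Xi_adj_Xi[OF _ i]) (auto simp: boxfun_Cons)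
    finally show ?case unfolding Suc by (simp add: flinear_scale[OF flinear_YY])
  qed (simp add: fv.scale_one)
  have "slice (2 * b + 1) v = 0" using v by (simp add: boxfun_Cons)
  then have "Xi i L ((?Y ^^ b) (slice 0 v)) = 0"
    unfolding odd even by (simp add: flinear_scale[OF flinear_Xi] minus_one_scale_0)
  then show "slice 0 v \<in> ?A" using u0 by (simp add: Xi_Ypn)
  show "v = 0" if "slice 0 v = 0"
  proof (rule lfun_eqI)
    show "slice x v = slice x 0" for x
      using even[of "x div 2"] odd[of "x div 2"] that
      by (cases "even x") (simp_all add: flinear_0[OF lYn] flinear_0[OF flinear_Xi] slice_lin fv.scale_zero_right)
  qed (use v in \<open>simp add: boxfun_Cons\<close>)
next
  let ?K = "{v. v \<in> boxfun ((2 * b + 1, 1) # R @ L) \<and> Xi (Suc i) L v = 0}"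
  let ?Y = "YYp i L"
  fix a assume a: "a \<in> {u. u \<in> boxfun (R @ L) \<and> (?Y ^^ b) (Xi i L u) = 0}"
  have Ysp: "(?Y ^^ t) a \<in> boxfun (R @ L)" for t
    using a YY_boxfun[of _ R L "dilate p L"] i by (induction t) (simp_all add: boxfun_dilate)
  define ev where "ev t = fscale ((- 1) ^ t) ((?Y ^^ t) a)" for t
  define v where "v = glue (\<lambda>y. if even y then ev (y div 2) else - Xi i L (ev (y div 2)))"
  have evsp: "ev t \<in> boxfun (R @ L)" for t
    unfolding ev_def by (rule fv.subspace_scale[OF subspace_boxfun Ysp])
  have sv: "slice (2 * t) v = ev t" "slice (2 * t + 1) v = - Xi i L (ev t)" for t
    by (simp_all add: v_def)
  have xz: "Xi i L (ev t) = 0" if "t \<ge> b" for t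
  proof -
    have "(?Y ^^ t) (Xi i L a) = (?Y ^^ (t - b)) ((?Y ^^ b) (Xi i L a))"
      using that by (simp flip: funpow_add[THEN fun_cong, unfolded o_apply])
    then show ?thesis using a by (simp add: ev_def flinear_scale[OF flinear_Xi] Xi_Ypn flinear_0[OF lYn] fv.scale_zero_right)
  qed
  have evS: "ev (Suc t) = - Xi_adj i L (Xi i L (ev t))" for t
    using Xi_adj_Xi[OF evsp i, of t] by (simp add: ev_def flinear_scale[OF flinear_YY])
  have ez: "ev t = 0" if "t > b" for t
    using evS[of "t - 1"] xz[of "t - 1"] that by (simp add: flinear_0[OF flinear_Xi_adj])
  have "v \<in> boxfun ((2 * b + 1, 1) # R @ L)"
    unfolding boxfun_Cons
  proof (intro conjI allI impI)
    show "v [] = 0" by (simp add: v_def)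
    show "slice x v \<in> boxfun (R @ L)" for x
      using evsp i fv.subspace_neg[OF subspace_boxfun Xi_boxfun[OF evsp]] by (simp add: v_def)
    show "slice x v = 0" if "fst (2 * b + 1, 1 :: nat) \<le> x" for x
    proof (cases "even x")
      case True
      then have "x div 2 > b" using that by (auto elim!: evenE)
      then show ?thesis using True ez by (simp add: v_def)
    next
      case False
      then have "x div 2 \<ge> b" using that by simp
      then show ?thesis using False xz by (simp add: v_def)
    qed
  qed
  moreover have "Xi (Suc i) L v = 0"
  proof (rule lfun_eqI)
    show "Xi (Suc i) L v [] = (0 :: 'k lfun) []"
      using calculation Xi_boxfun[of v "(2 * b + 1, 1) # R" L] i by (simp add: boxfun_Cons)
    fix x
    show "slice x (Xi (Suc i) L v) = slice x 0"
    proof (cases "even x")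
      case True
      then obtain t where x: "x = 2 * t" by (rule evenE)
      show ?thesis unfolding x slice_Xi_Suc sv by (simp add: slice_lin)
    next
      case False
      then obtain t where x: "x = 2 * t + 1" by (rule oddE)
      have "slice (2 * t + 2) v = ev (Suc t)" using sv(1)[of "Suc t"] by simp
      then show ?thesis unfolding x slice_Xi_Suc sv by (simp add: slice_lin evS flinear_uminus[OF flinear_Xi_adj])
    qed
  qed
  moreover have "slice 0 v = a" using sv(1)[of 0] by (simp add: ev_def fv.scale_one)
  ultimately show "\<exists>v\<in>?K. slice 0 v = a" by blast
qed

text \<open>The component of parity \<open>Suc e\<close> vanishes, so these functions live in parity
  \<open>e\<close>.\<close>

definition pker :: "(nat \<times> nat) list \<Rightarrow> nat \<Rightarrow> nat \<Rightarrow> nat" where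
  "pker R e n = vdim {u :: 'k lfun. u \<in> boxfun R \<and> parity (length R) (Suc e) u = 0 \<and> (XX (length R) ^^ n) u = 0}"

lemmas lXn = flinear_funpow[OF flinear_XX]

lemma YYp_Nil: "(YYp i [] ^^ b) v = (XX i ^^ (2 * b)) v"
  by (induction b arbitrary: v) (simp_all add: YY_def dilate_def ZZ_Nil)

lemma pker_alt: "vdim {u :: 'k lfun. u \<in> boxfun R \<and> parity (length R) 1 u = 0 \<and> (XX (length R) ^^ n) u = 0} = pker R 0 n"
  "vdim {u :: 'k lfun. u \<in> boxfun R \<and> parity (length R) 0 u = 0 \<and> (XX (length R) ^^ n) u = 0} = pker R 1 n"
  by (simp_all add: pker_def parity_Suc_Suc)

text \<open>This removes the last unsigned coordinate. With the list empty, \<open>ZZ\<close> is 0,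
  so each condition on the initial data is the vanishing of a single power of
  \<open>XX\<close>.\<close>

lemma Xi_kernel_parity_sum:
  fixes nn :: "nat \<Rightarrow> nat"
  assumes char: "\<And>e d. sol (length R) [] e d \<Longrightarrow>
       (e j = 0 \<and> (\<forall>t<p - 1. d (j + t) = 0)) \<longleftrightarrow>
       ((XX (length R) ^^ n0) (e 0) = 0 \<and> (\<forall>t<p - 1. (XX (length R) ^^ nn t) (d t) = 0))"
  shows "vdim {v. v \<in> boxfun (R @ [(j, 1)]) \<and> Xi (length R) [(j, 1)] v = 0} = pker R 0 n0 + (\<Sum>t<p - 1. pker R 1 (nn t))"
proof -
  let ?i = "length R"
  define A :: "nat \<Rightarrow> 'k lfun set" where "A t = (if t = 0 then {u. u \<in> boxfun R \<and> (XX ?i ^^ n0) (parity ?i 0 u) = 0 \<and> (XX ?i ^^ nn 0) (parity ?i 1 u) = 0}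
      else {u. u \<in> boxfun R \<and> parity ?i 0 u = 0 \<and> (XX ?i ^^ nn t) u = 0})" for t
  have "vdim {v. v \<in> boxfun (R @ [(j, 1)]) \<and> Xi ?i [(j, 1)] v = 0} = (\<Sum>t<p - 1. vdim (A t))"
  proof (rule Xi_kernel_dim[OF refl])
    show "fv.subspace (A t)" for t
    proof (cases "t = 0")
      case True
      show ?thesis unfolding A_def if_P[OF True]
        by (rule subspace_kernel2[OF subspace_boxfun flinear_compose[OF lXn flinear_parity] flinear_compose[OF lXn flinear_parity]])
    next
      case False
      show ?thesis unfolding A_def if_not_P[OF False]
        by (rule subspace_kernel2[OF subspace_boxfun flinear_parity lXn])
    qed
    show "A t \<subseteq> boxfun (R @ [])" for t by (auto simp: A_def)
    show "parity ?i 0 u = 0" if "1 \<le> t" "u \<in> A t" for t u using that by (simp add: A_def)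
    fix e d assume s: "sol ?i [] e d"
      and par: "\<And>x. e x \<in> boxfun (R @ []) \<and> parity ?i 1 (e x) = 0 \<and> d x \<in> boxfun (R @ []) \<and> parity ?i 0 (d x) = 0"
    have fe: "parity ?i 0 (e x) = e x" "parity ?i 1 (d x) = d x" for x
      using parity_fix[OF _ refl, of "e x" R "[]"] parity_fix[OF _ refl, of "d x" R "[]"] par[of x] by auto
    have m0: "e 0 + d 0 \<in> A 0 \<longleftrightarrow> (XX ?i ^^ n0) (e 0) = 0 \<and> (XX ?i ^^ nn 0) (d 0) = 0"
      using par[of 0] fe[of 0] fv.subspace_add[OF subspace_boxfun, of "e 0" R "d 0"]
      by (simp add: A_def op_lin)
    have mt: "d t \<in> A t \<longleftrightarrow> (XX ?i ^^ nn t) (d t) = 0" if "1 \<le> t" for t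
      using par[of t] that by (simp add: A_def)
    have all: "(\<forall>t<p - 1. P t) \<longleftrightarrow> P 0 \<and> (\<forall>t. 1 \<le> t \<and> t < p - 1 \<longrightarrow> P t)" for P
    proof
      assume *: "P 0 \<and> (\<forall>t. 1 \<le> t \<and> t < p - 1 \<longrightarrow> P t)"
      show "\<forall>t<p - 1. P t"
      proof (intro allI impI)
        show "P t" if "t < p - 1" for t using * that by (cases "t = 0") auto
      qed
    qed (use p_ge_3 in simp)
    have "(\<forall>t. 1 \<le> t \<and> t < p - 1 \<longrightarrow> d t \<in> A t) \<longleftrightarrow> (\<forall>t. 1 \<le> t \<and> t < p - 1 \<longrightarrow> (XX ?i ^^ nn t) (d t) = 0)"
      using mt by blast
    then show "(e j = 0 \<and> (\<forall>t<p - 1. d (j + t) = 0)) \<longleftrightarrow> (e 0 + d 0 \<in> A 0 \<and> (\<forall>t. 1 \<le> t \<and> t < p - 1 \<longrightarrow> d t \<in> A t))"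
      unfolding char[OF s] m0 all[of "\<lambda>t. (XX ?i ^^ nn t) (d t) = 0"] by blast
  qed
  also have "\<dots> = vdim (A 0) + (\<Sum>t\<in>{1..<p - 1}. vdim (A t))"
  proof -
    have "{..<p - 1} = insert 0 {1..<p - 1}" using p_ge_3 by auto
    then show ?thesis by simp
  qed
  also have "vdim (A 0) = pker R 0 n0 + pker R 1 (nn 0)"
    using vdim_parity_split[OF _ refl lXn lXn, of "boxfun R :: 'k lfun set" R "[]" n0 ?i "nn 0" ?i]
    by (simp add: A_def pker_alt[unfolded One_nat_def])
  also have "(\<Sum>t\<in>{1..<p - 1}. vdim (A t)) = (\<Sum>t\<in>{1..<p - 1}. pker R 1 (nn t))"
    by (intro sum.cong) (auto simp: A_def pker_alt[unfolded One_nat_def])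
  also have "pker R 0 n0 + pker R 1 (nn 0) + \<dots> = pker R 0 n0 + (\<Sum>t<p - 1. pker R 1 (nn t))"
  proof -
    have "{..<p - 1} = insert 0 {1..<p - 1}" using p_ge_3 by auto
    then show ?thesis by simp
  qed
  finally show ?thesis .
qed

lemma Xi_kernel_base_0:
  "vdim {v. v \<in> boxfun (R @ [(p * b, 1)]) \<and> Xi (length R) [(p * b, 1)] v = 0} = pker R 0 (2 * b) + (p - 1) * pker R 1 (2 * b)"
proof -
  let ?i = "length R"
  have "vdim {v. v \<in> boxfun (R @ [(p * b, 1)]) \<and> Xi ?i [(p * b, 1)] v = 0} = pker R 0 (2 * b) + (\<Sum>t<p - 1. pker R 1 (2 * b))"
  proof (rule Xi_kernel_parity_sum)
    fix e d assume s: "sol ?i [] e d"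
    show "(e (p * b) = 0 \<and> (\<forall>t<p - 1. d (p * b + t) = 0)) \<longleftrightarrow>
       ((XX ?i ^^ (2 * b)) (e 0) = 0 \<and> (\<forall>t<p - 1. (XX ?i ^^ (2 * b)) (d t) = 0))"
      using YY_shift_mult[OF s, of b 0] YY_shift_mult(2)[OF s, of b] by (simp add: YYp_Nil minus_one_scale_0)
  qed
  then show ?thesis by simp
qed

lemma sol_Nil:
  assumes "sol i [] e d"
  shows "e (Suc x) = - XX i (d x)" "d (x + (p - 1)) = XX i (e x)" "d (x + p) = - XX i (XX i (d x))"
proof -
  show "e (Suc x) = - XX i (d x)" using sol_next(1)[OF assms, of x] by (simp add: ZZ_Nil)
  have "(ZZ i [] ^^ (p - 1 - t)) (d (x + t)) = 0" if "t < p - 1" for t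
  proof -
    have "p - 1 - t = Suc (p - 2 - t)" using that by simp
    then show ?thesis by (metis ZZ_Nil comp_apply funpow.simps(2))
  qed
  then show "d (x + (p - 1)) = XX i (e x)"
    using sol_next(2)[OF assms, of x] by (simp add: fv.scale_zero_right)
  show "d (x + p) = - XX i (XX i (d x))"
    using YY_shift(2)[OF assms, of x] by (simp add: YY_def dilate_def ZZ_Nil)
qed

text \<open>Without \<open>ZZ\<close> the equations only multiply by \<open>XX\<close> and move the
  index, see \<open>sol_Nil\<close>. Going \<open>p\<close> indices ahead costs two factors of
  \<open>XX\<close>; the remainder \<open>k\<close> contributes none, one or two more, depending on
  how the \<open>p - 1\<close> indices from \<open>p * b + k\<close> on wrap around modulo
  \<open>p\<close>.\<close>

lemma Xi_kernel_base:
  assumes k: "1 \<le> k" "k \<le> p - 1"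
  shows "vdim {v. v \<in> boxfun (R @ [(p * b + k, 1)]) \<and> Xi (length R) [(p * b + k, 1)] v = 0} =
    pker R 0 (2 * b + 1) + pker R 1 (2 * b + 1) + (p - 1 - k) * pker R 1 (2 * b) + (k - 1) * pker R 1 (2 * b + 2)"
proof -
  let ?i = "length R"
  \<comment> \<open>The window of \<open>d\<close> constrains \<open>d t\<close> directly for
    \<open>t \<ge> k\<close> and after wrapping around for \<open>t < k - 1\<close>. The gap
    \<open>t = k - 1\<close> is filled by the condition on \<open>e (p * b + k)\<close>, and the
    index of residue \<open>p - 1\<close> constrains \<open>e 0\<close>.\<close>
  define nn where "nn t = (if t < k - 1 then 2 * b + 2 else if t = k - 1 then 2 * b + 1 else 2 * b)" for t
  let ?X = "XX ?i :: 'k lfun \<Rightarrow> 'k lfun"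
  have "vdim {v. v \<in> boxfun (R @ [(p * b + k, 1)]) \<and> Xi ?i [(p * b + k, 1)] v = 0} =
      pker R 0 (2 * b + 1) + (\<Sum>t<p - 1. pker R 1 (nn t))"
  proof (rule Xi_kernel_parity_sum)
    fix e d assume s: "sol ?i [] e d"
    let ?Q = "?X ^^ (2 * b)"
    have Q1: "(?X ^^ (2 * b + 1)) u = ?Q (?X u)" "(?X ^^ (2 * b + 2)) u = ?Q (?X (?X u))" for u
      by (simp_all add: funpow_swap1)
    have lQ: "flinear ?Q" by (rule lXn)
    have 1: "e (p * b + k) = 0 \<longleftrightarrow> (?X ^^ (2 * b + 1)) (d (k - 1)) = 0"
    proof -
      have "e k = - ?X (d (k - 1))" using sol_Nil(1)[OF s, of "k - 1"] k by simp
      then show ?thesis unfolding Q1 YY_shift_mult(1)[OF s, of b k] minus_one_scale_0 YYp_Nil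
        by (simp add: flinear_uminus[OF lQ])
    qed
    have 2: "d (p * b + k + t) = 0 \<longleftrightarrow> ?Q (d (k + t)) = 0" for t
      using YY_shift_mult(2)[OF s, of b "k + t"] by (simp add: minus_one_scale_0 YYp_Nil add.assoc)
    have 3: "?Q (d (p - 1)) = (?X ^^ (2 * b + 1)) (e 0)"
      unfolding Q1 using sol_Nil(2)[OF s, of 0] by simp
    have 4: "?Q (d (p + t)) = - (?X ^^ (2 * b + 2)) (d t)" for t
      unfolding Q1 using sol_Nil(3)[OF s, of t] by (simp add: add.commute flinear_uminus[OF lQ])
    show "(e (p * b + k) = 0 \<and> (\<forall>t<p - 1. d (p * b + k + t) = 0)) \<longleftrightarrow>
       ((?X ^^ (2 * b + 1)) (e 0) = 0 \<and> (\<forall>t<p - 1. (?X ^^ nn t) (d t) = 0))"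
      (is "?l \<longleftrightarrow> ?r")
    proof
      assume ?l
      then have l: "(?X ^^ (2 * b + 1)) (d (k - 1)) = 0" "\<And>t. t < p - 1 \<Longrightarrow> ?Q (d (k + t)) = 0"
        unfolding 1 2 by auto
      have "?Q (d (p - 1)) = 0" using l(2)[of "p - 1 - k"] k p_ge_3 by simp
      moreover have "(?X ^^ nn t) (d t) = 0" if t: "t < p - 1" for t
      proof -
        consider "t < k - 1" | "t = k - 1" | "t \<ge> k" by linarith
        then show ?thesis
        proof cases
          case 1
          have eq: "k + (p + t - k) = p + t" "p + t - k < p - 1" using 1 k by auto
          show ?thesis using l(2)[OF eq(2)] 1 unfolding eq 4 by (simp add: nn_def)
        next
          case 2
          then show ?thesis using l(1) by (simp add: nn_def)
        next
          case 3
          then have "t \<noteq> k - 1" "\<not> t < k - 1" using k by auto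
          then show ?thesis using l(2)[of "t - k"] t 3 by (simp add: nn_def)
        qed
      qed
      ultimately show ?r unfolding 3 by blast
    next
      assume r: ?r
      then have r': "\<And>t. t < p - 1 \<Longrightarrow> (?X ^^ nn t) (d t) = 0" by blast
      have "(?X ^^ (2 * b + 1)) (d (k - 1)) = 0" using r'[of "k - 1"] k by (simp add: nn_def)
      moreover have "?Q (d (k + t)) = 0" if t: "t < p - 1" for t
      proof -
        consider "k + t < p - 1" | "k + t = p - 1" | u where "k + t = p + u" "u < k - 1"
        proof -
          consider "k + t < p - 1" | "k + t = p - 1" | "k + t \<ge> p" by linarith
          then show thesis
          proof cases
            case 3
            then show thesis using that(3)[of "k + t - p"] t k by simp
          qed (use that in auto)
        qed
        then show ?thesis
        proof cases
          case 1
          have "nn (k + t) = 2 * b" using k by (auto simp: nn_def)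
          then show ?thesis using r'[OF 1] by simp
        next
          case 2
          show ?thesis unfolding 2 3 using r by blast
        next
          case 3
          have "u < p - 1" using 3 k by simp
          then show ?thesis unfolding 3 4 using r'[of u] 3(2) by (simp add: nn_def)
        qed
      qed
      ultimately show ?l unfolding 1 2 by blast
    qed
  qed
  also have "(\<Sum>t<p - 1. pker R 1 (nn t)) =
     (\<Sum>t\<in>{..<k - 1}. pker R 1 (nn t)) + (pker R 1 (nn (k - 1)) + (\<Sum>t\<in>{k..<p - 1}. pker R 1 (nn t)))"
  proof -
    have "{..<p - 1} = {..<k - 1} \<union> insert (k - 1) {k..<p - 1}" using k by auto
    then have "(\<Sum>t<p - 1. pker R 1 (nn t)) = (\<Sum>t\<in>{..<k - 1} \<union> insert (k - 1) {k..<p - 1}. pker R 1 (nn t))" by simp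
    also have "\<dots> = (\<Sum>t\<in>{..<k - 1}. pker R 1 (nn t)) + (\<Sum>t\<in>insert (k - 1) {k..<p - 1}. pker R 1 (nn t))"
      by (rule sum.union_disjoint) auto
    also have "(\<Sum>t\<in>insert (k - 1) {k..<p - 1}. pker R 1 (nn t)) = pker R 1 (nn (k - 1)) + (\<Sum>t\<in>{k..<p - 1}. pker R 1 (nn t))"
      using k by (intro sum.insert) auto
    finally show ?thesis .
  qed
  also have "(\<Sum>t\<in>{..<k - 1}. pker R 1 (nn t)) = (k - 1) * pker R 1 (2 * b + 2)"
    by (simp add: nn_def)
  also have "(\<Sum>t\<in>{k..<p - 1}. pker R 1 (nn t)) = (\<Sum>t\<in>{k..<p - 1}. pker R 1 (2 * b))"
    using k by (intro sum.cong) (auto simp: nn_def)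
  finally show ?thesis by (simp add: nn_def)
qed

end

lemma glueat_sliceat:
  assumes "u \<in> boxfun (R @ a # L)"
  shows "glueat (length R) (\<lambda>x. sliceat (length R) x u) = u"
proof -
  let ?v = "glueat (length R) (\<lambda>x. sliceat (length R) x u)"
  have v: "?v \<in> boxfun (R @ a # L)" using sliceat_boxfun[OF assms] by (intro glueat_boxfun)
  have "sliceat (length R) x ?v = sliceat (length R) x u" for x
    using sliceat_boxfun(1)[OF assms] by (intro sliceat_glueat)
  then have "?v - u = 0"
    by (intro sliceat_eq_0[OF fv.subspace_diff[OF subspace_boxfun v assms]]) (simp add: flinear_diff[OF flinear_sliceat])
  then show ?thesis by simp
qed

lemma flinear_glueat:
  assumes "\<And>x. flinear (\<lambda>v. w v x)"
  shows "flinear (\<lambda>v. glueat i (w v))"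
  using assms
proof (induction i arbitrary: w)
  case 0
  show ?case by (rule lfun_linearI) (simp_all add: glueat.simps(1) 0)
next
  case (Suc i)
  have "flinear (\<lambda>v. glueat i (\<lambda>x. slice y (w v x)))" for y
    by (rule Suc.IH) (rule flinear_compose[OF flinear_slice Suc.prems])
  then show ?case
    by - (rule lfun_linearI[of "\<lambda>v. glueat (Suc i) (w v)"], simp_all)
qed

lemma vdim_singleton_0: "vdim {0 :: 'i \<Rightarrow> 'k::field} = 0"
proof (rule fdim_basis[OF fdim_singleton_0])
  fix B :: "('i \<Rightarrow> 'k) set" assume "B \<subseteq> {0}" "fv.independent B" "card B = vdim {0 :: 'i \<Rightarrow> 'k}"
  moreover have "0 \<notin> B" using calculation(2) fv.dependent_zero by blast
  ultimately show ?thesis by (metis card.empty subset_singletonD singletonI)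
qed

section \<open>Signed boxes as sums and alternating sums of nullities\<close>

primrec snull_alt :: "'k::field itself \<Rightarrow> nat \<Rightarrow> nat \<Rightarrow> (nat \<times> nat) list \<Rightarrow> int" where
  "snull_alt K 0 b L = int (snull K L)"
| "snull_alt K (Suc m) b L = snull_alt K m b ((b + 1, 1) # L) - snull_alt K m b ((b, 1) # L)"

lemma snull_alt_perm: "mset L = mset L' \<Longrightarrow> snull_alt K m b L = snull_alt K m b L'"
proof (induction m arbitrary: L L')
  case (Suc m)
  show ?case
    using Suc.IH[of "(b + 1, 1) # L" "(b + 1, 1) # L'"] Suc.IH[of "(b, 1) # L" "(b, 1) # L'"] Suc.prems by simp
qed (use snull_perm in \<open>simp, blast\<close>)

context char_p
begin

definition pnull :: "nat \<Rightarrow> nat \<Rightarrow> nat \<Rightarrow> (nat \<times> nat) list \<Rightarrow> nat \<Rightarrow> nat" where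
  "pnull m b e L n = vdim {u :: 'k lfun. u \<in> boxfun (replicate m (2 * b + 1, 1) @ L) \<and> parity m (Suc e) u = 0 \<and> (YY m L ^^ n) u = 0}"

lemma pnull_0: "pnull 0 b e L n = (if even e then snull K ((n, 1) # L) else 0)"
proof -
  have Y: "YY 0 L v = shift L v" for v by (simp add: YY_def XX.simps(1) ZZ.simps(1))
  have "YY 0 L = shift L" by (rule ext) (rule Y)
  show ?thesis
  proof (cases "even e")
    case False
    then have "{u :: 'k lfun. u \<in> boxfun (replicate 0 (2 * b + 1, 1) @ L) \<and> parity 0 (Suc e) u = 0 \<and> (YY 0 L ^^ n) u = 0} = {0}"
      using flinear_0[OF lYn] fv.subspace_0[OF subspace_boxfun] by (auto simp: parity.simps(1))
    then show ?thesis unfolding pnull_def using False by (simp add: vdim_singleton_0)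
  qed (simp add: pnull_def snull_power[unfolded One_nat_def] parity.simps(1) \<open>YY 0 L = shift L\<close>)
qed

lemma pnull_parity: "pnull m b (Suc (Suc e)) L n = pnull m b e L n"
  by (simp add: pnull_def parity_Suc_Suc)

lemma slice_YY_Suc: "slice y (YY (Suc i) L v) = slice (y + 2) v + YY i L (slice y v)"
  unfolding YY_def flinear_add[OF flinear_slice] XX_XX_Suc by (simp add: add.assoc)

lemma sliceat_YY: "sliceat i x (YY i ((j, 1) # L) u) = sliceat i (Suc x) u + YY i L (sliceat i x u)"
  unfolding YY_def by (simp add: op_lin sliceat_ZZ sliceat_XX algebra_simps)

text \<open>\<open>YY\<close> contains only the squares of the signed shifts, so the
  \<open>b + 1\<close> even and the \<open>b\<close> odd positions of a signed coordinate decouple,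
  and each class becomes an unsigned coordinate of step width 1. An odd position reverses the parity
  required of the rest.\<close>

lemma pnull_Suc: "pnull (Suc m) b e L n = pnull m b e ((b + 1, 1) # L) n + pnull m b (Suc e) ((b, 1) # L) n"
proof -
  let ?R = "replicate m (2 * b + 1, 1 :: nat)"
  define st :: "bool \<Rightarrow> nat \<Rightarrow> nat" where "st t x = 2 * x + (if t then 0 else 1)" for t x
  define bd where "bd t = (if t then b + 1 else b)" for t
  define f :: "bool \<Rightarrow> 'k lfun \<Rightarrow> 'k lfun" where "f t v = glueat m (\<lambda>x. slice (st t x) v)" for t v
  define A :: "bool \<Rightarrow> 'k lfun set" where "A t = {u. u \<in> boxfun (?R @ (bd t, 1) # L) \<and> parity m (Suc (if t then e else Suc e)) u = 0 \<and> (YY m ((bd t, 1) # L) ^^ n) u = 0}" for t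
  let ?K = "{u :: 'k lfun. u \<in> boxfun ((2 * b + 1, 1) # ?R @ L) \<and> parity (Suc m) (Suc e) u = 0 \<and> (YY (Suc m) L ^^ n) u = 0}"
  have len: "length ?R = m" by simp
  have E: "parity m (Suc (if t then e else Suc e)) v = parity m (Suc e + st t x) v" for t x v
    using parity_parity[of m x "Suc (if t then e else Suc e)" v] by (cases t) (simp_all add: st_def ac_simps)
  have Yf: "sliceat m x ((YY m ((j, 1) # L) ^^ k) u) = slice (st t x) ((YY (Suc m) L ^^ k) v)"
    if "\<And>x. sliceat m x u = slice (st t x) v" for u v :: "'k lfun" and t k x j
    using that
  proof (induction k arbitrary: u v)
    case (Suc k)
    have "sliceat m x (YY m ((j, 1) # L) u) = slice (st t x) (YY (Suc m) L v)" for x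
      unfolding sliceat_YY slice_YY_Suc Suc.prems by (simp add: st_def)
    from Suc.IH[OF this] show ?case by (simp only: funpow_Suc_right o_apply)
  qed simp
  have fs: "f t v \<in> boxfun (?R @ (bd t, 1) # L)" "sliceat m x (f t v) = slice (st t x) v"
    if "v \<in> boxfun ((2 * b + 1, 1) # ?R @ L)" for t x and v :: "'k lfun"
  proof -
    have 1: "slice (st t x) v \<in> boxfun (?R @ L)" "x \<ge> bd t \<Longrightarrow> slice (st t x) v = 0" for x
      using that by (auto simp: boxfun_Cons st_def bd_def)
    show "f t v \<in> boxfun (?R @ (bd t, 1) # L)"
      unfolding f_def using glueat_boxfun[of "\<lambda>x. slice (st t x) v" ?R L "(bd t, 1)"] 1 by (simp only: len fst_conv)
    show "sliceat m x (f t v) = slice (st t x) v"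
      unfolding f_def using sliceat_glueat[of "\<lambda>x. slice (st t x) v" ?R L x] 1 by (simp only: len)
  qed
  have sz: "u = 0" if "u \<in> boxfun (?R @ (j, 1) # L)" "\<And>x. sliceat m x u = 0" for u :: "'k lfun" and j
    using sliceat_eq_0[OF that(1)] that(2) by (simp only: len)
  have st_ex: "\<exists>t x. y = st t x" for y
    by (rule exI[of _ "even y"], rule exI[of _ "y div 2"]) (simp add: st_def)
  have Yn_Nil: "((YY (Suc m) L ^^ n) v) [] = 0" if "v [] = 0" for v
    using that by (induction n) (simp_all add: YY_def)
  have Ysp: "(YY m ((j, 1) # L) ^^ k) u \<in> boxfun (?R @ (j, 1) # L)" if "u \<in> boxfun (?R @ (j, 1) # L)" for u :: "'k lfun" and k j
    using that YY_boxfun[of _ ?R "(j, 1) # L" "(j, 1) # L"] by (induction k) (simp_all only: funpow.simps id_apply o_apply len)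
  have "fdim ?K \<and> vdim ?K = (\<Sum>t\<in>UNIV. vdim (A t))"
  proof (rule vdim_family[where f = f])
    show "fv.subspace ?K" by (rule subspace_kernel2[OF subspace_boxfun flinear_parity lYn])
    show "finite (UNIV :: bool set)" by simp
    show "flinear (f t)" for t unfolding f_def by (rule flinear_glueat) (rule flinear_slice)
    show "fv.subspace (A t)" for t unfolding A_def by (rule subspace_kernel2[OF subspace_boxfun flinear_parity lYn])
    show "fdim (A t)" for t by (rule fdim_subset[OF fdim_boxfun[of "?R @ (bd t, 1) # L"]]) (auto simp: A_def)
    show "f t v \<in> A t" if v: "v \<in> ?K" for t v
    proof -
      have vs: "v \<in> boxfun ((2 * b + 1, 1) # ?R @ L)" and Ev: "parity (Suc m) (Suc e) v = 0" and Yv: "(YY (Suc m) L ^^ n) v = 0"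
        using v by auto
      note f1 = fs(1)[OF vs, of t] and f2 = fs(2)[OF vs, of _ t]
      have "sliceat m x (parity m (Suc (if t then e else Suc e)) (f t v)) = slice (st t x) (parity (Suc m) (Suc e) v)" for x
        unfolding sliceat_parity f2 E[of t _ x] by simp
      then have 1: "parity m (Suc (if t then e else Suc e)) (f t v) = 0"
        by (intro sz[OF ops_boxfun(3)[OF f1, unfolded len]]) (simp only: Ev slice_lin)
      have "sliceat m x ((YY m ((bd t, 1) # L) ^^ n) (f t v)) = slice (st t x) ((YY (Suc m) L ^^ n) v)" for x
        by (rule Yf) (rule f2)
      then have 2: "(YY m ((bd t, 1) # L) ^^ n) (f t v) = 0"
        by (intro sz[OF Ysp[OF f1]]) (simp only: Yv slice_lin)
      show ?thesis unfolding A_def using f1 1 2 by blast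
    qed
    show "v = 0" if "v \<in> ?K" "\<And>t. t \<in> UNIV \<Longrightarrow> f t v = 0" for v
    proof (rule lfun_eqI)
      show "v [] = (0 :: 'k lfun) []" using that(1) by (simp add: boxfun_Cons)
      fix y
      obtain t x where y: "y = st t x" using st_ex by blast
      have "v \<in> boxfun ((2 * b + 1, 1) # ?R @ L)" using that(1) by blast
      from fs(2)[OF this, of x t] show "slice y v = slice y 0" using that(2)[of t] by (simp add: y op_lin slice_lin)
    qed
    show "\<exists>v\<in>?K. \<forall>t\<in>UNIV. f t v = a t" if a': "\<And>t. t \<in> UNIV \<Longrightarrow> a t \<in> A t" for a
    proof -
      have a: "a t \<in> boxfun (?R @ (bd t, 1) # L)" "parity m (Suc (if t then e else Suc e)) (a t) = 0"
        "(YY m ((bd t, 1) # L) ^^ n) (a t) = 0" for t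
        using a'[of t] unfolding A_def by blast+
      define v where "v = glue (\<lambda>y. sliceat m (y div 2) (a (even y)))"
      have sv: "slice (st t x) v = sliceat m x (a t)" for t x by (simp add: v_def st_def)
      have sls: "sliceat m x (a t) \<in> boxfun (?R @ L)" "bd t \<le> x \<Longrightarrow> sliceat m x (a t) = 0" for t x
        using sliceat_boxfun[OF a(1)[of t], of x] unfolding len by simp_all
      have vs: "v \<in> boxfun ((2 * b + 1, 1) # ?R @ L)"
        unfolding boxfun_Cons
      proof (intro conjI allI impI)
        show "v [] = 0" by (simp add: v_def)
        fix y
        obtain t x where y: "y = st t x" using st_ex by blast
        show "slice y v \<in> boxfun (?R @ L)" using sls unfolding y sv by simp
        assume "fst (2 * b + 1, 1 :: nat) \<le> y"
        then have "bd t \<le> x" unfolding y by (auto simp: st_def bd_def split: if_splits)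
        then show "slice y v = 0" using sls unfolding y sv by simp
      qed
      have ft: "f t v = a t" for t
        using glueat_sliceat[OF a(1)[of t]] unfolding f_def sv len .
      have "parity (Suc m) (Suc e) v = 0"
      proof (rule lfun_eqI)
        fix y
        obtain t x where y: "y = st t x" using st_ex by blast
        have "slice y (parity (Suc m) (Suc e) v) = sliceat m x (parity m (Suc (if t then e else Suc e)) (a t))"
          unfolding sliceat_parity E[of t _ x] y sv[symmetric] by simp
        then show "slice y (parity (Suc m) (Suc e) v) = slice y 0" by (simp only: a(2) op_lin slice_lin)
      qed simp
      moreover have "(YY (Suc m) L ^^ n) v = 0"
      proof (rule lfun_eqI)
        fix y
        obtain t x where y: "y = st t x" using st_ex by blast
        have "sliceat m x ((YY m ((bd t, 1) # L) ^^ n) (a t)) = slice (st t x) ((YY (Suc m) L ^^ n) v)"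
          by (rule Yf) (simp add: sv)
        then show "slice y ((YY (Suc m) L ^^ n) v) = slice y 0" unfolding y by (simp only: a(3) op_lin slice_lin)
      qed (simp add: Yn_Nil v_def)
      ultimately show ?thesis using vs ft by blast
    qed
  qed
  then show ?thesis by (simp add: pnull_def A_def bd_def UNIV_bool add.commute)
qed

text \<open>By \<open>pnull_Suc\<close> the number is a sum of nullities that all contain the side
  of step width \<open>p\<close>, and \<open>snull_split_residues\<close> makes these affine in
  \<open>k\<close>. Hence the summands split off by \<open>Xi_kernel_step\<close> do not disturb
  linear interpolation.\<close>

lemma pnull_affine:
  "\<exists>c1 c0. \<forall>k\<le>p. pnull m b e (M @ [(p * b' + k, p)]) n = k * c1 + (p - k) * c0"
proof (induction m arbitrary: e M)
  case 0
  show ?case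
  proof (cases "even e")
    case True
    have "snull K ((n, 1) # M @ [(p * b' + k, p)]) = snull K ((p * b' + k, p) # (n, 1) # M)" for k
      by (rule snull_perm) simp
    then show ?thesis using True snull_split_residues[of p _ K b' "(n, 1) # M"] p_ge_3
      by (rule_tac exI[of _ "snull K ((b' + 1, 1) # (n, 1) # M)"], rule_tac exI[of _ "snull K ((b', 1) # (n, 1) # M)"])
        (simp add: pnull_0)
  qed (auto simp: pnull_0 intro!: exI[of _ 0])
next
  case (Suc m)
  from Suc.IH[of e "(b + 1, 1) # M"] Suc.IH[of "Suc e" "(b, 1) # M"] obtain c1 c0 d1 d0 where
    "\<forall>k\<le>p. pnull m b e ((b + 1, 1) # M @ [(p * b' + k, p)]) n = k * c1 + (p - k) * c0"
    "\<forall>k\<le>p. pnull m b (Suc e) ((b, 1) # M @ [(p * b' + k, p)]) n = k * d1 + (p - k) * d0"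
    by auto
  then show ?case
    by (rule_tac exI[of _ "c1 + d1"], rule_tac exI[of _ "c0 + d0"]) (simp add: pnull_Suc add_mult_distrib2 del: One_nat_def)
qed

lemma pker_pnull: "pker (replicate m (2 * b + 1, 1)) e (2 * n) = pnull m b e [] n"
  using YYp_Nil[of n m] by (simp add: pker_def pnull_def dilate_def)

text \<open>The second summand of \<open>pnull_Suc\<close> exchanges the parities, so it enters the
  difference of the even and the odd dimension with a minus sign.\<close>

lemma snull_alt_pnull: "int (pnull m b 0 L n) - int (pnull m b 1 L n) = snull_alt K m b ((n, 1) # L)"
proof (induction m arbitrary: L)
  case (Suc m)
  have sw: "snull_alt K m b ((n, 1) # x # L) = snull_alt K m b (x # (n, 1) # L)" for x by (rule snull_alt_perm) simp
  have "int (pnull (Suc m) b 0 L n) - int (pnull (Suc m) b 1 L n) =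
    (int (pnull m b 0 ((b + 1, 1) # L) n) - int (pnull m b 1 ((b + 1, 1) # L) n)) -
    (int (pnull m b 0 ((b, 1) # L) n) - int (pnull m b 1 ((b, 1) # L) n))"
    unfolding pnull_Suc using pnull_parity[of m b 0 "(b, 1) # L" n] by simp
  also have "\<dots> = snull_alt K m b ((b + 1, 1) # (n, 1) # L) - snull_alt K m b ((b, 1) # (n, 1) # L)"
    unfolding Suc by (simp only: sw)
  finally show ?case by simp
qed (simp add: pnull_0)

text \<open>\<open>XX\<close> maps the kernel of its $(n+2)$-nd power into that of its $(n+1)$-st, exchanging parities.\<close>

lemma pker_concave: "pker R (Suc e) (Suc (Suc n)) + pker R e n \<le> pker R (Suc e) (Suc n) + pker R e (Suc n)"
proof -
  let ?i = "length R"
  define Q where "Q e n = {u :: 'k lfun. u \<in> boxfun R \<and> parity ?i (Suc e) u = 0 \<and> (XX ?i ^^ n) u = 0}" for e n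
  have sQ: "fv.subspace (Q e n)" for e n
    unfolding Q_def by (rule subspace_kernel2[OF subspace_boxfun flinear_parity lXn])
  have fQ: "fdim (Q e n)" for e n
    unfolding Q_def by (rule fdim_subset[OF fdim_boxfun[of R]]) auto
  have X: "XX ?i v \<in> Q e k" if "v \<in> Q (Suc e) (Suc k)" for v k
  proof -
    have "parity ?i (Suc e) (XX ?i v) = XX ?i (parity ?i (Suc (Suc e)) v)"
      using XX_parity[of ?i "Suc (Suc e)" v] by (simp add: parity_Suc_Suc)
    then show ?thesis using that ops_boxfun(2)[of v R "[]"] by (simp add: Q_def op_lin funpow_swap1)
  qed
  have "vdim (Q (Suc e) (Suc (Suc n))) + vdim (Q e n) \<le> vdim {v \<in> Q (Suc e) (Suc (Suc n)). XX ?i v \<in> Q e n} + vdim (Q e (Suc n))"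
  proof (rule vdim_quot_inj)
    show "Q e n \<subseteq> Q e (Suc n)" by (auto simp: Q_def op_lin)
    show "XX ?i ` Q (Suc e) (Suc (Suc n)) \<subseteq> Q e (Suc n)" using X by blast
  qed (rule sQ fQ flinear_XX)+
  also have "{v \<in> Q (Suc e) (Suc (Suc n)). XX ?i v \<in> Q e n} = Q (Suc e) (Suc n)"
  proof (intro equalityI subsetI)
    show "v \<in> Q (Suc e) (Suc n)" if "v \<in> {v \<in> Q (Suc e) (Suc (Suc n)). XX ?i v \<in> Q e n}" for v
      using that by (simp add: Q_def funpow_swap1)
    show "v \<in> {v \<in> Q (Suc e) (Suc (Suc n)). XX ?i v \<in> Q e n}" if "v \<in> Q (Suc e) (Suc n)" for v
      using X[OF that] that by (simp add: Q_def op_lin)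
  qed
  finally show ?thesis by (simp add: Q_def pker_def)
qed

lemma pker_mono: "pker R e n \<le> pker R e (Suc n)"
proof -
  have "fdim {u :: 'k lfun. u \<in> boxfun R \<and> parity (length R) (Suc e) u = 0 \<and> (XX (length R) ^^ Suc n) u = 0}"
    by (rule fdim_subset[OF fdim_boxfun[of R]]) blast
  then show ?thesis unfolding pker_def by (rule vdim_mono) (auto simp: op_lin)
qed

lemma pker_parity: "pker R (Suc (Suc e)) n = pker R e n"
  by (simp add: pker_def parity_Suc_Suc)

lemma vdim_boxfun_replicate: "vdim (boxfun (replicate m (q, 1)) :: 'k lfun set) = q ^ m"
proof -
  let ?B = "{xs. list_all2 (\<lambda>a x. x < fst a) (replicate m (q, 1 :: nat)) xs}"
  have "{v :: 'k lfun. \<forall>x. x \<notin> ?B \<longrightarrow> v x = 0} = boxfun (replicate m (q, 1))"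
    unfolding boxfun_def by simp
  moreover have "vdim {v :: 'k lfun. \<forall>x. x \<notin> ?B \<longrightarrow> v x = 0} = card ?B"
    by (rule vdim_supported(2)[OF finite_box])
  ultimately have "vdim (boxfun (replicate m (q, 1)) :: 'k lfun set) = card ?B" by (rule subst)
  also have "{xs. list_all2 (\<lambda>a x. x < fst a) (replicate m (q, 1 :: nat)) xs} = {xs. set xs \<subseteq> {..<q} \<and> length xs = m}"
    by (auto simp: list_all2_conv_all_nth set_conv_nth)
  finally show ?thesis by (simp add: card_lists_length_eq)
qed

lemma pker_total_le:
  assumes "length R = m" "R = replicate m (q, 1)"
  shows "pker R 0 n + pker R 1 n \<le> q ^ m"
proof -
  let ?X = "XX (length R) ^^ n :: 'k lfun \<Rightarrow> 'k lfun"
  have "pker R 0 n + pker R 1 n = vdim {u :: 'k lfun. u \<in> boxfun R \<and> ?X (parity (length R) 0 u) = 0 \<and> ?X (parity (length R) 1 u) = 0}"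
    using vdim_parity_split[OF _ refl lXn lXn, of "boxfun R :: 'k lfun set" R "[]" n "length R" n "length R"]
    by (simp add: pker_alt[unfolded One_nat_def])
  also have "\<dots> \<le> vdim (boxfun R :: 'k lfun set)" by (rule vdim_mono[OF fdim_boxfun]) auto
  finally show ?thesis using vdim_boxfun_replicate[of m q] assms(2) by simp
qed

text \<open>All sides but one are converted into signed ones by \<open>Xi_kernel_step\<close> and
  \<open>Xi_kernel_super\<close>. The terms split off are affine in \<open>k\<close> from 0 to
  \<open>p\<close> inclusive, whereas the last term follows the affine formula of
  \<open>Xi_kernel_base\<close> only strictly in between. At 0 and \<open>p\<close> this formula
  exceeds the actual values by \<open>A\<close> and \<open>A'\<close>, which are negated second
  differences of kernel dimensions.\<close>

lemma kernel_count:
  assumes m: "m \<ge> 1" and q: "q = 2 * b + 1"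
  obtains A A' :: real where "A \<ge> 0" "A' \<ge> 0" "A - A' = real_of_int (snull_alt K (Suc m) b [])"
    "A + A' \<le> real q ^ (m - 1)"
    "\<And>k. 1 \<le> k \<Longrightarrow> k \<le> p - 1 \<Longrightarrow>
       real (snull K ((p * b + k, 1) # replicate m (p * b + 1, 1))) =
       (1 - k / p) * (snull K ((p * b, 1) # replicate m (p * b + 1, 1)) + A) +
       (k / p) * (snull K ((p * (b + 1), 1) # replicate m (p * b + 1, 1)) + A')"
proof -
  let ?a = "p * b + 1"
  define R where "R i = replicate i (q, 1 :: nat)" for i
  define N where "N e n = real (pker (R m) e n)" for e n
  define L where "L k j = replicate j (?a, 1) @ [(p * b + k, 1 :: nat)]" for k j
  define F where "F k i j = vdim {v :: 'k lfun. v \<in> boxfun (R i @ L k j) \<and> Xi i (L k j) v = 0}" for k i j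
  have Fstep: "F k i (Suc j) = F k (Suc i) j + (p - 2) * pnull i b 1 (dilate p (L k j)) b" for k i j
  proof -
    have lR: "length (R i) = i" by (simp add: R_def)
    have spR: "boxfun (R i @ dilate p (L k j)) = (boxfun (R i @ L k j) :: 'k lfun set)"
      unfolding boxfun_dilate[of p "R i @ L k j", symmetric] by (simp add: boxfun_def dilate_def list_all2_conv_all_nth nth_append)
    have "F k i (Suc j) = vdim {u :: 'k lfun. u \<in> boxfun (R i @ L k j) \<and> (YYp i (L k j) ^^ b) (Xi i (L k j) u) = 0} +
        (p - 2) * vdim {u :: 'k lfun. u \<in> boxfun (R i @ L k j) \<and> parity i 0 u = 0 \<and> (YYp i (L k j) ^^ b) u = 0}"
      using Xi_kernel_step[OF lR[symmetric], of b "L k j"] by (simp add: F_def L_def)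
    also have "vdim {u :: 'k lfun. u \<in> boxfun (R i @ L k j) \<and> (YYp i (L k j) ^^ b) (Xi i (L k j) u) = 0} = F k (Suc i) j"
      using Xi_kernel_super[OF lR[symmetric], of b "L k j"] by (simp add: F_def R_def q)
    also have "vdim {u :: 'k lfun. u \<in> boxfun (R i @ L k j) \<and> parity i 0 u = 0 \<and> (YYp i (L k j) ^^ b) u = 0} = pnull i b 1 (dilate p (L k j)) b"
      unfolding pnull_def using spR by (simp add: R_def q parity_Suc_Suc)
    finally show ?thesis .
  qed
  have Fsum: "F k i j = F k (i + j) 0 + (p - 2) * (\<Sum>t<j. pnull (i + t) b 1 (dilate p (L k (j - 1 - t))) b)" for k i j
  proof (induction j arbitrary: i)
    case (Suc j)
    show ?case unfolding Fstep Suc.IH[of "Suc i"] sum.lessThan_Suc_shift by (simp add: algebra_simps)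
  qed simp
  define f where "f k = snull K ((p * b + k, 1) # replicate m (?a, 1))" for k
  have fF: "f k = F k 0 m" for k
  proof -
    have "f k = snull K (L k m)" unfolding f_def by (rule snull_perm) (simp add: L_def)
    also have "\<dots> = F k 0 m"
      by (simp add: snull_def F_def R_def Xi_def XX.simps(1) parity.simps(1) ZZ.simps(1))
    finally show ?thesis .
  qed
  have "\<exists>c1 c0. \<forall>k\<le>p. (\<Sum>t<j. pnull t b 1 (dilate p (L k (m - 1 - t))) b) = k * c1 + (p - k) * c0" for j
  proof (induction j)
    case 0
    show ?case by (rule exI[of _ 0], rule exI[of _ 0]) simp
  next
    case (Suc j)
    have "dilate p (L k j') = dilate p (replicate j' (?a, 1)) @ [(p * b + k, p)]" for k j'
      by (simp add: L_def dilate_def)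
    then obtain d1 d0 where "\<forall>k\<le>p. pnull j b 1 (dilate p (L k (m - 1 - j))) b = k * d1 + (p - k) * d0"
      using pnull_affine[of j b 1 "dilate p (replicate (m - 1 - j) (?a, 1))" b b] by auto
    moreover obtain c1 c0 where "\<forall>k\<le>p. (\<Sum>t<j. pnull t b 1 (dilate p (L k (m - 1 - t))) b) = k * c1 + (p - k) * c0"
      using Suc by blast
    ultimately show ?case
      by (rule_tac exI[of _ "c1 + d1"], rule_tac exI[of _ "c0 + d0"]) (simp add: add_mult_distrib2)
  qed
  then obtain c1 c0 where c: "\<And>k. k \<le> p \<Longrightarrow> (\<Sum>t<m. pnull t b 1 (dilate p (L k (m - 1 - t))) b) = k * c1 + (p - k) * c0"
    by meson
  have f: "f k = F k m 0 + (p - 2) * (k * c1 + (p - k) * c0)" if "k \<le> p" for k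
    using Fsum[of k 0 m] c[OF that] by (simp add: fF)
  have lR: "length (R m) = m" by (simp add: R_def)
  have q1: "2 * b = q - 1" "q - 1 + 1 = q" "q - 1 + 2 = q + 1" "2 * (b + 1) = q + 1" using q by simp_all
  have Fk: "real (F k m 0) = N 0 q + N 1 q + (real p - 1 - k) * N 1 (q - 1) + (real k - 1) * N 1 (q + 1)" if "1 \<le> k" "k \<le> p - 1" for k
    using Xi_kernel_base[OF that, of "R m" b] that unfolding lR q1
    by (simp add: F_def L_def N_def of_nat_diff)
  have F0: "real (F 0 m 0) = N 0 (q - 1) + (real p - 1) * N 1 (q - 1)"
    using Xi_kernel_base_0[of "R m" b] p_ge_3 unfolding lR q1 by (simp add: F_def L_def N_def of_nat_diff)
  have Fp: "real (F p m 0) = N 0 (q + 1) + (real p - 1) * N 1 (q + 1)"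
  proof -
    have "F p m 0 = pker (R m) 0 (q + 1) + (p - 1) * pker (R m) 1 (q + 1)"
      using Xi_kernel_base_0[of "R m" "b + 1"] unfolding lR q1 by (simp add: F_def L_def add.commute)
    then show ?thesis using p_ge_3 by (simp add: N_def of_nat_diff)
  qed
  \<comment> \<open>The values at \<open>k = 0\<close> and \<open>k = p\<close> of the affine
    formula in \<open>Fk\<close>, minus those in \<open>F0\<close> and \<open>Fp\<close>.\<close>
  define A where "A = N 1 q + N 0 q - N 1 (q + 1) - N 0 (q - 1)"
  define A' where "A' = N 1 q + N 0 q - N 1 (q - 1) - N 0 (q + 1)"
  have conc: "N (Suc e) (Suc (Suc n)) + N e n \<le> N (Suc e) (Suc n) + N e (Suc n)" for e n
    using pker_concave[of "R m" e n] unfolding N_def by linarith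
  have q_Suc: "q = Suc (q - 1)" using q by simp
  have par: "N (Suc (Suc 0)) n = N 0 n" for n by (simp add: N_def pker_parity)
  have A0: "A \<ge> 0" using conc[of 0 "q - 1"] q_Suc by (simp add: A_def)
  have A'0: "A' \<ge> 0" using conc[of 1 "q - 1"] q_Suc par by (simp add: A'_def)
  have psign: "N 0 (2 * n) - N 1 (2 * n) = snull_alt K m b [(n, 1)]" for n
    using snull_alt_pnull[of m b "[]" n] pker_pnull[of m b _ n] unfolding N_def R_def q by (metis of_int_diff of_int_of_nat_eq)
  have sig: "A - A' = real_of_int (snull_alt K (Suc m) b [])"
    using psign[of "b + 1"] psign[of b] unfolding q1 A_def A'_def by simp
  \<comment> \<open>The total dimension is concave in the exponent and starts at 0, so
    \<open>M q - M (q - 1)\<close> is at most the average increment \<open>M q / q\<close>, hence at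
    most \<open>q ^ (m - 1)\<close>. As \<open>M\<close> is also monotone, this increment bounds
    \<open>A + A' = 2 * M q - M (q + 1) - M (q - 1)\<close>.\<close>
  define M where "M n = N 0 n + N 1 n" for n
  have Mc: "M (Suc (Suc n)) - M (Suc n) \<le> M (Suc n) - M n" for n
    using conc[of 0 n] conc[of 1 n] by (simp add: M_def par)
  have Md: "M (Suc (n + d)) - M (n + d) \<le> M (Suc n) - M n" for n d
    by (induction d) (use Mc in \<open>simp, smt (verit) add_Suc_right\<close>)
  have "real n * (M q - M (q - 1)) \<le> M n - M 0" if "n \<le> q" for n
    using that
  proof (induction n)
    case (Suc n)
    have "M q - M (q - 1) \<le> M (Suc n) - M n"
      using Md[of n "q - 1 - n"] Suc.prems q_Suc by simp
    then show ?case using Suc by (simp add: algebra_simps)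
  qed simp
  from this[of q] have "real q * (M q - M (q - 1)) \<le> M q" by (simp add: M_def N_def)
  also have "M q \<le> real q ^ m"
    using pker_total_le[of "R m" m q q] by (simp add: M_def N_def R_def flip: of_nat_power of_nat_add)
  also have "\<dots> = real q * real q ^ (m - 1)" using m by (simp flip: power_Suc)
  finally have Mq: "M q - M (q - 1) \<le> real q ^ (m - 1)" using q by simp
  have "A + A' \<le> real q ^ (m - 1)"
    using Mq pker_mono[of "R m" 0 q] pker_mono[of "R m" 1 q] unfolding A_def A'_def M_def N_def by simp
  moreover have fk: "real (f k) = (1 - k / p) * (f 0 + A) + (k / p) * (f p + A')" if k: "1 \<le> k" "k \<le> p - 1" for k
  proof -
    have kp: "k \<le> p" using k by simp
    have rp: "real p > 0" using p_ge_3 by simp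
    define s where "s = real (p - 2)"
    have f': "real (f k) = real (F k m 0) + s * (real k * c1 + (real p - k) * c0)" "real (f 0) = real (F 0 m 0) + s * (real p * c0)"
      "real (f p) = real (F p m 0) + s * (real p * c1)"
      using f[OF kp] f[of 0] f[of p] kp by (simp_all add: s_def of_nat_diff)
    define x where "x = real k / real p"
    have kx: "real k = x * real p" using rp by (simp add: x_def)
    show ?thesis unfolding f' F0 Fp Fk[OF k] x_def[symmetric] kx A_def A'_def by (simp add: algebra_simps)
  qed
  ultimately show thesis
    by (intro that[OF A0 A'0 sig]) (simp_all add: f_def add.commute[of p])
qed

end

section \<open>The coefficients of secant plus tangent\<close>

definition sectan :: "real fps" where
  "sectan = (1 + fps_sin 1) / fps_cos 1"

lemma fps_cos_nz: "fps_cos (c :: real) \<noteq> 0"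
  by (metis fps_cos_nth_0 fps_zero_nth zero_neq_one)

lemma sectan_mult_cos: "sectan * fps_cos 1 = 1 + fps_sin 1"
proof -
  have "is_unit (fps_cos (1::real))" by (simp add: fps_is_unit_iff)
  then show ?thesis unfolding sectan_def by (metis dvd_div_mult_self unit_imp_dvd)
qed

text \<open>Both sides are 2 sec (sec + tan); the identity is checked after multiplication by cos^2.
  It yields a convolution recurrence with positive terms.\<close>

lemma sectan_ode: "2 * fps_deriv sectan = 1 + sectan * sectan"
proof -
  let ?F = sectan and ?C = "fps_cos (1::real)" and ?S = "fps_sin (1::real)"
  have FC: "?F * ?C = 1 + ?S" by (rule sectan_mult_cos)
  have sq: "?C * ?C + ?S * ?S = 1"
    using fps_sin_cos_sum_of_squares[of "1::real"] by (simp add: power2_eq_square)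
  have "fps_deriv (?F * ?C) = fps_deriv (1 + ?S)" by (simp add: FC)
  then have d: "fps_deriv ?F * ?C - ?F * ?S = ?C"
    by (simp add: fps_sin_deriv fps_cos_deriv algebra_simps flip: fps_const_neg)
  have "(2 * fps_deriv ?F) * (?C * ?C) = 2 * (fps_deriv ?F * ?C - ?F * ?S) * ?C + 2 * (?F * ?C) * ?S"
    by (simp add: algebra_simps)
  also have "\<dots> = 2 * (?C * ?C) + 2 * (1 + ?S) * ?S" by (simp only: d FC mult.assoc)
  also have "\<dots> = (?C * ?C) + (1 + ?S) * (1 + ?S) + ((?C * ?C + ?S * ?S) - 1)" by (simp add: algebra_simps)
  also have "\<dots> = (?C * ?C) + (?F * ?C) * (?F * ?C)" by (simp only: sq FC) simp
  also have "\<dots> = (1 + ?F * ?F) * (?C * ?C)" by (simp add: algebra_simps)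
  finally show ?thesis using fps_cos_nz[of 1] by simp
qed

section \<open>Recurrence and growth of the coefficients\<close>

abbreviation stc :: "nat \<Rightarrow> real" where "stc j \<equiv> fps_nth sectan j"

lemma stc_0: "stc 0 = 1"
  using arg_cong[OF sectan_mult_cos, of "\<lambda>f. fps_nth f 0"] by simp

lemma stc_rec: "2 * real (Suc j) * stc (Suc j) = (if j = 0 then 1 else 0) + (\<Sum>i\<le>j. stc i * stc (j - i))"
proof -
  have "fps_nth (2 * fps_deriv sectan) j = 2 * (real (Suc j) * stc (Suc j))"
    unfolding mult_2[of "fps_deriv sectan"] fps_add_nth fps_deriv_nth by (simp add: algebra_simps)
  moreover have "fps_nth (1 + sectan * sectan) j = (if j = 0 then 1 else 0) + (\<Sum>i\<le>j. stc i * stc (j - i))"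
    unfolding fps_add_nth fps_mult_nth fps_one_nth atLeast0AtMost ..
  ultimately show ?thesis unfolding sectan_ode by (simp only: mult.assoc)
qed

lemma stc_pos: "stc j > 0"
proof (induction j rule: less_induct)
  case (less j)
  show ?case
  proof (cases j)
    case (Suc i)
    have "(\<Sum>k\<le>i. stc k * stc (i - k)) > 0"
      using less Suc by (intro sum_pos) auto
    then have "2 * real (Suc i) * stc (Suc i) > 0" unfolding stc_rec by auto
    then show ?thesis using Suc by (simp add: zero_less_mult_iff)
  qed (simp add: stc_0)
qed

lemma stc_values: "stc 1 = 1" "stc 2 = 1/2" "stc 3 = 1/3" "stc 4 = 5/24" "stc 5 = 2/15"
proof -
  show 1: "stc 1 = 1" using stc_rec[of 0] by (simp add: stc_0)
  show 2: "stc 2 = 1/2" using stc_rec[of 1] 1 by (simp add: stc_0 numeral_2_eq_2)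
  show 3: "stc 3 = 1/3" using stc_rec[of 2] 1 2 by (simp add: stc_0 numeral_2_eq_2 numeral_3_eq_3)
  show 4: "stc 4 = 5/24" using stc_rec[of 3] 1 2 3 by (simp add: stc_0 numeral_eq_Suc)
  show "stc 5 = 2/15" using stc_rec[of 4] 1 3 4 2[unfolded numeral_2_eq_2] by (simp add: stc_0 numeral_eq_Suc)
qed

text \<open>For \<open>j \<ge> 2\<close> the coefficient of index \<open>j - 1\<close> is not
  affected by the constant 1 in the differential equation.\<close>

lemma stc_conv: "j \<ge> 2 \<Longrightarrow> (\<Sum>i<j. stc i * stc (j - 1 - i)) = 2 * real j * stc j"
  using stc_rec[of "j - 1"] by (cases j) (auto simp: lessThan_Suc_atMost)

lemma stc_split: "(\<Sum>i\<le>j. stc i * stc (j - i)) = (\<Sum>i<j. stc i * stc (Suc (j - 1 - i))) + stc j"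
proof -
  have "(\<Sum>i\<le>j. stc i * stc (j - i)) = (\<Sum>i<j. stc i * stc (j - i)) + stc j"
    by (simp add: stc_0 flip: lessThan_Suc_atMost)
  also have "(\<Sum>i<j. stc i * stc (j - i)) = (\<Sum>i<j. stc i * stc (Suc (j - 1 - i)))"
    by (intro sum.cong) (auto simp: Suc_diff_Suc)
  finally show ?thesis .
qed

lemma stc_half: "stc j \<le> 2 * stc (Suc j)"
proof (induction j rule: less_induct)
  case (less j)
  consider "j = 0" | "j = 1" | "j \<ge> 2" by linarith
  then show ?case
  proof cases
    case 3
    have "2 * real j * stc j = (\<Sum>i<j. stc i * stc (j - 1 - i))" using stc_conv[OF 3] by simp
    also have "\<dots> \<le> (\<Sum>i<j. stc i * (2 * stc (Suc (j - 1 - i))))"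
      using less 3 stc_pos by (intro sum_mono mult_left_mono) (auto intro: less_imp_le)
    also have "\<dots> = 2 * (\<Sum>i<j. stc i * stc (Suc (j - 1 - i)))"
      by (simp add: sum_distrib_left mult_ac)
    also have "\<dots> = 2 * (2 * real (Suc j) * stc (Suc j) - stc j)"
      using stc_rec[of j] stc_split[of j] 3 by simp
    finally have "2 * real (Suc j) * stc j \<le> 2 * real (Suc j) * (2 * stc (Suc j))"
      by (simp add: algebra_simps)
    then show ?thesis by (simp del: of_nat_Suc)
  qed (use stc_values stc_0 in \<open>auto simp: numeral_2_eq_2\<close>)
qed

lemma stc_decreasing: "stc (Suc j) \<le> stc j"
proof (induction j rule: less_induct)
  case (less j)
  consider "j = 0" | "j = 1" | "j \<ge> 2" by linarith
  then show ?case
  proof cases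
    case 3
    have "2 * real (Suc j) * stc (Suc j) = (\<Sum>i<j. stc i * stc (Suc (j - 1 - i))) + stc j"
      using stc_rec[of j] stc_split[of j] 3 by simp
    also have "\<dots> \<le> (\<Sum>i<j. stc i * stc (j - 1 - i)) + stc j"
      using less 3 stc_pos by (intro add_mono sum_mono mult_left_mono) (auto intro: less_imp_le)
    also have "\<dots> \<le> 2 * real (Suc j) * stc j"
      unfolding stc_conv[OF 3] using stc_pos[of j] by (simp add: algebra_simps)
    finally show ?thesis by (simp del: of_nat_Suc)
  qed (use stc_values stc_0 in \<open>auto simp: numeral_2_eq_2\<close>)
qed

lemma stc_le: "j \<ge> 4 \<Longrightarrow> stc j \<le> 5 / 24"
proof (induction j rule: dec_induct)
  case (step n)
  then show ?case using stc_decreasing[of n] by linarith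
qed (simp add: stc_values)

text \<open>The values on $0, \dots, c$ of the $(m+1)$-fold window sum of an alternating pulse of half-period $2c + 1$, where $m$ is the second argument.\<close>

primrec half_wave :: "nat \<Rightarrow> nat \<Rightarrow> nat \<Rightarrow> real" where
  "half_wave c 0 k = 1"
| "half_wave c (Suc n) k = half_wave c n 0 + 2 * (\<Sum>i = 1..c - k. half_wave c n i)"

section \<open>Trigonometric form of the generating function of the half waves\<close>

context
  fixes c :: nat and p :: real
  defines "p \<equiv> 2 * real c + 1"
begin

definition stc_gf :: "real fps" where "stc_gf = Abs_fps (\<lambda>j. stc j * p ^ j)"

lemma stc_gf_cos: "stc_gf * fps_cos p = 1 + fps_sin p"
proof (rule fps_ext)
  fix n
  have c: "fps_nth (fps_cos p) k = p ^ k * fps_nth (fps_cos 1) k" for k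
    by (simp add: fps_cos_def)
  have "fps_nth (stc_gf * fps_cos p) n = (\<Sum>i=0..n. p ^ n * (stc i * fps_nth (fps_cos 1) (n - i)))"
    unfolding fps_mult_nth
  proof (intro sum.cong refl)
    fix i assume "i \<in> {0..n}"
    then have "p ^ n = p ^ i * p ^ (n - i)" by (simp flip: power_add)
    then show "fps_nth stc_gf i * fps_nth (fps_cos p) (n - i) = p ^ n * (stc i * fps_nth (fps_cos 1) (n - i))"
      by (simp add: stc_gf_def c)
  qed
  also have "\<dots> = p ^ n * fps_nth (sectan * fps_cos 1) n"
    by (simp add: fps_mult_nth sum_distrib_left)
  also have "\<dots> = fps_nth (1 + fps_sin p) n"
    unfolding sectan_mult_cos by (simp add: fps_sin_def)
  finally show "fps_nth (stc_gf * fps_cos p) n = fps_nth (1 + fps_sin p) n" .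
qed

lemma stc_gf_sin: "stc_gf * fps_sin p + fps_cos p = stc_gf"
proof -
  have sq: "fps_cos p * fps_cos p + fps_sin p * fps_sin p = 1"
    using fps_sin_cos_sum_of_squares[of p] by (simp add: power2_eq_square)
  have "(stc_gf * fps_sin p + fps_cos p) * fps_cos p = (stc_gf * fps_cos p) * fps_sin p + fps_cos p * fps_cos p"
    by (simp add: algebra_simps)
  also have "\<dots> = fps_sin p + (fps_cos p * fps_cos p + fps_sin p * fps_sin p)"
    unfolding stc_gf_cos by (simp add: algebra_simps)
  also have "\<dots> = stc_gf * fps_cos p" unfolding stc_gf_cos sq by simp
  finally show ?thesis using fps_cos_nz[of p] by simp
qed

text \<open>The expected solution of the system for the half waves once the variable is replaced by
  sin(t), up to a factor cos(t). Here \<open>fps_cos a\<close> stands for cos(a t), and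
  \<open>stc_gf\<close> for (sec + tan)(p t).\<close>

definition trig_gf :: "nat \<Rightarrow> real fps" where
  "trig_gf k = stc_gf * fps_cos (2 * real k) - fps_sin (2 * real k)"

text \<open>With F = \<open>stc_gf\<close> one has F cos(pt) - sin(pt) = 1 and F sin(pt) + cos(pt) =
  F, so the addition theorems turn p - b into b.\<close>

lemma trig_gf_reflect: "stc_gf * fps_cos (p - b) - fps_sin (p - b) = fps_cos b + stc_gf * fps_sin b"
proof -
  have "stc_gf * fps_cos (p - b) - fps_sin (p - b) =
     fps_cos b * (stc_gf * fps_cos p - fps_sin p) + fps_sin b * (stc_gf * fps_sin p + fps_cos p)"
    using fps_cos_add[of p "- b"] fps_sin_add[of p "- b"]
    by (simp add: fps_sin_even fps_cos_odd algebra_simps)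
  then show ?thesis unfolding stc_gf_cos stc_gf_sin by (simp add: algebra_simps)
qed

lemma trig_gf_c: "trig_gf c = fps_cos 1 + fps_sin 1 * trig_gf 0"
  using trig_gf_reflect[of 1] by (simp add: trig_gf_def p_def mult.commute)

text \<open>With b = 2k + 1 the two arguments are b - 1 and b + 1. Taking the difference produces a
  factor 2 sin(t), and the cofactor belongs to the reflected argument p - b = 2(c - k).\<close>

lemma trig_gf_step:
  assumes "k < c"
  shows "trig_gf k = trig_gf (Suc k) + 2 * fps_sin 1 * trig_gf (c - k)"
proof -
  define b where "b = 2 * real k + 1"
  have "trig_gf (c - k) = fps_cos b + stc_gf * fps_sin b"
    using trig_gf_reflect[of b] assms by (simp add: trig_gf_def p_def b_def of_nat_diff algebra_simps)
  moreover have Ek: "trig_gf k = stc_gf * fps_cos (b - 1) - fps_sin (b - 1)" "trig_gf (Suc k) = stc_gf * fps_cos (b + 1) - fps_sin (b + 1)"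
    by (simp_all add: trig_gf_def b_def algebra_simps)
  moreover have "fps_cos (b - 1) = fps_cos b * fps_cos 1 + fps_sin b * fps_sin 1"
    "fps_sin (b - 1) = fps_sin b * fps_cos 1 - fps_cos b * fps_sin 1"
    using fps_cos_add[of b "-1"] fps_sin_add[of b "-1"]
    by (simp_all add: fps_sin_even fps_cos_odd)
  ultimately show ?thesis unfolding fps_cos_add fps_sin_add
    by (simp only:) (simp add: algebra_simps)
qed

lemma trig_gf_system: "k \<le> c \<Longrightarrow> trig_gf k = fps_cos 1 + fps_sin 1 * (trig_gf 0 + 2 * (\<Sum>i = 1..c - k. trig_gf i))"
proof (induction "c - k" arbitrary: k)
  case 0
  then have "k = c" by simp
  then show ?case by (simp add: trig_gf_c)
next
  case (Suc d)
  have "trig_gf k = trig_gf (Suc k) + 2 * fps_sin 1 * trig_gf (c - k)" using Suc trig_gf_step by simp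
  also have "trig_gf (Suc k) = fps_cos 1 + fps_sin 1 * (trig_gf 0 + 2 * (\<Sum>i = 1..c - Suc k. trig_gf i))"
    using Suc by (intro Suc.hyps(1)) auto
  also have "\<dots> + 2 * fps_sin 1 * trig_gf (c - k) =
      fps_cos 1 + fps_sin 1 * (trig_gf 0 + 2 * (\<Sum>i = 1..Suc (c - Suc k). trig_gf i))"
  proof -
    have "c - k = Suc (c - Suc k)" using Suc by simp
    then show ?thesis by (simp add: algebra_simps)
  qed
  also have "Suc (c - Suc k) = c - k" using Suc by simp
  finally show ?case .
qed

definition half_wave_gf :: "nat \<Rightarrow> real fps" where "half_wave_gf k = Abs_fps (\<lambda>n. half_wave c n k)"

lemma half_wave_gf_system: "half_wave_gf k = 1 + fps_X * (half_wave_gf 0 + 2 * (\<Sum>i = 1..c - k. half_wave_gf i))"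
proof (rule fps_ext)
  fix n show "fps_nth (half_wave_gf k) n = fps_nth (1 + fps_X * (half_wave_gf 0 + 2 * (\<Sum>i = 1..c - k. half_wave_gf i))) n"
    by (cases n) (simp_all add: half_wave_gf_def fps_sum_nth numeral_fps_const)
qed

text \<open>Both sides solve the same linear system, in which every unknown on the right carries a
  factor sin(t). As sin(t) has no constant term, the coefficients of the difference vanish one after
  the other.\<close>

lemma half_wave_gf_trig_gf: assumes "k \<le> c" shows "fps_cos 1 * (half_wave_gf k oo fps_sin 1) = trig_gf k"
proof -
  define D where "D k = fps_cos 1 * (half_wave_gf k oo fps_sin 1) - trig_gf k" for k
  have s0: "fps_nth (fps_sin (1::real)) 0 = 0" by simp
  have D_sys: "D k = fps_sin 1 * (D 0 + 2 * (\<Sum>i = 1..c - k. D i))" if "k \<le> c" for k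
  proof -
    have "half_wave_gf k oo fps_sin 1 = 1 + fps_sin 1 * ((half_wave_gf 0 oo fps_sin 1) + 2 * (\<Sum>i = 1..c - k. half_wave_gf i oo fps_sin 1))"
      by (subst half_wave_gf_system) (simp add: fps_compose_add_distrib fps_compose_mult_distrib[OF s0]
          fps_compose_sum_distrib numeral_fps_const)
    then show ?thesis
      unfolding D_def by (subst trig_gf_system[OF that]) (simp add: algebra_simps sum_distrib_left sum_subtractf)
  qed
  have "fps_nth (D k) n = 0" if "k \<le> c" for n k
    using that
  proof (induction n arbitrary: k rule: less_induct)
    case (less n)
    let ?W = "D 0 + 2 * (\<Sum>i = 1..c - k. D i)"
    have "fps_nth ?W m = 0" if "m < n" for m
      using less.IH[OF that] by (auto simp: fps_sum_nth numeral_fps_const intro!: sum.neutral)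
    then have "fps_nth (fps_sin 1) i * fps_nth ?W (n - i) = 0" if "i \<le> n" for i
      using s0 that by (cases "i = 0") auto
    then have "fps_nth (fps_sin 1 * ?W) n = 0"
      by (subst fps_mult_nth) (auto intro!: sum.neutral)
    then show ?case by (simp only: D_sys[OF less.prems])
  qed
  then have "D k = 0" using assms by (intro fps_ext) simp
  then show ?thesis by (simp add: D_def)
qed

lemma half_wave_gf_0: "fps_cos 1 * (half_wave_gf 0 oo fps_sin 1) = stc_gf"
  using half_wave_gf_trig_gf[of 0] by (simp add: trig_gf_def)

end

section \<open>Coefficients under the substitution of the sine\<close>

definition deriv2 :: "(nat \<Rightarrow> real) \<Rightarrow> nat \<Rightarrow> real" where
  "deriv2 f j = real (j + 1) * real (j + 2) * f (j + 2)"

text \<open>If $\cos(t)\, g(\sin t) = f(t)$, the differential equation for $g$ expresses the coefficients of $g$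
  through those of $f$ and $f''$; the recursion only adds nonnegative terms.\<close>

fun compose_coeff :: "nat \<Rightarrow> (nat \<Rightarrow> real) \<Rightarrow> real" where
  "compose_coeff 0 f = f 0"
| "compose_coeff (Suc 0) f = f 1"
| "compose_coeff (Suc (Suc n)) f = (real (n + 1) ^ 2 * compose_coeff n f + compose_coeff n (deriv2 f)) / (real (n + 1) * real (n + 2))"

lemma fps_nth_deriv2: "fps_nth (fps_deriv (fps_deriv f)) = deriv2 (fps_nth f)"
  by (rule ext) (simp add: deriv2_def algebra_simps)

lemma compose_sin_coeffs:
  fixes f g :: "real fps"
  assumes "fps_cos 1 * (g oo fps_sin 1) = f"
  shows "fps_nth g n = compose_coeff n (fps_nth f)"
  using assms
proof (induction n "fps_nth f" arbitrary: f g rule: compose_coeff.induct)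
  case 1
  then show ?case by auto
next
  case (2 f g)
  let ?C = "fps_cos (1::real)" and ?S = "fps_sin (1::real)"
  have "fps_deriv f = - ?S * (g oo ?S) + ?C * ((fps_deriv g oo ?S) * ?C)"
    by (simp add: fps_cos_deriv fps_sin_deriv fps_compose_deriv algebra_simps flip: fps_const_neg 2(1))
  from arg_cong[OF this, of "\<lambda>f. fps_nth f 0"] show ?case by simp
next
  case (3 n f g)
  let ?C = "fps_cos (1::real)" and ?S = "fps_sin (1::real)"
  define g1 where "g1 = fps_deriv g"
  define g2 where "g2 = fps_deriv g1"
  \<comment> \<open>The second derivative of cos(t) g(sin t) is cos(t) times this operator on
    \<open>g\<close>, evaluated at sin(t). So \<open>G\<close> is related to the second derivative
    of \<open>f\<close> as \<open>g\<close> is to \<open>f\<close>, and the induction hypothesis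
    applies to it.\<close>
  define G where "G = (1 - fps_X * fps_X) * g2 - 3 * (fps_X * g1) - g"
  have cc: "?C * ?C = 1 - ?S * ?S"
    using fps_sin_cos_sum_of_squares[of "1::real"] by (simp add: power2_eq_square algebra_simps)
  have dC: "fps_deriv ?C = - ?S" and dS: "fps_deriv ?S = ?C"
    by (simp_all add: fps_cos_deriv fps_sin_deriv flip: fps_const_neg)
  have d0: "fps_deriv (g oo ?S) = (g1 oo ?S) * ?C" and d1: "fps_deriv (g1 oo ?S) = (g2 oo ?S) * ?C"
    by (simp_all add: fps_compose_deriv dS g1_def g2_def)
  have f1: "fps_deriv f = - ?S * (g oo ?S) + ?C * ((g1 oo ?S) * ?C)"
    by (simp add: dC d0 algebra_simps flip: 3(3))
  have f2: "fps_deriv (fps_deriv f) = ?C * ((?C * ?C) * (g2 oo ?S) - 3 * (?S * (g1 oo ?S)) - (g oo ?S))"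
    unfolding f1 by (simp add: dC dS d0 d1 algebra_simps)
  have "G oo ?S = (1 - ?S * ?S) * (g2 oo ?S) - 3 * (?S * (g1 oo ?S)) - (g oo ?S)"
    unfolding G_def by (simp add: fps_compose_sub_distrib fps_compose_mult_distrib numeral_fps_const)
  then have fG: "?C * (G oo ?S) = fps_deriv (fps_deriv f)" by (simp only: f2 cc)
  have "fps_nth G n = real (n + 1) * real (n + 2) * fps_nth g (n + 2) - real (n + 1) ^ 2 * fps_nth g n"
  proof -
    consider "n = 0" | "n = 1" | m where "n = Suc (Suc m)" by (metis One_nat_def not0_implies_Suc)
    then show ?thesis
      by cases (simp_all add: G_def g1_def g2_def numeral_fps_const mult.assoc algebra_simps power2_eq_square
          numeral_eq_Suc)
  qed
  moreover have "fps_nth G n = compose_coeff n (deriv2 (fps_nth f))"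
    using 3(2)[OF _ fG] by (simp add: fps_nth_deriv2)
  moreover have "fps_nth g n = compose_coeff n (fps_nth f)" using 3(1) 3(3) by blast
  ultimately have "real (n + 1) * real (n + 2) * fps_nth g (n + 2) = real (n + 1) ^ 2 * compose_coeff n (fps_nth f) + compose_coeff n (deriv2 (fps_nth f))"
    by simp
  then show ?case by (simp add: field_simps del: of_nat_Suc)
qed

lemma half_wave_compose_coeff: "half_wave c n 0 = compose_coeff n (\<lambda>j. stc j * (2 * real c + 1) ^ j)"
  using compose_sin_coeffs[OF half_wave_gf_0, of c n] by (simp add: half_wave_gf_def stc_gf_def Abs_fps_inverse)

lemma deriv2_nonneg: "(\<And>j. f j \<ge> 0) \<Longrightarrow> deriv2 f j \<ge> 0"
  by (simp add: deriv2_def)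

text \<open>The terms kept are the exact contributions of \<open>f n\<close> and
  \<open>f (n - 2)\<close>; everything else in the recursion is nonnegative. The factor (n+1)/6
  reproduces itself through (n+1)^2 + (n+1) n (n-1)/6 = (n+1)(n+2)(n+3)/6.\<close>

lemma compose_coeff_ge: "(\<And>j. f j \<ge> 0) \<Longrightarrow> compose_coeff n f \<ge> f n + (if n \<ge> 2 then real (n + 1) / 6 * f (n - 2) else 0)"
proof (induction n f rule: compose_coeff.induct)
  case (3 n f)
  have i1: "compose_coeff n f \<ge> f n"
    using 3(1)[OF 3(3)] 3(3)[of "n - 2"] by (auto split: if_splits intro: order_trans[rotated])
  have i2: "compose_coeff n (deriv2 f) \<ge> deriv2 f n + (if n \<ge> 2 then real (n + 1) / 6 * deriv2 f (n - 2) else 0)"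
    using 3(2)[OF deriv2_nonneg[OF 3(3)]] .
  have i3: "(if n \<ge> 2 then real (n + 1) / 6 * deriv2 f (n - 2) else 0) = real (n + 1) * real n * (real n - 1) / 6 * f n"
  proof -
    consider "n = 0" | "n = 1" | m where "n = Suc (Suc m)" by (metis One_nat_def not0_implies_Suc)
    then show ?thesis by cases (simp_all add: deriv2_def field_simps)
  qed
  have pos: "real (n + 1) * real (n + 2) > 0" by simp
  have "(f (n + 2) + real (n + 3) / 6 * f n) * (real (n + 1) * real (n + 2)) =
     real (n + 1) ^ 2 * f n + (deriv2 f n + real (n + 1) * real n * (real n - 1) / 6 * f n)"
    by (simp add: deriv2_def field_simps power2_eq_square)
  also have "\<dots> \<le> real (n + 1) ^ 2 * compose_coeff n f + compose_coeff n (deriv2 f)"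
    using i1 i2 i3 by (intro add_mono mult_left_mono) auto
  finally have "f (n + 2) + real (n + 3) / 6 * f n \<le> compose_coeff (Suc (Suc n)) f"
    using pos by (simp add: pos_le_divide_eq del: of_nat_add)
  then show ?case by (simp add: add.commute)
qed auto

text \<open>Each pass through the recursion adds a multiple of a coefficient two places lower, which
  costs at most a factor \<open>x\<close>; there are \<open>n div 2\<close> passes.\<close>

lemma compose_coeff_le:
  assumes "x \<ge> 0"
  shows "(\<And>j. f j \<ge> 0) \<Longrightarrow> (\<And>j. f j \<le> x * f (j + 2)) \<Longrightarrow> compose_coeff n f \<le> f n * (1 + x) ^ (n div 2)"
proof (induction n f rule: compose_coeff.induct)
  case (3 n f)
  let ?P = "(1 + x) ^ (n div 2)"
  have P: "?P \<ge> 0" using assms by simp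
  have x: "deriv2 f j \<le> x * deriv2 f (j + 2)" for j
  proof -
    have "real (j + 1) * real (j + 2) * f (j + 2) \<le> real (j + 3) * real (j + 4) * (x * f (j + 4))"
    proof (intro mult_mono)
      have "j + 2 + 2 = j + 4" by simp
      then show "f (j + 2) \<le> x * f (j + 4)" using 3(4)[of "j + 2"] by metis
    qed (use 3(3) in auto)
    then show ?thesis by (simp add: deriv2_def mult_ac add.commute numeral_eq_Suc)
  qed
  have i1: "compose_coeff n f \<le> f n * ?P" using 3(1,3,4) by blast
  have i2: "compose_coeff n (deriv2 f) \<le> deriv2 f n * ?P" by (rule 3(2)) (rule deriv2_nonneg 3(3) x)+
  have pos: "real (n + 1) * real (n + 2) > 0" by simp
  have "real (n + 1) ^ 2 * compose_coeff n f + compose_coeff n (deriv2 f) \<le> (real (n + 1) * real (n + 2)) * (x * f (n + 2) * ?P) + deriv2 f n * ?P"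
  proof (intro add_mono i2)
    have "compose_coeff n f \<le> x * f (n + 2) * ?P" using i1 3(4)[of n] P mult_right_mono order_trans by blast
    moreover have "0 \<le> x * f (n + 2) * ?P" using assms 3(3) P by simp
    ultimately show "real (n + 1) ^ 2 * compose_coeff n f \<le> (real (n + 1) * real (n + 2)) * (x * f (n + 2) * ?P)"
    proof -
      let ?W = "x * f (n + 2) * ?P"
      assume 1: "compose_coeff n f \<le> ?W" and 2: "0 \<le> ?W"
      have "real (n + 1) ^ 2 * compose_coeff n f \<le> real (n + 1) ^ 2 * ?W" using 1 by (intro mult_left_mono) auto
      also have "\<dots> \<le> (real (n + 1) * real (n + 2)) * ?W"
        using 2 by (intro mult_right_mono) (auto simp: power2_eq_square intro!: mult_left_mono)
      finally show ?thesis .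
    qed
  qed
  also have "\<dots> = (f (n + 2) * ((1 + x) * ?P)) * (real (n + 1) * real (n + 2))"
    by (simp add: deriv2_def algebra_simps)
  finally have "compose_coeff (Suc (Suc n)) f \<le> f (n + 2) * ((1 + x) * ?P)"
    using pos by (simp add: pos_divide_le_eq del: of_nat_add)
  then show ?case by (simp add: add.commute)
qed auto

lemma fps_nth_eq_higher_deriv:
  fixes f :: "real fps"
  assumes "fps_conv_radius f > 0"
  shows "(deriv ^^ n) (eval_fps f) 0 = fact n * fps_nth f n"
  using assms
proof (induction n arbitrary: f)
  case (Suc n f)
  have "eventually (\<lambda>z. z \<in> eball 0 (fps_conv_radius f)) (nhds (0::real))"
    using Suc.prems by (intro eventually_nhds_in_open) (auto simp: zero_ereal_def)
  then have "eventually (\<lambda>z. deriv (eval_fps f) z = eval_fps (fps_deriv f) z) (nhds 0)"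
    by eventually_elim (simp add: eval_fps_deriv)
  then have "(deriv ^^ Suc n) (eval_fps f) 0 = (deriv ^^ n) (eval_fps (fps_deriv f)) 0"
    unfolding funpow_Suc_right o_apply by (rule higher_deriv_cong_ev) simp
  also have "\<dots> = fact n * fps_nth (fps_deriv f) n"
    using Suc.prems fps_conv_radius_deriv[of f] by (intro Suc.IH) auto
  finally show ?case by (simp add: algebra_simps)
qed (simp add: eval_fps_at_0)

text \<open>Iterated derivatives at 0 depend only on the function near 0, where it agrees with the
  sum of the power series.\<close>

lemma sec_tan_coeff_eq: "sec_tan_coeff j = stc j"
proof -
  let ?f = "\<lambda>x::real. 1 / cos x + tan x"
  have "(\<lambda>x::real. (1 + sin x) / cos x) has_fps_expansion sectan"
    unfolding sectan_def
    by (intro has_fps_expansion_divide' has_fps_expansion_add has_fps_expansion_1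
        has_fps_expansion_sin' has_fps_expansion_cos') auto
  also have "(\<lambda>x::real. (1 + sin x) / cos x) = ?f"
    by (rule ext) (simp add: tan_def add_divide_distrib)
  finally have *: "fps_conv_radius sectan > 0" "eventually (\<lambda>z. eval_fps sectan z = ?f z) (nhds 0)"
    by (auto simp: has_fps_expansion_def)
  have "(deriv ^^ j) (eval_fps sectan) 0 = (deriv ^^ j) ?f 0"
    using *(2) by (intro higher_deriv_cong_ev) auto
  then have "sec_tan_coeff j = fact j * stc j / fact j"
    unfolding sec_tan_coeff_def using fps_nth_eq_higher_deriv[OF *(1), of j] by simp
  then show ?thesis by simp
qed

lemma power_le_exp: "x \<ge> 0 \<Longrightarrow> (1 + x) ^ k \<le> exp (real k * x)" for x :: real
  unfolding exp_of_nat_mult by (intro power_mono) (auto simp: add_nonneg_nonneg)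

text \<open>Write U and T for \<open>compose_coeff (n + 1) f\<close> and
  \<open>compose_coeff (n - 1) f\<close>. The first bound serves the geometric series of ratio T /
  p^(n+1) in the lower estimate of the limit, the second that of ratio 1/p in the upper one. The
  recursion expressing U through T reduces the first bound to an upper bound on T by its leading
  term.\<close>

lemma quadric_bounds:
  fixes n p c :: nat
  defines "f \<equiv> \<lambda>j. stc j * (2 * real c + 1) ^ j"
  assumes n: "n \<ge> 3" and p: "p = 2 * c + 1" "c \<ge> 1"
    and ev: "even n \<Longrightarrow> p + 2 \<ge> n" and od: "odd n \<Longrightarrow> p + 4 \<ge> 2 * n"
  shows "compose_coeff (n + 1) f - compose_coeff (n - 1) f \<ge> stc (n + 1) * (real p ^ (n + 1) - compose_coeff (n - 1) f)"
    and "compose_coeff (n + 1) f / real p ^ (n + 1) * (real p / (real p - 1)) \<le> stc (n + 1) + (2 * real n - 4) / real p"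
proof -
  have rp: "2 * real c + 1 = real p" "real p \<ge> 3" using p by auto
  have f: "f j = stc j * real p ^ j" for j using rp by (simp add: f_def)
  have f0: "f j \<ge> 0" for j using stc_pos[of j] by (simp add: f)
  \<comment> \<open>Two applications of \<open>stc_half\<close> lose a factor 4, while the power of
    \<open>p\<close> in \<open>f\<close> gains p^2 over two places.\<close>
  define x where "x = 4 / real p ^ 2"
  have x0: "x \<ge> 0" by (simp add: x_def)
  have fx: "f j \<le> x * f (j + 2)" for j
  proof -
    have "stc j \<le> 4 * stc (j + 2)" using stc_half[of j] stc_half[of "Suc j"] by simp
    then have "stc j * real p ^ j \<le> 4 * stc (j + 2) * real p ^ j" by (intro mult_right_mono) auto
    also have "\<dots> = x * f (j + 2)" using rp by (simp add: f x_def power_add power2_eq_square field_simps)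
    finally show ?thesis by (simp add: f)
  qed
  have le: "compose_coeff m f \<le> f m * (1 + x) ^ (m div 2)" for m
    by (rule compose_coeff_le[OF x0]) (rule f0 fx)+
  have ge: "compose_coeff m f \<ge> f m + (if m \<ge> 2 then real (m + 1) / 6 * f (m - 2) else 0)" for m
    by (rule compose_coeff_ge) (rule f0)
  have ge0: "compose_coeff m f \<ge> f m" for m
  proof -
    have "0 \<le> (if m \<ge> 2 then real (m + 1) / 6 * f (m - 2) else 0)" using f0 by simp
    then show ?thesis using ge[of m] by linarith
  qed
  have ge': "compose_coeff m (deriv2 f) \<ge> deriv2 f m + (if m \<ge> 2 then real (m + 1) / 6 * deriv2 f (m - 2) else 0)" for m
    by (rule compose_coeff_ge, rule deriv2_nonneg) (rule f0)
  define T where "T = compose_coeff (n - 1) f"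
  define M where "M = stc (n + 1)"
  have M0: "M > 0" "M \<le> 5 / 24" using stc_pos stc_le n by (auto simp: M_def)
  have T: "T \<ge> f (n - 1)" unfolding T_def by (rule ge0)
  have nn: "Suc (Suc (n - 1)) = n + 1" "Suc (n - 1) = n" using n by auto
  have rn: "real (n - 1) = real n - 1" using n by (simp add: of_nat_diff)
  have U: "compose_coeff (n + 1) f = (real n ^ 2 * T + compose_coeff (n - 1) (deriv2 f)) / (real n * (real n + 1))"
    unfolding T_def using compose_coeff.simps(3)[of "n - 1" f] n by (simp add: nn rn add.commute)
  have "compose_coeff (n - 1) (deriv2 f) \<ge> deriv2 f (n - 1) + real n / 6 * deriv2 f (n - 3)"
  proof -
    have e: "2 \<le> n - 1" "n - 1 + 1 = n" "n - 1 - 2 = n - 3" using n by auto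
    show ?thesis using ge'[of "n - 1"] by (simp only: e if_True)
  qed
  moreover have "deriv2 f (n - 1) = real n * (real n + 1) * (M * real p ^ (n + 1))"
    unfolding deriv2_def using n by (simp add: f M_def nn rn)
  moreover have "deriv2 f (n - 3) = (real n - 2) * (real n - 1) * f (n - 1)"
  proof -
    have "n - 3 + 2 = n - 1" "real (n - 3 + 1) = real n - 2" "real (n - 3 + 2) = real n - 1" using n by auto
    then show ?thesis unfolding deriv2_def by simp
  qed
  ultimately have dU: "compose_coeff (n - 1) (deriv2 f) \<ge> real n * (real n + 1) * (M * real p ^ (n + 1))
      + real n / 6 * ((real n - 2) * (real n - 1) * f (n - 1))" by simp
  \<comment> \<open>What remains of the first claim after the leading term has been removed from the
    recursion. For n = 3 and n = 4 both sides are explicit; for larger n it is enough that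
    \<open>T\<close> is at most twice its leading term \<open>f (n - 1)\<close>.\<close>
  have key: "(1 - (real n + 1) * M) * T \<le> (real n - 1) * (real n - 2) / 6 * f (n - 1)"
  proof -
    consider "n = 3" | "n = 4" | "n \<ge> 5" using n by linarith
    then show ?thesis
    proof cases
      case 1
      have M: "M = 5 / 24" using 1 stc_values(4) by (simp add: M_def)
      have T: "T = real p * real p / 2 + 1 / 2"
        using stc_values(2) by (simp add: T_def 1 numeral_2_eq_2 deriv2_def f stc_0)
      have fn: "f (n - 1) = real p * real p / 2"
        using stc_values(2) by (simp add: 1 f power2_eq_square)
      have "real p * real p \<ge> 3 * 3" using rp(2) by (intro mult_mono) auto
      then show ?thesis unfolding M T fn using 1 by simp
    next
      case 2
      have M: "M = 2 / 15" using 2 stc_values(5) by (simp add: M_def)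
      have T: "T = real p ^ 3 / 3 + 2 / 3 * real p"
        using stc_values(1,3) by (simp add: T_def 2 numeral_3_eq_3 deriv2_def f)
      have fn: "f (n - 1) = real p ^ 3 / 3"
        using stc_values(3) by (simp add: 2 f)
      have "real p ^ 3 \<ge> 3 * 3 * real p"
        using rp(2) unfolding power3_eq_cube by (intro mult_right_mono mult_mono) auto
      then show ?thesis unfolding M T fn using 2 rp self_le_power[of p 3] by simp
    next
      case 3
      define k where "k = (n - 1) div 2"
      \<comment> \<open>Keeps \<open>real k * x\<close> at or below 2/5, and exp(2/5) is below 2.
        The conditions on \<open>p\<close> against \<open>n\<close> are used here.\<close>
      have "10 * k \<le> p ^ 2"
      proof (cases "even n")
        case True
        then have "2 * k \<le> p" "p \<ge> 5" using ev 3 p by (auto simp: k_def elim!: evenE; presburger)+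
        moreover have "5 * p \<le> p * p" using calculation by simp
        ultimately have "10 * k \<le> p * p" by linarith
        then show ?thesis by (simp add: power2_eq_square)
      next
        case False
        then have "4 * k \<le> p + 2" "p \<ge> 6" using od 3 by (auto simp: k_def elim!: oddE)
        moreover have "p * p \<ge> 6 * p" using calculation by simp
        ultimately have "10 * k \<le> p * p" by linarith
        then show ?thesis by (simp add: power2_eq_square)
      qed
      then have "10 * real k \<le> real p ^ 2" by (metis of_nat_le_iff of_nat_mult of_nat_numeral of_nat_power)
      then have kx: "real k * x \<le> 2 / 5" using rp by (simp add: x_def field_simps)
      have "(1 + x) ^ k \<le> exp (2 / 5)"
        using power_le_exp[OF x0, of k] kx by (meson exp_le_cancel_iff order_trans)
      also have "\<dots> \<le> 2" using exp_bound[of "2/5"] by (simp add: power2_eq_square)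
      finally have "T \<le> f (n - 1) * 2"
        using le[of "n - 1"] f0[of "n - 1"] mult_left_mono[of "(1 + x) ^ k" 2 "f (n - 1)"] by (simp add: T_def k_def)
      moreover have "(1 - (real n + 1) * M) * T \<le> 1 * T"
        using M0 T f0[of "n - 1"] by (intro mult_right_mono) auto
      moreover have "2 * f (n - 1) \<le> (real n - 1) * (real n - 2) / 6 * f (n - 1)"
      proof (intro mult_right_mono f0)
        have "4 * 3 \<le> (real n - 1) * (real n - 2)" using 3 by (intro mult_mono) auto
        then show "2 \<le> (real n - 1) * (real n - 2) / 6" by simp
      qed
      ultimately show ?thesis by simp
    qed
  qed
  have np: "real n * (real n + 1) > 0" using n by simp
  have "(M * (real p ^ (n + 1) - T) + T) * (real n * (real n + 1)) \<le> real n ^ 2 * T + compose_coeff (n - 1) (deriv2 f)"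
  proof -
    have "real n * ((1 - (real n + 1) * M) * T) \<le> real n * ((real n - 1) * (real n - 2) / 6 * f (n - 1))"
      using key by (intro mult_left_mono) auto
    then show ?thesis using dU by (simp add: algebra_simps power2_eq_square)
  qed
  then have "M * (real p ^ (n + 1) - T) + T \<le> compose_coeff (n + 1) f"
    unfolding U using np by (simp add: pos_le_divide_eq)
  then show "compose_coeff (n + 1) f - compose_coeff (n - 1) f \<ge> stc (n + 1) * (real p ^ (n + 1) - compose_coeff (n - 1) f)"
    by (simp add: M_def T_def)
  define k where "k = (n + 1) div 2"
  \<comment> \<open>Keeps u = \<open>real k * x\<close> at or below 1, the range in which exp(u) is
    at most 1 + u + u^2.\<close>
  have k1: "4 * k \<le> p ^ 2"
  proof -
    have "4 * k \<le> 2 * p + 2 \<and> (p = 3 \<longrightarrow> 4 * k \<le> 9)"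
      using ev od n p unfolding k_def by presburger
    moreover have "p * p \<ge> 5 * p" if "p \<noteq> 3" using that p by (intro mult_le_mono) presburger+
    ultimately show ?thesis using p by (cases "p = 3") (auto simp: power2_eq_square)
  qed
  then have "4 * real k \<le> real p ^ 2" by (metis of_nat_le_iff of_nat_mult of_nat_numeral of_nat_power)
  then have kx: "real k * x \<le> 1" "real k * x \<ge> 0" using rp x0 by (simp_all add: x_def field_simps)
  define u where "u = real k * x"
  have "(1 + x) ^ k \<le> exp u" using power_le_exp[OF x0] by (simp add: u_def)
  also have "\<dots> \<le> 1 + u + u ^ 2" using exp_bound kx by (simp add: u_def)
  also have "\<dots> \<le> 1 + 2 * u"
  proof -
    have "u * u \<le> u * 1" using kx unfolding u_def by (intro mult_left_mono) auto
    then show ?thesis by (simp add: power2_eq_square)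
  qed
  finally have "compose_coeff (n + 1) f \<le> f (n + 1) * (1 + 2 * u)"
    using le[of "n + 1"] f0[of "n + 1"] mult_left_mono[of "(1 + x) ^ k" "1 + 2 * u" "f (n + 1)"] by (simp add: k_def)
  then have "compose_coeff (n + 1) f / real p ^ (n + 1) \<le> M * (1 + 2 * u)"
    using rp by (simp add: f M_def pos_divide_le_eq mult_ac)
  then have "compose_coeff (n + 1) f / real p ^ (n + 1) * (real p / (real p - 1)) \<le> M * (1 + 2 * u) * (real p / (real p - 1))"
    using rp by (intro mult_right_mono) auto
  also have "\<dots> = M + M * (2 * (u * real p) + 1) / (real p - 1)"
    using rp by (simp add: field_simps)
  also have "M * (2 * (u * real p) + 1) / (real p - 1) \<le> (2 * real n - 4) / real p"
  proof -
    have "u * real p = 4 * real k / real p" using rp by (simp add: u_def x_def power2_eq_square)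
    also have "\<dots> \<le> 4 * ((real n + 1) / 2) / 3"
      using rp by (intro frac_le mult_left_mono) (auto simp: k_def)
    finally have up: "2 * (u * real p) + 1 \<le> (4 * real n + 7) / 3" by simp
    \<comment> \<open>The coefficient 5/24 of index 4 bounds \<open>M\<close>. The next comparison
      amounts to 227 <= 76 n and just holds at n = 3; its factor 2/3 makes up for p/(p-1), which is
      at most 3/2.\<close>
    have "M * (2 * (u * real p) + 1) \<le> 5 / 24 * ((4 * real n + 7) / 3)"
      using up M0 kx rp by (intro mult_mono) (auto simp: u_def)
    also have "\<dots> \<le> 2 / 3 * (2 * real n - 4)" using n by simp
    finally have 1: "M * (2 * (u * real p) + 1) \<le> 2 / 3 * (2 * real n - 4)" .
    have "M * (2 * (u * real p) + 1) * real p \<le> (2 / 3 * (2 * real n - 4)) * (3 / 2 * (real p - 1))"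
    proof (rule mult_mono[OF 1])
      show "real p \<le> 3 / 2 * (real p - 1)" using rp by simp
      show "0 \<le> 2 / 3 * (2 * real n - 4)" using n by simp
      show "0 \<le> real p" by simp
    qed
    also have "\<dots> = (2 * real n - 4) * (real p - 1)" by (simp add: field_simps)
    finally show ?thesis using rp by (simp add: pos_divide_le_eq pos_le_divide_eq mult_ac)
  qed
  finally show "compose_coeff (n + 1) f / real p ^ (n + 1) * (real p / (real p - 1)) \<le> stc (n + 1) + (2 * real n - 4) / real p"
    by (simp add: M_def)
qed

section \<open>Window sums of periodic functions\<close>

lemma int_fun_eqI:
  fixes F G :: "int \<Rightarrow> real"
  assumes "F a = G a" "\<And>k. F (k + 1) - F k = G (k + 1) - G k"
  shows "F k = G k"
proof (induction k rule: int_induct[where k = a])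
  case (step1 i)
  then show ?case using assms(2)[of i] by simp
next
  case (step2 i)
  then show ?case using assms(2)[of "i - 1"] by simp
qed (rule assms)

definition window :: "nat \<Rightarrow> (int \<Rightarrow> real) \<Rightarrow> int \<Rightarrow> real" where
  "window c g k = (\<Sum>j\<in>{- int c..int c}. g (k + j))"

lemma window_step: "window c g (k + 1) - window c g k = g (k + 1 + int c) - g (k - int c)"
proof -
  have e: "window c g k = (\<Sum>j\<in>{k - int c..k + int c}. g j)" for k
    unfolding window_def by (rule sum.reindex_bij_witness[of _ "\<lambda>j. j - k" "\<lambda>j. k + j"]) auto
  have "(\<Sum>j\<in>{k - int c..k + 1 + int c}. g j) = g (k - int c) + window c g (k + 1)"
  proof -
    have "{k - int c..k + 1 + int c} = insert (k - int c) {k + 1 - int c..k + 1 + int c}" by auto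
    then show ?thesis unfolding e by simp
  qed
  moreover have "(\<Sum>j\<in>{k - int c..k + 1 + int c}. g j) = g (k + 1 + int c) + window c g k"
  proof -
    have "{k - int c..k + 1 + int c} = insert (k + 1 + int c) {k - int c..k + int c}" by auto
    then show ?thesis unfolding e by simp
  qed
  ultimately show ?thesis by simp
qed

lemma window_shift: "window c (\<lambda>k. g (k + d)) k = window c g (k + d)"
  by (simp add: window_def algebra_simps)

lemma window_lin: "window c (\<lambda>k. x * g k + y * h k) k = x * window c g k + y * window c h k"
  by (simp add: window_def sum.distrib sum_distrib_left)

lemma window_funpow_shift: "(window c ^^ n) (\<lambda>k. g (k + d)) k = (window c ^^ n) g (k + d)"
proof (induction n arbitrary: k)
  case (Suc n)
  have "(window c ^^ n) (\<lambda>k. g (k + d)) = (\<lambda>k. (window c ^^ n) g (k + d))" by (rule ext) (rule Suc)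
  then show ?case by (simp add: window_shift)
qed simp

lemma window_funpow_lin: "(window c ^^ n) (\<lambda>k. x * g k + y * h k) k = x * (window c ^^ n) g k + y * (window c ^^ n) h k"
proof (induction n arbitrary: k)
  case (Suc n)
  have "(window c ^^ n) (\<lambda>k. x * g k + y * h k) = (\<lambda>k. x * (window c ^^ n) g k + y * (window c ^^ n) h k)" by (rule ext) (rule Suc)
  then show ?case by (simp add: window_lin)
qed simp

lemma window_reflect: "window c (\<lambda>k. g (d - k)) k = window c g (d - k)"
  unfolding window_def by (rule sum.reindex_bij_witness[of _ uminus uminus]) (auto simp: algebra_simps)

lemma window_funpow_reflect: "(window c ^^ n) (\<lambda>k. g (d - k)) k = (window c ^^ n) g (d - k)"
proof (induction n arbitrary: k)
  case (Suc n)
  have "(window c ^^ n) (\<lambda>k. g (d - k)) = (\<lambda>k. (window c ^^ n) g (d - k))" by (rule ext) (rule Suc)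
  then show ?case by (simp add: window_reflect)
qed simp

section \<open>Alternating window sums\<close>

definition psign :: "int \<Rightarrow> real" where "psign k = (if even k then 1 else - 1)"

lemma psign_add: "psign (j + k) = psign j * psign k" and psign_sq: "psign k * psign k = 1" and abs_psign: "\<bar>psign k\<bar> = 1"
  by (simp_all add: psign_def)

text \<open>The sign is positive at both ends of the window, so the sum is a difference of two
  spreads.\<close>

definition alt_window :: "nat \<Rightarrow> (int \<Rightarrow> real) \<Rightarrow> int \<Rightarrow> real" where
  "alt_window c g k = (\<Sum>j\<in>{- int c..int c}. psign (j + int c) * g (k + j))"

lemma alt_window_lin: "alt_window c (\<lambda>k. x * g k + y * h k) k = x * alt_window c g k + y * alt_window c h k"
  by (simp add: alt_window_def sum.distrib sum_distrib_left algebra_simps)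

text \<open>Multiplication by the sign of the argument turns alternating sums into plain ones, so
  facts about \<open>window\<close> can be reused.\<close>

lemma alt_window_twist: "alt_window c g k = psign c * (psign k * window c (\<lambda>k. psign k * g k) k)"
proof -
  have "psign (j + int c) * g (k + j) = psign c * (psign k * (psign (k + j) * g (k + j)))" for j
    using psign_sq[of k] by (simp add: psign_add algebra_simps)
  then show ?thesis unfolding alt_window_def window_def sum_distrib_left by (simp only:)
qed

lemma alt_window_funpow_twist: "(alt_window c ^^ n) g k = psign c ^ n * (psign k * (window c ^^ n) (\<lambda>k. psign k * g k) k)"
proof (induction n arbitrary: k)
  case 0
  show ?case using psign_sq[of k] by (simp flip: mult.assoc)
next
  case (Suc n)
  have "(alt_window c ^^ n) g = (\<lambda>k. psign c ^ n * (psign k * (window c ^^ n) (\<lambda>k. psign k * g k) k))" by (rule ext) (rule Suc)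
  then have "(alt_window c ^^ Suc n) g k = psign c * (psign k * window c (\<lambda>k. psign c ^ n * ((window c ^^ n) (\<lambda>k. psign k * g k) k)) k)"
    by (simp add: alt_window_twist psign_sq algebra_simps) (simp flip: mult.assoc add: psign_sq)
  also have "window c (\<lambda>k. psign c ^ n * ((window c ^^ n) (\<lambda>k. psign k * g k) k)) k = psign c ^ n * (window c ^^ Suc n) (\<lambda>k. psign k * g k) k"
    using window_lin[of c "psign c ^ n" _ 0 "\<lambda>_. 0"] by simp
  finally show ?case by (simp add: algebra_simps)
qed

lemma alt_window_reflect: "alt_window c (\<lambda>k. g (d - k)) k = alt_window c g (d - k)"
  unfolding alt_window_def by (rule sum.reindex_bij_witness[of _ uminus uminus]) (auto simp: algebra_simps psign_def)

lemma alt_window_funpow_reflect: "(alt_window c ^^ n) (\<lambda>k. g (d - k)) k = (alt_window c ^^ n) g (d - k)"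
proof (induction n arbitrary: k)
  case (Suc n)
  have "(alt_window c ^^ n) (\<lambda>k. g (d - k)) = (\<lambda>k. (alt_window c ^^ n) g (d - k))" by (rule ext) (rule Suc)
  then show ?case by (simp add: alt_window_reflect)
qed simp

lemma alt_window_funpow_lin: "(alt_window c ^^ n) (\<lambda>k. x * g k + y * h k) k = x * (alt_window c ^^ n) g k + y * (alt_window c ^^ n) h k"
proof (induction n arbitrary: k)
  case (Suc n)
  have "(alt_window c ^^ n) (\<lambda>k. x * g k + y * h k) = (\<lambda>k. x * (alt_window c ^^ n) g k + y * (alt_window c ^^ n) h k)" by (rule ext) (rule Suc)
  then show ?case by (simp add: alt_window_lin)
qed simp

lemma window_psign: "window c psign k = psign c * psign k"
proof -
  have "(\<Sum>j\<in>{- int c..int c}. psign j) = psign c"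
  proof (induction c)
    case (Suc c)
    have "{- int (Suc c)..int (Suc c)} = insert (- int (Suc c)) (insert (int (Suc c)) {- int c..int c})" by auto
    then show ?case using Suc by (simp add: psign_def split: if_splits)
  qed (simp add: psign_def)
  moreover have "window c psign k = psign k * (\<Sum>j\<in>{- int c..int c}. psign j)" by (simp add: window_def psign_add sum_distrib_left)
  ultimately show ?thesis by simp
qed

lemma window_funpow_psign: "(window c ^^ n) psign k = psign c ^ n * psign k"
proof (induction n arbitrary: k)
  case (Suc n)
  have "(window c ^^ n) psign = (\<lambda>k. psign c ^ n * psign k + 0 * 0)" by (rule ext) (simp add: Suc)
  then show ?case using window_lin[of c "psign c ^ n" psign 0 "\<lambda>_. 0" k] by (simp add: window_psign)
qed simp

section \<open>Square waves, the sawtooth and their window sums\<close>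

context
  fixes c :: nat and p :: int
  assumes p: "p = 2 * int c + 1"
begin

definition comb :: "int \<Rightarrow> real" where "comb k = (if 2 * p dvd k then 1 else 0)"

lemma comb_periodic: "comb (k + 2 * p) = comb k" and comb_minus: "comb (- k) = comb k"
  by (simp_all add: comb_def)

text \<open>It is 1 at 0, -1 at \<open>p\<close> and antiperiodic with respect to \<open>p\<close>;
  one window sum of it is a square wave.\<close>

definition pulse :: "int \<Rightarrow> real" where "pulse k = comb k - comb (k + p)"

definition wave :: "nat \<Rightarrow> int \<Rightarrow> real" where "wave n = (window c ^^ n) pulse"

lemma wave_Suc: "wave (Suc n) k = window c (wave n) k"
  by (simp add: wave_def)

lemma wave_anti: "wave n (k + p) = - wave n k"
proof (induction n arbitrary: k)
  case 0
  have "k + p + p = k + 2 * p" by simp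
  then show ?case using comb_periodic[of k] by (simp add: wave_def pulse_def add.commute)
next
  case (Suc n)
  have "wave n (k + p + j) = - wave n (k + j)" for j using Suc[of "k + j"] by (simp add: algebra_simps)
  then show ?case unfolding wave_Suc by (simp add: window_def sum_negf)
qed

lemma wave_even: "wave n (- k) = wave n k"
proof (induction n arbitrary: k)
  case 0
  show ?case using comb_minus[of "k + p"] comb_minus[of k] comb_periodic[of "- k - p"] by (simp add: wave_def pulse_def)
next
  case (Suc n)
  have "wave n = (\<lambda>k. wave n (0 - k))" using Suc by auto
  then show ?case using window_reflect[of c "wave n" 0 k] unfolding wave_Suc by simp
qed

text \<open>A window has \<open>p\<close> entries, so the entry that comes in lies \<open>p\<close>
  after the one that drops out and is its negative.\<close>

lemma wave_step: "wave (Suc n) (k + 1) = wave (Suc n) k - 2 * wave n (k - int c)"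
  using window_step[of c "wave n" k] wave_anti[of n "k - int c"] unfolding wave_Suc by (simp add: p algebra_simps)

text \<open>At \<open>c\<close> the window runs from 0 to 2c. Reflection about p/2 changes the sign
  of the values at 1, ..., 2c, so only the value at 0 is left.\<close>

lemma wave_mid: "wave (Suc n) (int c) = wave n 0"
proof -
  define S where "S = (\<Sum>j\<in>{1..2 * int c}. wave n j)"
  have "S = (\<Sum>j\<in>{1..2 * int c}. wave n (- j + p))"
    unfolding S_def by (rule sum.reindex_bij_witness[of _ "\<lambda>j. p - j" "\<lambda>j. p - j"]) (auto simp: p)
  then have "S = - S" unfolding wave_anti wave_even by (simp add: S_def sum_negf)
  then have "S = 0" by simp
  have "wave (Suc n) (int c) = (\<Sum>j\<in>{0..2 * int c}. wave n j)"
    unfolding wave_Suc window_def by (rule sum.reindex_bij_witness[of _ "\<lambda>j. j - int c" "\<lambda>j. j + int c"]) (auto simp: add.commute)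
  also have "{0..2 * int c} = insert 0 {1..2 * int c}" by auto
  finally show ?thesis using \<open>S = 0\<close> by (simp add: S_def)
qed

lemma pulse_0: "pulse 0 = 1" and pulse_small: "0 < k \<Longrightarrow> k < p \<Longrightarrow> pulse k = 0"
proof -
  have *: "\<not> 2 * p dvd k" if "0 < k" "k < 2 * p" for k using zdvd_not_zless that by blast
  have p0: "p > 0" by (simp add: p)
  show "pulse 0 = 1" using *[of p] p0 by (simp add: pulse_def comb_def)
  show "pulse k = 0" if "0 < k" "k < p" using *[of k] *[of "k + p"] that by (simp add: pulse_def comb_def)
qed

text \<open>\<open>wave_mid\<close> gives the value at \<open>c\<close>, and
  \<open>wave_step\<close> leads from there to the smaller arguments; this is the recursion of
  \<open>half_wave\<close>.\<close>

lemma wave_half_wave: "i \<le> c \<Longrightarrow> wave (Suc n) (int (c - i)) = half_wave c n (c - i)"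
proof (induction n arbitrary: i)
  case 0
  then show ?case
  proof (induction i)
    case (Suc i)
    have e: "int (c - i) = int (c - Suc i) + 1" "int (c - Suc i) - int c = - int (Suc i)" using Suc.prems by auto
    have "wave 0 (- int (Suc i)) = 0"
    proof -
      have "int (Suc i) < p" using Suc.prems by (simp add: p)
      then show ?thesis unfolding wave_even using pulse_small[of "int (Suc i)"] by (simp add: wave_def)
    qed
    then show ?case using wave_step[of 0 "int (c - Suc i)"] Suc unfolding e by simp
  qed (use wave_mid[of 0] pulse_0 in \<open>simp add: wave_def\<close>)
next
  case (Suc n)
  have IH: "wave (Suc n) (int k) = half_wave c n k" if "k \<le> c" for k using Suc.IH[of "c - k"] that by simp
  show ?case using Suc.prems
  proof (induction i)
    case 0
    then show ?case using wave_mid[of "Suc n"] IH[of 0] by simp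
  next
    case (Suc i)
    have e: "int (c - i) = int (c - Suc i) + 1" "int (c - Suc i) - int c = - int (Suc i)" using Suc.prems by auto
    have "wave (Suc n) (- int (Suc i)) = half_wave c n (Suc i)" unfolding wave_even using IH[of "Suc i"] Suc.prems by simp
    then have "wave (Suc (Suc n)) (int (c - Suc i)) = half_wave c (Suc n) (c - i) + 2 * half_wave c n (Suc i)"
      using wave_step[of "Suc n" "int (c - Suc i)"] Suc unfolding e by simp
    then show ?case using Suc.prems by simp
  qed
qed

lemma wave_0: "wave (Suc n) 0 = half_wave c n 0"
  using wave_half_wave[of c n] by simp

text \<open>The value 0 at the jumps is the mean of the two one-sided limits and makes the function
  odd.\<close>

definition sawtooth :: "int \<Rightarrow> real" where
  "sawtooth k = (if 2 * p dvd k then 0 else 1 - real_of_int (k mod (2 * p)) / real_of_int p)"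

lemma sawtooth_eq: "0 < k \<Longrightarrow> k < 2 * p \<Longrightarrow> sawtooth k = 1 - real_of_int k / real_of_int p"
  using zdvd_not_zless[of k "2 * p"] by (simp add: sawtooth_def)

lemma sawtooth_periodic: "sawtooth (k + 2 * p) = sawtooth k"
  by (simp add: sawtooth_def)

lemma sawtooth_0: "sawtooth 0 = 0"
  by (simp add: sawtooth_def)

lemma sawtooth_minus: "sawtooth (- k) = - sawtooth k"
proof (cases "2 * p dvd k")
  case False
  have "(- k) mod (2 * p) = 2 * p - k mod (2 * p)"
    using False by (simp add: zmod_zminus1_eq_if dvd_eq_mod_eq_0)
  then have "real_of_int ((- k) mod (2 * p)) = 2 * real_of_int p - real_of_int (k mod (2 * p))" by simp
  moreover have "p > 0" by (simp add: p)
  ultimately show ?thesis using False by (simp add: sawtooth_def diff_divide_distrib)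
qed (simp add: sawtooth_def)

text \<open>The jump of height 2 is passed in two steps through the value 0, hence two
  \<open>comb\<close> terms.\<close>

lemma sawtooth_step: "sawtooth (k + 1) - sawtooth k = comb k + comb (k + 1) - 1 / real_of_int p"
proof -
  define r where "r = k mod (2 * p)"
  have r: "0 \<le> r" "r < 2 * p" by (simp_all add: r_def p)
  have k: "k = r + (k div (2 * p)) * (2 * p)" unfolding r_def by (simp only: mod_div_mult_eq)
  have boxfun: "sawtooth (r + j + (k div (2 * p)) * (2 * p)) = sawtooth (r + j)" "comb (r + j + (k div (2 * p)) * (2 * p)) = comb (r + j)" for j
    by (simp_all add: sawtooth_def comb_def)
  have e: "sawtooth (k + 1) = sawtooth (r + 1)" "sawtooth k = sawtooth r" "comb k = comb r" "comb (k + 1) = comb (r + 1)"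
    using boxfun[of 1] boxfun[of 0] k by (simp_all add: algebra_simps)
  have p0: "p > 0" by (simp add: p)
  have "sawtooth (r + 1) - sawtooth r = comb r + comb (r + 1) - 1 / real_of_int p"
  proof -
    consider "r = 0" | "r = 2 * p - 1" | "0 < r" "r + 1 < 2 * p" using r by linarith
    then show ?thesis
    proof cases
      case 1
      then show ?thesis using sawtooth_eq[of 1] zdvd_not_zless[of 1 "2 * p"] p0 by (simp add: sawtooth_0 comb_def)
    next
      case 2
      have "\<not> 2 * p dvd 2 * p - 1" using zdvd_not_zless[of "2 * p - 1" "2 * p"] p0 by simp
      then show ?thesis unfolding 2 using sawtooth_eq[of "2 * p - 1"] sawtooth_periodic[of 0] p0 by (simp add: sawtooth_0 comb_def field_simps)
    next
      case 3
      then show ?thesis using sawtooth_eq[of r] sawtooth_eq[of "r + 1"] zdvd_not_zless[of r "2 * p"] zdvd_not_zless[of "r + 1" "2 * p"] p0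
        by (simp add: comb_def field_simps)
    qed
  qed
  then show ?thesis unfolding e .
qed

text \<open>Both sides are compared by their increments. An increment on the left is a difference of
  sawtooth values \<open>p\<close> apart: the linear parts cancel, and a square wave remains,
  averaged over neighbours because of the mean values at the jumps. This square wave is identified
  by increments as well.\<close>

lemma window_sawtooth: "window c sawtooth k = (wave 2 (k - int c) + wave 2 (k - int c - 1)) / 4"
proof -
  have aw1: "sawtooth (x + p) - sawtooth x = (wave 1 (x + int c + 1) + wave 1 (x + int c)) / 2" for x
  proof (rule int_fun_eqI[of "\<lambda>x. sawtooth (x + p) - sawtooth x" 0 "\<lambda>x. (wave 1 (x + int c + 1) + wave 1 (x + int c)) / 2"])
    have "sawtooth p = 0" using sawtooth_eq[of p] by (simp add: p)
    moreover have "wave 1 (int c) = 1" "wave 1 (int c + 1) = - 1"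
      using wave_mid[of 0] wave_step[of 0 "int c"] pulse_0 by (simp_all add: wave_def)
    ultimately show "sawtooth (0 + p) - sawtooth 0 = (wave 1 (0 + int c + 1) + wave 1 (0 + int c)) / 2"
      by (simp add: sawtooth_0)
    fix x
    have 1: "wave 1 (x + 1 + int c) = wave 1 (x + int c) - 2 * pulse x" "wave 1 (x + 1 + int c + 1) = wave 1 (x + 1 + int c) - 2 * pulse (x + 1)"
      using wave_step[of 0 "x + int c"] wave_step[of 0 "x + 1 + int c"] by (simp_all add: wave_def algebra_simps)
    have 2: "sawtooth (x + 1 + p) = sawtooth (x + p) - 1 / real_of_int p + comb (x + p) + comb (x + 1 + p)"
      using sawtooth_step[of "x + p"] by (simp add: algebra_simps)
    show "(sawtooth (x + 1 + p) - sawtooth (x + 1)) - (sawtooth (x + p) - sawtooth x) =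
      (wave 1 (x + 1 + int c + 1) + wave 1 (x + 1 + int c)) / 2 - (wave 1 (x + int c + 1) + wave 1 (x + int c)) / 2"
    proof -
      have 0: "x + int c + 1 = x + 1 + int c" by simp
      have *: "t1 - s1 - (t0 - s0) = (A2 + A1) / 2 - (A1 + A0) / 2"
        if "s1 - s0 = d0 + d1 - q" "A1 = A0 - 2 * (d0 - e0)" "A2 = A1 - 2 * (d1 - e1)" "t1 = t0 - q + e0 + e1"
        for s0 s1 t0 t1 A0 A1 A2 d0 d1 e0 e1 q :: real
        using that by (simp add: field_simps)
      show ?thesis unfolding 0 by (rule *[OF sawtooth_step[of x] 1[unfolded pulse_def] 2])
    qed
  qed
  show ?thesis
  proof (rule int_fun_eqI[of "window c sawtooth" 0 "\<lambda>k. (wave 2 (k - int c) + wave 2 (k - int c - 1)) / 4"])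
    have "window c sawtooth 0 = window c (\<lambda>k. sawtooth (0 - k)) 0" by (simp only: window_reflect diff_0_right)
    also have "\<dots> = - window c sawtooth 0" by (simp add: window_def sawtooth_minus sum_negf)
    finally have "window c sawtooth 0 = 0" by simp
    moreover have "wave 2 (- int c - 1) = - wave 2 (- int c)"
      using wave_anti[of 2 "- int c - 1"] wave_even[of 2 "int c"] by (simp add: p)
    ultimately show "window c sawtooth 0 = (wave 2 (0 - int c) + wave 2 (0 - int c - 1)) / 4" by simp
    fix k
    have s: "wave 2 (j + 1) = wave 2 j - 2 * wave 1 (j - int c)" for j using wave_step[of 1 j] by (simp add: numeral_2_eq_2)
    have t: "wave 1 (k - int c - int c) = - wave 1 (k + 1)" "wave 1 (k - int c - 1 - int c) = - wave 1 k"
      using wave_anti[of 1 "k - int c - int c"] wave_anti[of 1 "k - int c - 1 - int c"] by (simp_all add: p algebra_simps)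
    have w: "window c sawtooth (k + 1) - window c sawtooth k = sawtooth (k - int c + p) - sawtooth (k - int c)"
      unfolding window_step by (simp add: p algebra_simps)
    show "window c sawtooth (k + 1) - window c sawtooth k =
      (wave 2 (k + 1 - int c) + wave 2 (k + 1 - int c - 1)) / 4 - (wave 2 (k - int c) + wave 2 (k - int c - 1)) / 4"
    proof -
      have "k + 1 - int c = k - int c + 1" "k + 1 - int c - 1 = k - int c - 1 + 1" "k - int c + int c = k" by simp_all
      then show ?thesis unfolding w aw1 using s[of "k - int c"] s[of "k - int c - 1"] t by (simp add: field_simps)
    qed
  qed
qed

lemma window_funpow_sawtooth: "(window c ^^ Suc n) sawtooth k = (wave (n + 2) (k - int c) + wave (n + 2) (k - int c - 1)) / 4"
proof (induction n arbitrary: k)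
  case 0
  then show ?case by (simp add: window_sawtooth numeral_2_eq_2)
next
  case (Suc n)
  have "(window c ^^ Suc n) sawtooth = (\<lambda>k. (1/4) * wave (n + 2) (k + (- int c)) + (1/4) * wave (n + 2) (k + (- int c - 1)))"
    by (rule ext) (simp only: Suc, simp add: algebra_simps)
  then have "(window c ^^ Suc (Suc n)) sawtooth k = window c (\<lambda>k. (1/4) * wave (n + 2) (k + (- int c)) + (1/4) * wave (n + 2) (k + (- int c - 1))) k"
    by simp
  also have "\<dots> = (1/4) * window c (wave (n + 2)) (k + (- int c)) + (1/4) * window c (wave (n + 2)) (k + (- int c - 1))"
    unfolding window_lin window_shift ..
  finally show ?case by (simp add: wave_Suc algebra_simps)
qed

text \<open>The arguments lie symmetrically about p/2, so the wave values that occur are those at 0,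
  0, 1 and -1, and one \<open>wave_step\<close> reduces 1 to 0.\<close>

lemma window_sawtooth_value:
  "(window c ^^ (n + 2)) sawtooth (int c) + (window c ^^ (n + 2)) sawtooth (int c + 1) = half_wave c (n + 2) 0 - half_wave c n 0"
proof -
  have 1: "wave (n + 3) 1 = wave (n + 3) 0 - 2 * wave (n + 1) 0"
    using wave_step[of "n + 2" 0] wave_mid[of "n + 1"] wave_even[of "n + 2" "int c"] by (simp add: numeral_eq_Suc)
  have 2: "wave (n + 3) (- 1) = wave (n + 3) 1" by (rule wave_even)
  have 3: "Suc (n + 1) = n + 2" "n + 1 + 2 = n + 3" by simp_all
  have 4: "wave (n + 3) 0 = half_wave c (n + 2) 0" "wave (n + 1) 0 = half_wave c n 0"
    using wave_0[of "n + 2"] wave_0[of n] by (simp_all add: eval_nat_numeral)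
  have a: "(window c ^^ (n + 2)) sawtooth (int c) = (wave (n + 3) 0 + wave (n + 3) (- 1)) / 4"
    using window_funpow_sawtooth[of "n + 1" "int c"] unfolding 3 by (simp only: diff_self diff_0)
  have b: "(window c ^^ (n + 2)) sawtooth (int c + 1) = (wave (n + 3) 1 + wave (n + 3) 0) / 4"
    using window_funpow_sawtooth[of "n + 1" "int c + 1"] unfolding 3 by (simp only: add_diff_cancel_left' diff_self)
  show ?thesis
    unfolding a b 2 1 4 by (simp add: field_simps del: half_wave.simps)
qed

text \<open>After twisting by signs, the sum of neighbouring values of the sawtooth is an
  alternating constant 1/p minus a difference of combs. The window sum of the latter is a shifted
  pulse, and the former is an eigenfunction of the window, whose contribution compensates the term
  1/p.\<close>

lemma alt_window_sawtooth_value: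
  "1 / real_of_int p + ((alt_window c ^^ (n + 2)) sawtooth (int c + 1) - (alt_window c ^^ (n + 2)) sawtooth (int c)) = psign c ^ (n + 3) * half_wave c n 0"
proof -
  let ?T = "\<lambda>k. psign k * sawtooth k"
  let ?m = "n + 2"
  have pw: "psign c ^ (n + 2) * psign c = psign c ^ (n + 3)" by (simp add: numeral_eq_Suc)
  have even_comb: "even j" if "2 * p dvd j" for j using that by (metis dvd_mult_left)
  have e: "?T (k + 1) + ?T k = (1 / real_of_int p) * psign k + (- 1) * (comb k - comb (k + 1))" for k
  proof -
    have d: "psign k * comb k = comb k" "psign k * comb (k + 1) = - comb (k + 1)" using even_comb[of k] even_comb[of "k + 1"] by (auto simp: psign_def comb_def)
    have "?T (k + 1) + ?T k = - (psign k * (sawtooth (k + 1) - sawtooth k))" by (simp add: psign_add algebra_simps) (simp add: psign_def)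
    also have "\<dots> = (1 / real_of_int p) * psign k + (- 1) * (psign k * comb k + psign k * comb (k + 1))"
      unfolding sawtooth_step by (simp add: algebra_simps)
    finally show ?thesis unfolding d by simp
  qed
  have w: "window c (\<lambda>k. comb k - comb (k + 1)) k = pulse (k + (- int c))" for k
  proof -
    have "window c (\<lambda>k. comb k - comb (k + 1)) k = window c comb k - window c comb (k + 1)"
      using window_shift[of c comb 1 k] window_lin[of c 1 comb "- 1" "\<lambda>k. comb (k + 1)" k] by simp
    also have "\<dots> = comb (k - int c) - comb (k + 1 + int c)" using window_step[of c comb k] by simp
    also have "k + 1 + int c = k + (- int c) + p" by (simp add: p)
    finally show ?thesis by (simp add: pulse_def)
  qed
  have "(window c ^^ ?m) (\<lambda>k. comb k - comb (k + 1)) (int c) = (window c ^^ Suc n) (window c (\<lambda>k. comb k - comb (k + 1))) (int c)"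
    by (simp only: add_2_eq_Suc' funpow_Suc_right[of "Suc n"] o_apply)
  also have "\<dots> = (window c ^^ Suc n) (\<lambda>k. pulse (k + (- int c))) (int c)"
  proof -
    have "window c (\<lambda>k. comb k - comb (k + 1)) = (\<lambda>k. pulse (k + (- int c)))" by (rule ext) (rule w)
    then show ?thesis by (rule arg_cong)
  qed
  also have "\<dots> = wave (Suc n) 0" unfolding window_funpow_shift wave_def by simp
  finally have 1: "(window c ^^ ?m) (\<lambda>k. comb k - comb (k + 1)) (int c) = half_wave c n 0" by (simp only: wave_0)
  have "(window c ^^ ?m) ?T (int c + 1) + (window c ^^ ?m) ?T (int c) = (window c ^^ ?m) (\<lambda>k. ?T (k + 1) + ?T k) (int c)"
    using window_funpow_lin[of ?m c 1 "\<lambda>k. ?T (k + 1)" 1 ?T "int c"] window_funpow_shift[of ?m c ?T 1 "int c"] by simp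
  also have "\<dots> = (1 / real_of_int p) * (psign c ^ ?m * psign c) - half_wave c n 0"
    unfolding e window_funpow_lin 1 window_funpow_psign by (simp del: half_wave.simps funpow.simps)
  finally have 2: "(window c ^^ ?m) ?T (int c + 1) + (window c ^^ ?m) ?T (int c) = (1 / real_of_int p) * psign c ^ (n + 3) - half_wave c n 0"
    unfolding pw .
  have pw': "psign c ^ (n + 2) * (- psign c * u) - psign c ^ (n + 2) * (psign c * v) = - (psign c ^ (n + 3)) * (u + v)" for u v
    unfolding pw[symmetric] by (simp add: algebra_simps)
  have s: "psign (int c + 1) = - psign c" by (simp add: psign_def)
  have sq: "psign c ^ (n + 3) * psign c ^ (n + 3) = 1" by (simp add: psign_sq flip: power_mult_distrib)
  have "(alt_window c ^^ ?m) sawtooth (int c + 1) - (alt_window c ^^ ?m) sawtooth (int c) =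
     - (psign c ^ (n + 3)) * ((window c ^^ ?m) ?T (int c + 1) + (window c ^^ ?m) ?T (int c))"
    unfolding alt_window_funpow_twist s by (rule pw')
  also have "\<dots> = psign c ^ (n + 3) * half_wave c n 0 - (psign c ^ (n + 3) * psign c ^ (n + 3)) / real_of_int p"
    unfolding 2 by (simp add: algebra_simps)
  finally show ?thesis unfolding sq by simp
qed

end

section \<open>The discrete wave equation\<close>

text \<open>\<open>spread r g\<close> is the state at time $r$ of the wave with state 0 at time 0 and $g$ at time 1.\<close>

definition spread :: "nat \<Rightarrow> (int \<Rightarrow> real) \<Rightarrow> int \<Rightarrow> real" where
  "spread r g k = (\<Sum>t<r. g (k - int r + 1 + 2 * int t))"

lemma spread_0: "spread 0 g k = 0" and spread_1: "spread (Suc 0) g k = g k"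
  by (simp_all add: spread_def)

lemma spread_Suc_Suc: "spread (Suc (Suc r)) g k = spread (Suc r) g (k + 1) + spread (Suc r) g (k - 1) - spread r g k"
proof -
  have 1: "spread (Suc (Suc r)) g k = g (k - int r - 1) + spread (Suc r) g (k + 1)"
    unfolding spread_def by (subst sum.lessThan_Suc_shift) (simp add: algebra_simps)
  have 2: "spread (Suc r) g (k - 1) = g (k - int r - 1) + spread r g k"
    unfolding spread_def by (subst sum.lessThan_Suc_shift) (simp add: algebra_simps)
  show ?thesis using 1 2 by simp
qed

lemma sum_even_odd: "(\<Sum>t<2 * c + 1. u t) = (\<Sum>t<Suc c. u (2 * t)) + (\<Sum>t<c. u (2 * t + 1))"
  for u :: "nat \<Rightarrow> real"
  by (induction c) simp_all

lemma sum_symmetric_interval: "(\<Sum>j\<in>{- int c..int c}. h j) = (\<Sum>t<2 * c + 1. h (int t - int c))"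
  by (rule sum.reindex_bij_witness[of _ "\<lambda>t. int t - int c" "\<lambda>j. nat (j + int c)"]) auto

text \<open>The points at even distance from the left end of the window make up
  \<open>spread (Suc c)\<close>, those at odd distance \<open>spread c\<close>.\<close>

lemma window_spread: "window c g k = spread (Suc c) g k + spread c g k"
  unfolding window_def sum_symmetric_interval sum_even_odd by (simp add: spread_def algebra_simps)

lemma alt_window_spread: "alt_window c g k = spread (Suc c) g k - spread c g k"
  unfolding alt_window_def sum_symmetric_interval sum_even_odd by (simp add: spread_def psign_def sum_negf algebra_simps)

definition odd_periodic :: "nat \<Rightarrow> (int \<Rightarrow> real) \<Rightarrow> bool" where
  "odd_periodic p g \<longleftrightarrow> (\<forall>k. g (- k) = - g k) \<and> (\<forall>k. g (k + 2 * int p) = g k)"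

lemma odd_periodic_zero: "odd_periodic p g \<Longrightarrow> g 0 = 0" "odd_periodic p g \<Longrightarrow> g (int p) = 0"
proof -
  assume g: "odd_periodic p g"
  then show "g 0 = 0" unfolding odd_periodic_def by (metis add.inverse_neutral equal_neg_zero)
  have "g (- int p) = - g (int p)" "g (- int p + 2 * int p) = g (- int p)" using g unfolding odd_periodic_def by blast+
  then show "g (int p) = 0" by simp
qed

lemma odd_periodic_spread:
  assumes "odd_periodic p g"
  shows "odd_periodic p (spread r g)"
  unfolding odd_periodic_def
proof (intro conjI allI)
  fix k
  have "spread r g (- k) = (\<Sum>t<r. g (- k - int r + 1 + 2 * int (r - 1 - t)))"
    unfolding spread_def by (rule sum.nat_diff_reindex[symmetric, THEN trans]) simp
  also have "\<dots> = (\<Sum>t<r. - g (k - int r + 1 + 2 * int t))"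
  proof (rule sum.cong)
    fix t assume "t \<in> {..<r}"
    then have "- k - int r + 1 + 2 * int (r - 1 - t) = - (k - int r + 1 + 2 * int t)" by (simp add: of_nat_diff)
    then show "g (- k - int r + 1 + 2 * int (r - 1 - t)) = - g (k - int r + 1 + 2 * int t)"
      using assms by (simp only: odd_periodic_def)
  qed simp
  finally show "spread r g (- k) = - spread r g k" by (simp add: spread_def sum_negf)
  have "g (k + 2 * int p - int r + 1 + 2 * int t) = g (k - int r + 1 + 2 * int t)" for t
  proof -
    have "k + 2 * int p - int r + 1 + 2 * int t = k - int r + 1 + 2 * int t + 2 * int p" by simp
    then show ?thesis using assms by (simp only: odd_periodic_def)
  qed
  then show "spread r g (k + 2 * int p) = spread r g k" by (simp add: spread_def)
qed

section \<open>Sums over two admissible side lengths in every slot\<close>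

primrec choice_sum :: "real \<Rightarrow> nat \<Rightarrow> nat \<Rightarrow> (nat list \<Rightarrow> real) \<Rightarrow> real" where
  "choice_sum s c 0 F = F []"
| "choice_sum s c (Suc m) F = choice_sum s c m (\<lambda>rs. F (Suc c # rs)) + s * choice_sum s c m (\<lambda>rs. F (c # rs))"

lemma choice_sum_cong:
  assumes "\<And>rs. length rs = m \<Longrightarrow> set rs \<subseteq> {c, Suc c} \<Longrightarrow> F rs = F' rs"
  shows "choice_sum s c m F = choice_sum s c m F'"
  using assms
proof (induction m arbitrary: F F')
  case (Suc m)
  have "choice_sum s c m (\<lambda>rs. F (x # rs)) = choice_sum s c m (\<lambda>rs. F' (x # rs))" if "x \<in> {c, Suc c}" for x
    by (rule Suc.IH) (use Suc.prems[of "x # _"] that in auto)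
  then show ?case by simp
qed simp

lemma choice_sum_lin: "choice_sum s c m (\<lambda>rs. x * F rs + y * F' rs) = x * choice_sum s c m F + y * choice_sum s c m F'"
  by (induction m arbitrary: F F') (simp_all add: algebra_simps)

lemma choice_sum_sum: "choice_sum s c m (\<lambda>rs. \<Sum>t<r. F t rs) = (\<Sum>t<r. choice_sum s c m (F t))" for r :: nat
proof (induction r)
  case 0
  show ?case using choice_sum_lin[of s c m 0 "\<lambda>_. 0" 0 "\<lambda>_. 0"] by simp
next
  case (Suc r)
  then show ?case using choice_sum_lin[of s c m 1 "\<lambda>rs. \<Sum>t<r. F t rs" 1 "F r"] by simp
qed

text \<open>As \<open>spread\<close> is linear, the choices can be summed slot by slot, and each
  slot amounts to one application of \<open>W\<close>.\<close>

lemma choice_sum_foldr_spread: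
  assumes W: "\<And>g k. W g k = spread (Suc c) g k + s * spread c g k"
  shows "choice_sum s c m (\<lambda>rs. foldr spread rs g k) = (W ^^ m) g k"
proof (induction m arbitrary: k)
  case (Suc m)
  have "choice_sum s c m (\<lambda>rs. spread r (foldr spread rs g) k) = spread r ((W ^^ m) g) k" for r
    by (simp add: spread_def choice_sum_sum Suc)
  then show ?case using W[of "(W ^^ m) g" k] by simp
qed simp

primrec slot_sum :: "real \<Rightarrow> 'k::field itself \<Rightarrow> nat \<Rightarrow> nat \<Rightarrow> (nat \<times> nat) list \<Rightarrow> real" where
  "slot_sum s K 0 b L = real (snull K L)"
| "slot_sum s K (Suc m) b L = slot_sum s K m b ((b + 1, 1) # L) + s * slot_sum s K m b ((b, 1) # L)"

lemma slot_sum_snull_alt: "slot_sum (- 1) K m b L = real_of_int (snull_alt K m b L)"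
  by (induction m arbitrary: L) simp_all

lemma choice_sum_snull: "choice_sum s c m (\<lambda>rs. real (snull K (map (\<lambda>r. (a + r, 1)) rs @ L))) = slot_sum s K m (a + c) L"
proof (induction m arbitrary: L)
  case (Suc m)
  have "snull K (map (\<lambda>r. (a + r, 1)) (x # rs) @ L) = snull K (map (\<lambda>r. (a + r, 1)) rs @ (a + x, 1) # L)" for x rs
    by (rule snull_perm) simp
  then show ?case using Suc[of "(a + c + 1, 1) # L"] Suc[of "(a + c, 1) # L"] by (simp del: list.map)
qed simp

text \<open>Multilinear interpolation of the nullity between its values at side lengths $pb$ and $p(b+1)$, times a power of $p$.\<close>

primrec interpol :: "'k::field itself \<Rightarrow> nat \<Rightarrow> nat \<Rightarrow> nat list \<Rightarrow> (nat \<times> nat) list \<Rightarrow> real" where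
  "interpol K p b [] L = real (snull K L)"
| "interpol K p b (r # rs) L = real r * interpol K p b rs ((b + 1, 1) # L) + (real p - real r) * interpol K p b rs ((b, 1) # L)"

lemma interpol_perm_right: "mset L = mset L' \<Longrightarrow> interpol K p b rs L = interpol K p b rs L'"
proof (induction rs arbitrary: L L')
  case (Cons r rs)
  have "interpol K p b rs (x # L) = interpol K p b rs (x # L')" for x by (rule Cons.IH) (simp add: Cons.prems)
  then show ?case by simp
qed (use snull_perm in \<open>simp, blast\<close>)

lemma interpol_swap: "interpol K p b (P @ x # y # rs) L = interpol K p b (P @ y # x # rs) L"
proof (induction P arbitrary: L)
  case Nil
  have "interpol K p b rs ((b, 1) # (b + 1, 1) # L) = interpol K p b rs ((b + 1, 1) # (b, 1) # L)"
    by (rule interpol_perm_right) simp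
  then show ?case by (simp add: algebra_simps)
qed simp

lemma interpol_perm: "mset rs = mset rs' \<Longrightarrow> interpol K p b rs L = interpol K p b rs' L"
  by (rule swap_invariant_perm[of "\<lambda>rs. interpol K p b rs L", OF interpol_swap])

text \<open>The assumptions say that the weights of \<open>b + 1\<close> and \<open>b\<close>,
  summed over both choices with their signs, are \<open>\<kappa>\<close> times 1 and
  \<open>s\<close>. For p = 2c + 1 this holds with \<open>\<kappa>\<close> = p for s = 1 and with
  \<open>\<kappa>\<close> = 1 for s = -1.\<close>

lemma choice_sum_interpol:
  assumes "real (Suc c) + s * real c = \<kappa>" "(real p - real (Suc c)) + s * (real p - real c) = \<kappa> * s"
  shows "choice_sum s c m (\<lambda>rs. interpol K p b rs L) = \<kappa> ^ m * slot_sum s K m b L"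
proof (induction m arbitrary: L)
  case (Suc m)
  have e: "choice_sum s c m (\<lambda>rs. interpol K p b (x # rs) L) = real x * (\<kappa> ^ m * slot_sum s K m b ((b + 1, 1) # L)) + (real p - real x) * (\<kappa> ^ m * slot_sum s K m b ((b, 1) # L))" for x
    by (simp only: interpol.simps choice_sum_lin Suc)
  have "choice_sum s c (Suc m) (\<lambda>rs. interpol K p b rs L) =
      (real (Suc c) + s * real c) * (\<kappa> ^ m * slot_sum s K m b ((b + 1, 1) # L)) +
      ((real p - real (Suc c)) + s * (real p - real c)) * (\<kappa> ^ m * slot_sum s K m b ((b, 1) # L))"
    unfolding choice_sum.simps e by (simp add: algebra_simps)
  also have "\<dots> = \<kappa> ^ Suc m * slot_sum s K (Suc m) b L"
    unfolding assms by (simp add: algebra_simps)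
  finally show ?case .
qed simp

section \<open>The deviation of nullities from interpolation\<close>

context char_p
begin

text \<open>Each entry contributes weights of sum \<open>p\<close> to \<open>interpol\<close>, but
  multiplying all sides by \<open>p\<close> multiplies the nullity by one factor \<open>p\<close>
  less; hence the division.\<close>

definition deviation :: "nat \<Rightarrow> nat list \<Rightarrow> real" where
  "deviation b rs = real (snull K (map (\<lambda>r. (p * b + r, 1)) rs)) - interpol K p b rs [] / real p"

lemma deviation_perm: "mset rs = mset rs' \<Longrightarrow> deviation b rs = deviation b rs'"
  unfolding deviation_def using interpol_perm[of rs rs' K p b "[]"] snull_perm[of "map (\<lambda>r. (p * b + r, 1)) rs" "map (\<lambda>r. (p * b + r, 1)) rs'" K]
  by simp

lemma snull_dilate_interpol: "set rs \<subseteq> {..p} \<Longrightarrow> real (snull K (map (\<lambda>r. (p * b + r, p)) rs @ L)) = interpol K p b rs L"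
proof (induction rs arbitrary: L)
  case (Cons r rs)
  have "snull K (map (\<lambda>r. (p * b + r, p)) (r # rs) @ L) =
      r * snull K ((b + 1, 1) # map (\<lambda>r. (p * b + r, p)) rs @ L) + (p - r) * snull K ((b, 1) # map (\<lambda>r. (p * b + r, p)) rs @ L)"
    using snull_split_residues[of p r K b "map (\<lambda>r. (p * b + r, p)) rs @ L"] p_ge_3 Cons.prems by simp
  moreover have "snull K (x # map (\<lambda>r. (p * b + r, p)) rs @ L) = snull K (map (\<lambda>r. (p * b + r, p)) rs @ x # L)" for x
    by (rule snull_perm) simp
  ultimately show ?case using Cons by (simp add: of_nat_diff)
qed simp

lemma snull_multiple:
  assumes "set rs \<subseteq> {..p}"
  shows "real (snull K ((p * j, 1) # map (\<lambda>r. (p * b + r, 1)) rs)) = interpol K p b rs [(j, 1)]"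
proof -
  have "snull K ((p * j, 1) # map (\<lambda>r. (p * b + r, 1)) rs) = snull K ((j, 1) # map (\<lambda>r. (p * b + r, p)) rs)"
    unfolding snull_frobenius[OF p_prime char_K] by (simp add: dilate_def comp_def)
  also have "\<dots> = snull K (map (\<lambda>r. (p * b + r, p)) rs @ [(j, 1)])" by (rule snull_perm) simp
  finally show ?thesis using snull_dilate_interpol[OF assms] by simp
qed

text \<open>If one side is divisible by \<open>p\<close>, the Frobenius gives all other sides step
  width \<open>p\<close>, and for those the nullity is exactly affine in each remainder.\<close>

lemma deviation_boundary:
  assumes "set rs \<subseteq> {..p}"
  shows "deviation b (0 # rs) = 0" "deviation b (p # rs) = 0"
proof -
  have p: "real p \<noteq> 0" using p_ge_3 by simp
  show "deviation b (0 # rs) = 0" using snull_multiple[OF assms, of b b] p by (simp add: deviation_def)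
  have "p * b + p = p * (b + 1)" by simp
  then show "deviation b (p # rs) = 0" using snull_multiple[OF assms, of "b + 1" b] p by (simp add: deviation_def del: mult_Suc_right)
qed

text \<open>By \<open>snull_wave\<close> both sums of nullities equal the nullity with an additional
  side of length 2; this needs that neither side is divisible by \<open>p\<close>. The interpolation
  term is affine in each entry and so satisfies the equation as well.\<close>

lemma deviation_wave:
  assumes "1 \<le> i" "i < p" "1 \<le> j" "j < p"
  shows "deviation b ((i + 1) # j # rs) + deviation b ((i - 1) # j # rs) = deviation b (i # (j + 1) # rs) + deviation b (i # (j - 1) # rs)"
proof -
  let ?L = "map (\<lambda>r. (p * b + r, 1 :: nat)) rs"
  have nz: "of_nat (p * b + k) \<noteq> (0 :: 'k)" if "1 \<le> k" "k < p" for k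
  proof
    assume "of_nat (p * b + k) = (0 :: 'k)"
    then have "p dvd p * b + k" unfolding of_nat_eq_0_iff_char_dvd char_K .
    then have "p dvd k" by (simp add: dvd_add_right_iff)
    then show False using that by (simp add: nat_dvd_not_less)
  qed
  have w: "snull K ((p * b + (k + 1), 1) # x # ?L) + snull K ((p * b + (k - 1), 1) # x # ?L) = snull K ((2, 1) # (p * b + k, 1) # x # ?L)"
    if "1 \<le> k" "k < p" for k x
    using snull_wave[OF nz[OF that], of K "x # ?L"] that by simp
  have s: "snull K ((2, 1) # y # x # ?L) = snull K ((2, 1) # x # y # ?L)" "snull K (x # y # ?L) = snull K (y # x # ?L)" for x y
    by (rule snull_perm, simp)+
  have d: "snull K ((p * b + (i + 1), 1) # (p * b + j, 1) # ?L) + snull K ((p * b + (i - 1), 1) # (p * b + j, 1) # ?L) =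
    snull K ((p * b + i, 1) # (p * b + (j + 1), 1) # ?L) + snull K ((p * b + i, 1) # (p * b + (j - 1), 1) # ?L)"
    unfolding w[OF assms(1,2)] s(2)[of "(p * b + i, 1)"] w[OF assms(3,4)] by (rule s(1))
  have m: "interpol K p b ((i + 1) # j # rs) [] + interpol K p b ((i - 1) # j # rs) [] = interpol K p b (i # (j + 1) # rs) [] + interpol K p b (i # (j - 1) # rs) []"
    using assms by (simp add: of_nat_diff algebra_simps)
  show ?thesis
    unfolding deviation_def using arg_cong[OF d, of real] arg_cong[OF m, of "\<lambda>x. x / real p"] by (simp add: add_divide_distrib)
qed

text \<open>The boundary values at 0 and $p$ vanish, so the odd $2p$-periodic extension continues to solve the wave equation.\<close>

lemma deviation_spread:
  assumes g: "odd_periodic p g" and base: "\<And>k. k \<le> p \<Longrightarrow> deviation b (k # replicate m 1) = g (int k)"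
  shows "set rs \<subseteq> {..p} \<Longrightarrow> length rs + n = m \<Longrightarrow> k \<le> p \<Longrightarrow> deviation b (k # rs @ replicate n 1) = foldr spread rs g (int k)"
proof (induction rs arbitrary: n k)
  case (Cons r rs)
  define H where "H = foldr spread rs g"
  let ?T = "rs @ replicate n 1"
  have T: "set ?T \<subseteq> {..p}" using Cons.prems p_ge_3 by auto
  have oH: "odd_periodic p H" unfolding H_def by (induction rs) (simp_all add: g odd_periodic_spread)
  \<comment> \<open>The entry \<open>i\<close> is the time: time 0 is a boundary value, time 1 is
    the case with one more 1 in the tail, and later times follow from the wave equation.\<close>
  have "deviation b (k # i # ?T) = spread i H (int k)" if "i \<le> p" "k \<le> p" for i k
    using that
  proof (induction i arbitrary: k rule: induct_nat_012)
    case 0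
    have "deviation b (k # 0 # ?T) = deviation b (0 # k # ?T)" by (rule deviation_perm) simp
    then show ?case using deviation_boundary(1)[of "k # ?T" b] T 0 by (simp add: spread_0)
  next
    case 1
    have "deviation b (k # 1 # ?T) = deviation b (k # rs @ replicate (Suc n) 1)" by (rule deviation_perm) simp
    also have "\<dots> = H (int k)" unfolding H_def using Cons.prems 1 by (intro Cons.IH) auto
    finally show ?case by (simp add: spread_1)
  next
    case (ge2 i)
    have "set (Suc (Suc i) # ?T) \<subseteq> {..p}" using T ge2.prems by auto
    then have bd: "deviation b (0 # Suc (Suc i) # ?T) = 0" "deviation b (p # Suc (Suc i) # ?T) = 0" by (rule deviation_boundary)+
    consider "k = 0" | "k = p" | "1 \<le> k" "k < p" using ge2.prems by linarith
    then show ?case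
    proof cases
      case 1
      then show ?thesis using bd(1) odd_periodic_zero(1)[OF odd_periodic_spread[OF oH]] by simp
    next
      case 2
      then show ?thesis using bd(2) odd_periodic_zero(2)[OF odd_periodic_spread[OF oH]] by simp
    next
      case 3
      have i: "1 \<le> Suc i" "Suc i < p" using ge2.prems by auto
      have "deviation b ((k + 1) # Suc i # ?T) + deviation b ((k - 1) # Suc i # ?T) = deviation b (k # Suc (Suc i) # ?T) + deviation b (k # i # ?T)"
        using deviation_wave[OF 3 i, of b ?T] by simp
      moreover have "deviation b ((k + 1) # Suc i # ?T) = spread (Suc i) H (int k + 1)"
        using ge2.IH(2)[of "k + 1"] 3 i by (simp add: add.commute)
      moreover have "deviation b ((k - 1) # Suc i # ?T) = spread (Suc i) H (int k - 1)"
        using ge2.IH(2)[of "k - 1"] 3 i by (simp add: of_nat_diff)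
      moreover have "deviation b (k # i # ?T) = spread i H (int k)"
        using ge2.IH(1)[of k] 3 i by simp
      ultimately show ?thesis unfolding spread_Suc_Suc by linarith
    qed
  qed
  then show ?case using Cons.prems by (simp add: H_def)
qed (use base in simp)

text \<open>Every nullity is split into interpolation and deviation. The first parts add up to a
  multiple of the old slot sum. In the second parts one slot is kept as the space variable of the
  wave, and the other slots are times, each contributing one \<open>W\<close>.\<close>

lemma slot_sum_step:
  assumes g: "odd_periodic p g" and base: "\<And>k. k \<le> p \<Longrightarrow> deviation b (k # replicate m 1) = g (int k)"
    and c: "c < p" and k: "real (Suc c) + s * real c = \<kappa>" "(real p - real (Suc c)) + s * (real p - real c) = \<kappa> * s"
    and W: "\<And>g k. W g k = spread (Suc c) g k + s * spread c g k"
  shows "slot_sum s K (Suc m) (p * b + c) [] = \<kappa> ^ Suc m / real p * slot_sum s K (Suc m) b [] + ((W ^^ m) g (int c + 1) + s * (W ^^ m) g (int c))"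
proof -
  let ?D = "\<lambda>rs. real (snull K (map (\<lambda>r. (p * b + r, 1)) rs))"
  have fc: "choice_sum s c m (\<lambda>rs. deviation b (x # rs)) = (W ^^ m) g (int x)" if "x \<in> {c, Suc c}" for x
  proof -
    have "choice_sum s c m (\<lambda>rs. deviation b (x # rs)) = choice_sum s c m (\<lambda>rs. foldr spread rs g (int x))"
    proof (rule choice_sum_cong)
      fix rs :: "nat list" assume *: "length rs = m" "set rs \<subseteq> {c, Suc c}"
      then have "set rs \<subseteq> {..p}" using c by auto
      with * show "deviation b (x # rs) = foldr spread rs g (int x)"
        using deviation_spread[OF g base, of rs 0 x] that c by auto
    qed
    also have "\<dots> = (W ^^ m) g (int x)" by (rule choice_sum_foldr_spread[OF W])
    finally show ?thesis .
  qed
  have "slot_sum s K (Suc m) (p * b + c) [] = choice_sum s c (Suc m) ?D"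
    using choice_sum_snull[of s c "Suc m" K "p * b" "[]"] by (simp only: append_Nil2)
  also have "?D = (\<lambda>rs. 1 * deviation b rs + (1 / real p) * interpol K p b rs [])"
    by (rule ext) (simp add: deviation_def)
  also have "choice_sum s c (Suc m) \<dots> = choice_sum s c (Suc m) (deviation b) + (1 / real p) * (\<kappa> ^ Suc m * slot_sum s K (Suc m) b [])"
    unfolding choice_sum_lin choice_sum_interpol[OF k] by simp
  also have "choice_sum s c (Suc m) (deviation b) = (W ^^ m) g (int c + 1) + s * (W ^^ m) g (int c)"
    using fc[of c] fc[of "Suc c"] by (simp add: add.commute)
  finally show ?thesis by simp
qed

text \<open>\<open>n0\<close> is the sum \<open>A + A'\<close> of the amplitudes, while the
  alternating slot sum at \<open>b\<close> is \<open>A - A'\<close>; both amplitudes being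
  nonnegative, the former bounds the absolute value of the latter.\<close>

lemma slot_sum_recursion:
  assumes c: "p = 2 * c + 1"
  obtains n0 :: real where
    "slot_sum 1 K (n + 3) (p * b + c) [] = real p ^ (n + 2) * slot_sum 1 K (n + 3) b [] + n0 * (half_wave c (n + 2) 0 - half_wave c n 0)"
    "\<bar>slot_sum (- 1) K (n + 3) (p * b + c) []\<bar> = \<bar>half_wave c n 0\<bar> * \<bar>slot_sum (- 1) K (n + 3) b []\<bar>"
    "\<bar>slot_sum (- 1) K (n + 3) b []\<bar> \<le> n0" "n0 \<le> real (2 * b + 1) ^ (n + 1)"
proof -
  let ?m = "n + 2"
  obtain A A' :: real where A: "A \<ge> 0" "A' \<ge> 0" "A - A' = real_of_int (snull_alt K (Suc ?m) b [])"
    "A + A' \<le> real (2 * b + 1) ^ (?m - 1)"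
    "\<And>k. 1 \<le> k \<Longrightarrow> k \<le> p - 1 \<Longrightarrow>
       real (snull K ((p * b + k, 1) # replicate ?m (p * b + 1, 1))) =
       (1 - k / p) * (snull K ((p * b, 1) # replicate ?m (p * b + 1, 1)) + A) +
       (k / p) * (snull K ((p * (b + 1), 1) # replicate ?m (p * b + 1, 1)) + A')"
    by (rule kernel_count[OF _ refl, of ?m b]) (simp, blast)
  have ip: "int p = 2 * int c + 1" using c by simp
  let ?sawtooth = "sawtooth (int p)"
  \<comment> \<open>Strictly between 0 and \<open>p\<close> this is A (1 - k/p) + A' k/p, and it is
    0 at both ends; the sawtooth supplies the odd periodic extension.\<close>
  define g where "g k = A * ?sawtooth k + A' * ?sawtooth (int p - k)" for k
  have boxfun: "?sawtooth 0 = 0" "?sawtooth (int p) = 0" using sawtooth_0[OF ip] sawtooth_eq[OF ip, of "int p"] p_ge_3 by simp_all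
  have "odd_periodic p ?sawtooth" unfolding odd_periodic_def
    using sawtooth_minus[OF ip] sawtooth_periodic[OF ip] by blast
  moreover have sm: "?sawtooth (int p + k) = - ?sawtooth (int p - k)" for k
    using sawtooth_periodic[OF ip, of "- int p + k"] sawtooth_minus[OF ip, of "int p - k"] by (simp add: algebra_simps)
  moreover have "?sawtooth (int p - (k + 2 * int p)) = ?sawtooth (int p - k)" for k
    using sawtooth_periodic[OF ip, of "- int p - k"] sawtooth_periodic[OF ip, of "int p - k - 2 * int p"] by (simp add: algebra_simps)
  ultimately have og: "odd_periodic p g"
    unfolding odd_periodic_def g_def by (simp add: algebra_simps)
  have rp: "real p > 0" using p_ge_3 by simp
  have base: "deviation b (k # replicate ?m 1) = g (int k)" if k: "k \<le> p" for k
  proof -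
    have R: "set (replicate ?m 1) \<subseteq> {..p}" using p_ge_3 by auto
    note bd = deviation_boundary[OF R, of b]
    consider "k = 0" | "k = p" | "1 \<le> k" "k \<le> p - 1" using k by linarith
    then show ?thesis
    proof cases
      case 3
      define x where "x = real k / real p"
      have kx: "real k = x * real p" using rp by (simp add: x_def)
      have pb: "p * (b + 1) = p * b + p" by simp
      define f where "f k = real (snull K ((p * b + k, 1) # replicate ?m (p * b + 1, 1)))" for k
      have GGf: "deviation b (k # replicate ?m 1) = f k - interpol K p b (k # replicate ?m 1) [] / real p" for k
        by (simp add: deviation_def f_def map_replicate del: replicate.simps interpol.simps replicate_Suc add_2_eq_Suc')
      have f: "f k = (1 - x) * (f 0 + A) + x * (f p + A')"
        using A(5)[OF 3] unfolding f_def x_def pb by simp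
      have mlx: "interpol K p b (k # R) [] = (1 - x) * interpol K p b (0 # R) [] + x * interpol K p b (p # R) []" for R
        by (simp add: kx algebra_simps)
      have "deviation b (k # replicate ?m 1) = (1 - x) * A + x * A'"
      proof -
        have *: "fk - ((1 - x) * M0 + x * Mp) / P = (1 - x) * A + x * A'"
          if "f0 - M0 / P = 0" "fp - Mp / P = 0" "fk = (1 - x) * (f0 + A) + x * (fp + A')" for fk f0 fp M0 Mp P
          using that by (simp add: add_divide_distrib diff_divide_distrib algebra_simps)
        show ?thesis unfolding GGf mlx[of "replicate ?m 1"] by (rule *[OF bd[unfolded GGf] f])
      qed
      moreover have "?sawtooth (int k) = 1 - x" "?sawtooth (int p - int k) = x"
        using sawtooth_eq[OF ip, of "int k"] sawtooth_eq[OF ip, of "int p - int k"] 3 rp by (simp_all add: x_def diff_divide_distrib)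
      ultimately show ?thesis by (simp only: g_def mult.commute)
    qed (use bd boxfun in \<open>simp_all add: g_def\<close>)
  qed
  have rc: "real p = 2 * real c + 1" using c by simp
  have cp: "c < p" "int p - int c = int c + 1" "int p - (int c + 1) = int c" using c by simp_all
  have "slot_sum 1 K (n + 3) (p * b + c) [] = real p ^ (n + 2) * slot_sum 1 K (n + 3) b [] + (A + A') * (half_wave c (n + 2) 0 - half_wave c n 0)"
  proof -
    have w: "(window c ^^ ?m) g k = A * (window c ^^ ?m) ?sawtooth k + A' * (window c ^^ ?m) ?sawtooth (int p - k)" for k
      unfolding g_def[abs_def] window_funpow_lin window_funpow_reflect ..
    have "slot_sum 1 K (Suc ?m) (p * b + c) [] = real p ^ Suc ?m / real p * slot_sum 1 K (Suc ?m) b [] + ((window c ^^ ?m) g (int c + 1) + 1 * (window c ^^ ?m) g (int c))"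
      by (rule slot_sum_step[OF og base cp(1)]) (simp_all add: rc window_spread)
    also have "(window c ^^ ?m) g (int c + 1) + 1 * (window c ^^ ?m) g (int c) = (A + A') * ((window c ^^ ?m) ?sawtooth (int c) + (window c ^^ ?m) ?sawtooth (int c + 1))"
      unfolding w cp by (simp only: mult_1 distrib_left distrib_right)
    finally show ?thesis unfolding window_sawtooth_value[OF ip] using rp by (simp add: eval_nat_numeral del: half_wave.simps slot_sum.simps)
  qed
  moreover have "slot_sum (- 1) K (n + 3) (p * b + c) [] = psign c ^ (n + 3) * half_wave c n 0 * slot_sum (- 1) K (n + 3) b []"
  proof -
    have w: "(alt_window c ^^ ?m) g k = A * (alt_window c ^^ ?m) ?sawtooth k + A' * (alt_window c ^^ ?m) ?sawtooth (int p - k)" for k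
      unfolding g_def[abs_def] alt_window_funpow_lin alt_window_funpow_reflect ..
    let ?Y = "(alt_window c ^^ ?m) ?sawtooth (int c + 1) - (alt_window c ^^ ?m) ?sawtooth (int c)"
    have "slot_sum (- 1) K (Suc ?m) (p * b + c) [] = 1 ^ Suc ?m / real p * slot_sum (- 1) K (Suc ?m) b [] + ((alt_window c ^^ ?m) g (int c + 1) + (- 1) * (alt_window c ^^ ?m) g (int c))"
      by (rule slot_sum_step[OF og base cp(1)]) (simp_all add: alt_window_spread)
    \<comment> \<open>The reflection exchanges \<open>c\<close> and \<open>c + 1\<close>, so
      \<open>A'\<close> enters with the opposite sign.\<close>
    also have "(alt_window c ^^ ?m) g (int c + 1) + (- 1) * (alt_window c ^^ ?m) g (int c) = (A - A') * ?Y"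
      unfolding w cp by (simp add: algebra_simps)
    also have "A - A' = slot_sum (- 1) K (Suc ?m) b []" unfolding A(3) slot_sum_snull_alt ..
    also have "1 ^ Suc ?m / real p * slot_sum (- 1) K (Suc ?m) b [] + slot_sum (- 1) K (Suc ?m) b [] * ?Y = (1 / real p + ?Y) * slot_sum (- 1) K (Suc ?m) b []"
      unfolding power_one by (simp only: distrib_right) (simp only: mult.commute)
    also have "1 / real p + ?Y = psign c ^ (n + 3) * half_wave c n 0" using alt_window_sawtooth_value[OF ip, of n] by simp
    also have "Suc ?m = n + 3" by simp
    finally show ?thesis .
  qed
  then have "\<bar>slot_sum (- 1) K (n + 3) (p * b + c) []\<bar> = \<bar>half_wave c n 0\<bar> * \<bar>slot_sum (- 1) K (n + 3) b []\<bar>"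
    by (simp only: abs_mult power_abs abs_psign power_one mult_1)
  moreover have "\<bar>slot_sum (- 1) K (n + 3) b []\<bar> \<le> A + A'"
  proof -
    have "slot_sum (- 1) K (n + 3) b [] = A - A'" unfolding A(3) slot_sum_snull_alt by (simp only: eval_nat_numeral add_Suc_right add_0_right)
    then show ?thesis using A(1,2) by linarith
  qed
  moreover have "A + A' \<le> real (2 * b + 1) ^ (n + 1)" using A(4) by simp
  ultimately show thesis by (rule that)
qed

end

section \<open>Duality\<close>

lemma poly_mapping_add_induct [case_names zero add]:
  assumes "P 0" "\<And>f k v. P f \<Longrightarrow> P (f + Poly_Mapping.single k v)"
  shows "P (f :: 'a \<Rightarrow>\<^sub>0 'b::monoid_add)"
proof (induction f rule: Poly_Mapping.update_induct)
  case (update f a b)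
  have "Poly_Mapping.update a b f = f + Poly_Mapping.single a b"
  proof (rule poly_mapping_eqI)
    show "Poly_Mapping.lookup (Poly_Mapping.update a b f) k = Poly_Mapping.lookup (f + Poly_Mapping.single a b) k" for k
      using update(1) by (cases "a = k") (simp_all add: Poly_Mapping.lookup_update lookup_add lookup_single in_keys_iff)
  qed
  then show ?case using assms(2)[OF update(3)] by simp
qed (rule assms)

lemma lookup_mult_monomial:
  fixes f :: "('a::cancel_comm_monoid_add) \<Rightarrow>\<^sub>0 'b::comm_semiring_1"
  shows "Poly_Mapping.lookup (f * Poly_Mapping.single t 1) (s + t) = Poly_Mapping.lookup f s"
    "(\<And>s. u \<noteq> s + t) \<Longrightarrow> Poly_Mapping.lookup (f * Poly_Mapping.single t 1) u = 0"
proof -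
  show "Poly_Mapping.lookup (f * Poly_Mapping.single t 1) (s + t) = Poly_Mapping.lookup f s"
    by (induction f rule: poly_mapping_add_induct)
      (simp_all add: distrib_right mult_single lookup_add lookup_single when_def)
  show "Poly_Mapping.lookup (f * Poly_Mapping.single t 1) u = 0" if "\<And>s. u \<noteq> s + t"
    by (induction f rule: poly_mapping_add_induct)
      (use that in \<open>auto simp: distrib_right mult_single lookup_add lookup_single when_def\<close>)
qed

lemma lookup_Const_mult: "Poly_Mapping.lookup (Const a * f) k = a * Poly_Mapping.lookup f k"
  by (simp add: Const_def Poly_Mapping.map.rep_eq when_def flip: mult_map_scale_conv_mult)

lemma Var_power: "Var i ^ n = (Poly_Mapping.single (Poly_Mapping.single i n) 1 :: 'k::comm_ring_1 mpoly)"
proof (induction n)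
  case (Suc n)
  have "(Poly_Mapping.single i 1 :: nat \<Rightarrow>\<^sub>0 nat) + Poly_Mapping.single i n = Poly_Mapping.single i (Suc n)"
    by (simp flip: single_add)
  then show ?case unfolding power_Suc Suc unfolding Var_def mult_single by simp
qed (simp add: single_one)

section \<open>Polynomials in finitely many variables and their ideals\<close>

lemma polys_in_add: "f \<in> polys_in N \<Longrightarrow> g \<in> polys_in N \<Longrightarrow> f + g \<in> polys_in N"
  using Poly_Mapping.keys_add[of f g] by (auto simp: polys_in_def)

lemma polys_in_0: "0 \<in> polys_in N"
  by (simp add: polys_in_def)

lemma polys_in_sum: "(\<And>x. x \<in> A \<Longrightarrow> f x \<in> polys_in N) \<Longrightarrow> (\<Sum>x\<in>A. f x) \<in> polys_in N"
  by (induction A rule: infinite_finite_induct) (auto intro: polys_in_add polys_in_0)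

lemma polys_in_mult: "f \<in> polys_in N \<Longrightarrow> g \<in> polys_in N \<Longrightarrow> f * g \<in> polys_in N"
proof -
  assume f: "f \<in> polys_in N" and g: "g \<in> polys_in N"
  show "f * g \<in> polys_in N"
    unfolding polys_in_def
  proof (intro CollectI ballI)
    fix m i assume m: "m \<in> Poly_Mapping.keys (f * g)" and i: "i \<in> Poly_Mapping.keys m"
    obtain a b where ab: "m = a + b" "a \<in> Poly_Mapping.keys f" "b \<in> Poly_Mapping.keys g"
      using m keys_mult[of f g] by blast
    have "i \<in> Poly_Mapping.keys a \<union> Poly_Mapping.keys b" using i Poly_Mapping.keys_add[of a b] ab by blast
    then show "i < N" using f g ab unfolding polys_in_def by blast
  qed
qed

lemma polys_in_single: "(\<And>i. i \<in> Poly_Mapping.keys m \<Longrightarrow> i < N) \<Longrightarrow> Poly_Mapping.single m a \<in> polys_in N"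
  by (simp add: polys_in_def)

lemma polys_in_Const: "Const a \<in> polys_in N"
  unfolding Const_def by (rule polys_in_single) simp

lemma polys_in_uminus: "f \<in> polys_in N \<Longrightarrow> - f \<in> polys_in N"
  for f :: "'k::comm_ring_1 mpoly"
  by (simp add: polys_in_def in_keys_iff)

lemma polys_in_diff: "f \<in> polys_in N \<Longrightarrow> g \<in> polys_in N \<Longrightarrow> f - g \<in> polys_in N"
  for f g :: "'k::comm_ring_1 mpoly"
  using polys_in_add[of f N "- g"] polys_in_uminus[of g N] by simp

lemma polys_in_Var_power: "i < N \<Longrightarrow> Var i ^ n \<in> polys_in N"
  unfolding Var_power by (rule polys_in_single) (auto split: if_splits)

lemma ideal_genE:
  assumes "f \<in> ideal_gen N G"
  obtains r :: nat and c g where "f = (\<Sum>j<r. c j * g j)" "\<forall>j<r. c j \<in> polys_in N \<and> g j \<in> G"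
proof -
  have "\<exists>(r :: nat) c g. f = (\<Sum>j<r. c j * g j) \<and> (\<forall>j<r. c j \<in> polys_in N \<and> g j \<in> G)"
    using assms unfolding ideal_gen_def by simp
  then obtain r :: nat and c g where "f = (\<Sum>j<r. c j * g j)" "\<forall>j<r. c j \<in> polys_in N \<and> g j \<in> G"
    by (elim exE conjE)
  then show thesis by (rule that)
qed

lemma ideal_gen_add:
  assumes "f \<in> ideal_gen N G" "g \<in> ideal_gen N G"
  shows "f + g \<in> ideal_gen N G"
proof -
  obtain r :: nat and c u where f: "f = (\<Sum>j<r. c j * u j)" "\<forall>j<r. c j \<in> polys_in N \<and> u j \<in> G"
    by (rule ideal_genE[OF assms(1)])
  obtain r' :: nat and c' u' where g: "g = (\<Sum>j<r'. c' j * u' j)" "\<forall>j<r'. c' j \<in> polys_in N \<and> u' j \<in> G"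
    by (rule ideal_genE[OF assms(2)])
  define C where "C j = (if j < r then c j else c' (j - r))" for j
  define U where "U j = (if j < r then u j else u' (j - r))" for j
  have "(\<Sum>j<r + r'. C j * U j) = (\<Sum>j<r. C j * U j) + (\<Sum>j=r..<r + r'. C j * U j)"
    using sum.atLeastLessThan_concat[of 0 r "r + r'" "\<lambda>j. C j * U j"] by (simp add: atLeast0LessThan)
  also have "(\<Sum>j<r. C j * U j) = f" unfolding f by (rule sum.cong) (auto simp: C_def U_def)
  also have "(\<Sum>j=r..<r + r'. C j * U j) = g"
    unfolding g by (rule sum.reindex_bij_witness[of _ "\<lambda>j. j + r" "\<lambda>j. j - r"]) (auto simp: C_def U_def)
  finally have "f + g = (\<Sum>j<r + r'. C j * U j)" ..
  moreover have "\<forall>j<r + r'. C j \<in> polys_in N \<and> U j \<in> G" using f g by (auto simp: C_def U_def)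
  ultimately show ?thesis unfolding ideal_gen_def by blast
qed

lemma ideal_gen_0: "0 \<in> ideal_gen N G"
  unfolding ideal_gen_def by (intro CollectI exI[of _ 0]) auto

lemma ideal_gen_sum: "(\<And>x. x \<in> A \<Longrightarrow> f x \<in> ideal_gen N G) \<Longrightarrow> (\<Sum>x\<in>A. f x) \<in> ideal_gen N G"
  by (induction A rule: infinite_finite_induct) (auto intro: ideal_gen_add ideal_gen_0)

lemma ideal_gen_base: "c \<in> polys_in N \<Longrightarrow> g \<in> G \<Longrightarrow> c * g \<in> ideal_gen N G"
  unfolding ideal_gen_def
  by (intro CollectI exI[of _ 1] exI[of _ "\<lambda>_. c"] exI[of _ "\<lambda>_. g"]) auto

definition inbox :: "nat \<Rightarrow> nat \<Rightarrow> nat list \<Rightarrow> bool" where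
  "inbox N q xs \<longleftrightarrow> length xs = N \<and> (\<forall>x\<in>set xs. x < q)"

text \<open>Complementary exponents: the reflection realises the self-duality of k[x] modulo the
  x_i^q and exchanges up-shifts with down-shifts.\<close>

definition mirror :: "nat \<Rightarrow> nat list \<Rightarrow> nat list" where
  "mirror q xs = map (\<lambda>x. q - 1 - x) xs"

lemma length_mirror [simp]: "length (mirror q xs) = length xs"
  and nth_mirror: "i < length xs \<Longrightarrow> mirror q xs ! i = q - 1 - xs ! i"
  by (simp_all add: mirror_def)

lemma inbox_nth: "inbox N q xs \<longleftrightarrow> length xs = N \<and> (\<forall>i<N. xs ! i < q)"
  by (auto simp: inbox_def all_set_conv_all_nth)

lemma inbox_mirror: "inbox N q xs \<Longrightarrow> inbox N q (mirror q xs)"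
  by (auto simp: inbox_nth nth_mirror)

lemma mirror_mirror: "inbox N q xs \<Longrightarrow> mirror q (mirror q xs) = xs"
  by (rule nth_equalityI) (auto simp: inbox_nth nth_mirror)

text \<open>Coordinates of a polynomial modulo the \<open>q\<close>-th powers of the
  variables.\<close>

definition box_coeffs :: "nat \<Rightarrow> nat \<Rightarrow> 'k::field mpoly \<Rightarrow> 'k lfun" where
  "box_coeffs N q f = (\<lambda>xs. if inbox N q xs then Poly_Mapping.lookup f (Poly_Mapping.nth xs) else 0)"

definition flip_box :: "nat \<Rightarrow> nat \<Rightarrow> 'k::field lfun \<Rightarrow> 'k lfun" where
  "flip_box N q v = (\<lambda>xs. if inbox N q xs then v (mirror q xs) else 0)"

lemma boxfun_replicate: "v \<in> boxfun (replicate N (q, e)) \<longleftrightarrow> (\<forall>xs. \<not> inbox N q xs \<longrightarrow> v xs = 0)"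
proof -
  have "list_all2 (\<lambda>a x. x < fst a) (replicate N (q, e)) xs \<longleftrightarrow> inbox N q xs" for xs
    by (auto simp: list_all2_conv_all_nth inbox_def set_conv_nth)
  then show ?thesis by (simp add: boxfun_def)
qed

lemma finite_inbox: "finite {xs. inbox N q xs}"
proof -
  have "{xs. inbox N q xs} = {xs. set xs \<subseteq> {..<q} \<and> length xs = N}" by (auto simp: inbox_def)
  then show ?thesis by (simp add: finite_lists_length_eq)
qed

lemma flinear_flip_box: "flinear (flip_box N q)"
  by (rule flinearI) (simp_all add: flip_box_def fun_app)

lemma flip_box_boxfun: "flip_box N q v \<in> boxfun (replicate N (q, e))"
  by (simp add: boxfun_replicate flip_box_def)

lemma flip_box_flip_box: "v \<in> boxfun (replicate N (q, e)) \<Longrightarrow> flip_box N q (flip_box N q v) = v"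
proof (rule ext)
  fix xs assume v: "v \<in> boxfun (replicate N (q, e))"
  show "flip_box N q (flip_box N q v) xs = v xs"
  proof (cases "inbox N q xs")
    case True
    then show ?thesis using inbox_mirror[OF True] mirror_mirror[OF True] by (simp add: flip_box_def)
  qed (use v in \<open>simp add: flip_box_def boxfun_replicate\<close>)
qed

lemma shift_explicit:
  "length xs = length L \<Longrightarrow> shift L v xs = (\<Sum>i<length L. v (xs[i := xs ! i + snd (L ! i)]))"
proof (induction L arbitrary: xs v)
  case (Cons a L)
  then obtain x ys where xs: "xs = x # ys" "length ys = length L" by (cases xs) auto
  have "shift (a # L) v xs = slice x (shift (a # L) v) ys" by (simp add: xs slice_def)
  also have "\<dots> = v ((x + snd a) # ys) + shift L (slice x v) ys" by (simp add: fun_app slice_def[of "x + snd a"])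
  also have "\<dots> = (\<Sum>i<length (a # L). v (xs[i := xs ! i + snd ((a # L) ! i)]))"
    unfolding Cons.IH[OF xs(2)] length_Cons sum.lessThan_Suc_shift by (simp add: xs slice_def)
  finally show ?case .
qed (simp add: shift.simps fun_app)

lemma lookup_mult_Var_square:
  fixes f :: "'k::comm_ring_1 mpoly"
  assumes "i < length xs"
  shows "Poly_Mapping.lookup (f * Var i ^ n) (Poly_Mapping.nth xs) =
    (if n \<le> xs ! i then Poly_Mapping.lookup f (Poly_Mapping.nth (xs[i := xs ! i - n])) else 0)"
proof (cases "n \<le> xs ! i")
  case True
  have "Poly_Mapping.nth xs = Poly_Mapping.nth (xs[i := xs ! i - n]) + Poly_Mapping.single i n"
  proof (rule poly_mapping_eqI)
    show "Poly_Mapping.lookup (Poly_Mapping.nth xs) k = Poly_Mapping.lookup (Poly_Mapping.nth (xs[i := xs ! i - n]) + Poly_Mapping.single i n) k" for k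
      using True assms by (auto simp: lookup_add lookup_single nth_default_def nth_list_update when_def)
  qed
  then show ?thesis using True lookup_mult_monomial(1)[of f "Poly_Mapping.single i n"] by (simp add: Var_power)
next
  case False
  have "Poly_Mapping.nth xs \<noteq> s + Poly_Mapping.single i n" for s
  proof
    assume "Poly_Mapping.nth xs = s + Poly_Mapping.single i n"
    then have "Poly_Mapping.lookup (Poly_Mapping.nth xs) i = Poly_Mapping.lookup s i + n" by (simp add: lookup_add)
    then show False using False assms by (simp add: nth_default_def)
  qed
  then show ?thesis using False lookup_mult_monomial(2)[of "Poly_Mapping.nth xs" "Poly_Mapping.single i n" f] by (simp add: Var_power)
qed

lemma box_coeffs_add: "box_coeffs N q (f + g) = box_coeffs N q f + box_coeffs N q g"
  and box_coeffs_diff: "box_coeffs N q (f - g) = box_coeffs N q f - box_coeffs N q g"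
  and box_coeffs_0: "box_coeffs N q 0 = 0"
  and box_coeffs_Const: "box_coeffs N q (Const a * f) = fscale a (box_coeffs N q f)"
  by (rule ext, simp add: box_coeffs_def fun_app lookup_add lookup_minus lookup_Const_mult)+

lemma box_coeffs_sum: "box_coeffs N q (\<Sum>x\<in>A. f x) = (\<Sum>x\<in>A. box_coeffs N q (f x))"
  by (induction A rule: infinite_finite_induct) (simp_all add: box_coeffs_0 box_coeffs_add)

lemma box_coeffs_boxfun: "box_coeffs N q f \<in> boxfun (replicate N (q, e))"
  by (simp add: boxfun_replicate box_coeffs_def)

definition sum_squares :: "nat \<Rightarrow> 'k::comm_ring_1 mpoly" where
  "sum_squares N = (\<Sum>i<N. Var i ^ 2)"

lemma sum_squares_in: "sum_squares N \<in> polys_in N"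
  unfolding sum_squares_def by (intro polys_in_sum polys_in_Var_power) simp

text \<open>Raising an exponent by 2 is a down-shift in complementary exponents. An exponent below
  2, which no product with x_i^2 can have, corresponds to a shifted point outside the box.\<close>

lemma box_coeffs_sum_squares: "box_coeffs N q (f * sum_squares N) = flip_box N q (shift (replicate N (q, 2)) (flip_box N q (box_coeffs N q f)))"
proof (rule ext)
  fix xs
  show "box_coeffs N q (f * sum_squares N) xs = flip_box N q (shift (replicate N (q, 2)) (flip_box N q (box_coeffs N q f))) xs"
  proof (cases "inbox N q xs")
    case True
    let ?ys = "mirror q xs"
    have len: "length xs = N" using True by (simp add: inbox_def)
    have "box_coeffs N q (f * sum_squares N) xs = (\<Sum>i<N. if 2 \<le> xs ! i then Poly_Mapping.lookup f (Poly_Mapping.nth (xs[i := xs ! i - 2])) else 0)"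
      using True by (simp add: box_coeffs_def sum_squares_def sum_distrib_left lookup_sum lookup_mult_Var_square len)
    also have "\<dots> = (\<Sum>i<N. flip_box N q (box_coeffs N q f) (?ys[i := ?ys ! i + 2]))"
    proof (rule sum.cong)
      fix i assume i: "i \<in> {..<N}"
      have xj: "xs ! j < q" if "j < N" for j using True that by (simp add: inbox_nth)
      have xi: "xs ! i < q" using xj i by simp
      have yi: "?ys ! i = q - 1 - xs ! i" using i len by (simp add: nth_mirror)
      show "(if 2 \<le> xs ! i then Poly_Mapping.lookup f (Poly_Mapping.nth (xs[i := xs ! i - 2])) else 0) =
         flip_box N q (box_coeffs N q f) (?ys[i := ?ys ! i + 2])"
      proof (cases "2 \<le> xs ! i")
        case t: True
        have b: "inbox N q (?ys[i := ?ys ! i + 2])" "inbox N q (xs[i := xs ! i - 2])"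
          using inbox_mirror[OF True] True t xi i yi unfolding inbox_nth by (auto simp: nth_list_update)
        have "mirror q (?ys[i := ?ys ! i + 2]) = xs[i := xs ! i - 2]"
        proof (rule nth_equalityI)
          fix j assume "j < length (mirror q (?ys[i := ?ys ! i + 2]))"
          then have j: "j < N" using len by simp
          show "mirror q (?ys[i := ?ys ! i + 2]) ! j = xs[i := xs ! i - 2] ! j"
          proof (cases "j = i")
            case True
            then show ?thesis using j len t xi yi by (simp add: nth_mirror)
          next
            case False
            then show ?thesis using j len xj[OF j] by (simp add: nth_mirror)
          qed
        qed simp
        then show ?thesis using b t by (simp add: flip_box_def box_coeffs_def)
      next
        case f: False
        have "?ys[i := ?ys ! i + 2] ! i = ?ys ! i + 2" using i len by simp
        then have "\<not> inbox N q (?ys[i := ?ys ! i + 2])"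
          using f xi yi i len unfolding inbox_nth by (auto intro!: exI[of _ i])
        then show ?thesis using f by (simp add: flip_box_def)
      qed
    qed simp
    also have "\<dots> = shift (replicate N (q, 2)) (flip_box N q (box_coeffs N q f)) ?ys"
      using len by (simp add: shift_explicit)
    finally show ?thesis using True by (simp add: flip_box_def)
  qed (simp add: box_coeffs_def flip_box_def)
qed

definition box_poly :: "nat \<Rightarrow> nat \<Rightarrow> 'k::field lfun \<Rightarrow> 'k mpoly" where
  "box_poly N q v = (\<Sum>xs\<in>{xs. inbox N q xs}. Poly_Mapping.single (Poly_Mapping.nth xs) (v xs))"

lemma box_poly_in: "box_poly N q v \<in> polys_in N"
  unfolding box_poly_def
proof (intro polys_in_sum polys_in_single)
  fix xs i assume "xs \<in> {xs. inbox N q xs}" "i \<in> Poly_Mapping.keys (Poly_Mapping.nth xs)"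
  then show "i < N" by (auto simp: in_keys_iff nth_default_def inbox_def simp del: keys_nth split: if_splits)
qed

lemma nth_inj: "length xs = length ys \<Longrightarrow> Poly_Mapping.nth xs = Poly_Mapping.nth ys \<longleftrightarrow> xs = (ys :: nat list)"
proof
  assume l: "length xs = length ys" and e: "Poly_Mapping.nth xs = Poly_Mapping.nth ys"
  show "xs = ys"
  proof (rule nth_equalityI[OF l])
    fix i assume "i < length xs"
    then show "xs ! i = ys ! i"
      using arg_cong[OF e, of "\<lambda>m. Poly_Mapping.lookup m i"] l by (simp add: nth_default_def)
  qed
qed simp

lemma box_coeffs_box_poly: "v \<in> boxfun (replicate N (q, e)) \<Longrightarrow> box_coeffs N q (box_poly N q v) = v"
proof (rule ext)
  fix xs assume v: "v \<in> boxfun (replicate N (q, e))"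
  show "box_coeffs N q (box_poly N q v) xs = v xs"
  proof (cases "inbox N q xs")
    case True
    have "box_coeffs N q (box_poly N q v) xs = (\<Sum>ys\<in>{xs. inbox N q xs}. if ys = xs then v ys else 0)"
      unfolding box_coeffs_def box_poly_def lookup_sum if_P[OF True]
    proof (rule sum.cong)
      fix ys assume "ys \<in> {xs. inbox N q xs}"
      then have "length ys = length xs" using True by (simp add: inbox_def)
      then show "Poly_Mapping.lookup (Poly_Mapping.single (Poly_Mapping.nth ys) (v ys)) (Poly_Mapping.nth xs) = (if ys = xs then v ys else 0)"
        using nth_inj[of ys xs] by (simp add: lookup_single when_def)
    qed simp
    also have "\<dots> = v xs" using True finite_inbox by simp
    finally show ?thesis .
  qed (use v in \<open>simp add: box_coeffs_def boxfun_replicate\<close>)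
qed

lemma sum_fun_app: "(\<Sum>i\<in>A. f i) x = (\<Sum>i\<in>A. f i x)"
  by (induction A rule: infinite_finite_induct) (simp_all add: fun_app)

lemma CHAR_mpoly: "CHAR('k::comm_ring_1 mpoly) = CHAR('k)"
proof (rule CHAR_eqI)
  have e: "of_nat n = (0 :: 'k mpoly) \<longleftrightarrow> of_nat n = (0 :: 'k)" for n
  proof -
    have *: "(of_nat n :: 'k mpoly) = Poly_Mapping.single 0 (of_nat n)" by simp
    show ?thesis
    proof
      assume "of_nat n = (0 :: 'k mpoly)"
      then have "Poly_Mapping.lookup (of_nat n :: 'k mpoly) 0 = 0" by simp
      then show "of_nat n = (0 :: 'k)" by (simp add: lookup_of_nat)
    qed (simp add: *)
  qed
  show "of_nat CHAR('k) = (0 :: 'k mpoly)" unfolding e by (rule of_nat_CHAR)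
  show "CHAR('k) dvd x" if "of_nat x = (0 :: 'k mpoly)" for x
    using that unfolding e of_nat_eq_0_iff_char_dvd .
qed

lemma box_coeffs_Var_power: "i < N \<Longrightarrow> box_coeffs N q (f * Var i ^ q) = 0"
proof (rule ext)
  fix xs assume i: "i < N"
  show "box_coeffs N q (f * Var i ^ q) xs = 0 xs"
  proof (cases "inbox N q xs")
    case True
    then have "\<not> q \<le> xs ! i" "i < length xs" using i by (auto simp: inbox_nth not_le)
    then show ?thesis by (simp add: box_coeffs_def fun_app lookup_mult_Var_square)
  qed (simp add: box_coeffs_def fun_app)
qed

definition frob_ideal :: "nat \<Rightarrow> nat \<Rightarrow> 'k::field mpoly set" where
  "frob_ideal N q = ideal_gen N ({sum_squares N} \<union> {g ^ q | g. g \<in> max_ideal N})"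

text \<open>Multiplication by the sum of squares is the double down-shift conjugated by the reflection of the box.\<close>

definition quadric_image :: "nat \<Rightarrow> nat \<Rightarrow> 'k::field lfun set" where
  "quadric_image N q = (\<lambda>v. flip_box N q (shift (replicate N (q, 2)) v)) ` boxfun (replicate N (q, 2))"

lemma flinear_flip_box_shift: "flinear (\<lambda>v. flip_box N q (shift L v))"
  by (rule flinear_compose[OF flinear_flip_box flinear_shift])

lemma subspace_quadric_image: "fv.subspace (quadric_image N q)"
  unfolding quadric_image_def by (rule fvp.linear_subspace_image[OF flinear_linear[OF flinear_flip_box_shift] subspace_boxfun])

lemma quadric_image_boxfun: "quadric_image N q \<subseteq> boxfun (replicate N (q, 2))"
  unfolding quadric_image_def by (auto intro: flip_box_boxfun)

lemma box_coeffs_frob_ideal: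
  fixes f :: "'k::field mpoly"
  assumes p: "prime p" "CHAR('k) = p" and q: "q = p ^ s" and f: "f \<in> frob_ideal N q"
  shows "box_coeffs N q f \<in> quadric_image N q"
proof -
  obtain r :: nat and c g where f: "f = (\<Sum>j<r. c j * g j)"
    and g: "\<forall>j<r. c j \<in> polys_in N \<and> g j \<in> {sum_squares N} \<union> {g ^ q | g. g \<in> max_ideal N}"
    by (rule ideal_genE[OF f[unfolded frob_ideal_def]])
  have "box_coeffs N q (c j * g j) \<in> quadric_image N q" if j: "j < r" for j
  proof -
    have "g j = sum_squares N \<or> (\<exists>h. g j = h ^ q \<and> h \<in> max_ideal N)" using g j by blast
    then show ?thesis
    proof
      assume "g j = sum_squares N"
      then show ?thesis unfolding quadric_image_def by (simp only: box_coeffs_sum_squares) (rule imageI[OF flip_box_boxfun])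
    next
      assume "\<exists>h. g j = h ^ q \<and> h \<in> max_ideal N"
      then obtain h where h: "g j = h ^ q" "h \<in> max_ideal N" by blast
      obtain r' :: nat and c' v where hs: "h = (\<Sum>j<r'. c' j * v j)" "\<forall>j<r'. c' j \<in> polys_in N \<and> v j \<in> {Var i | i. i < N}"
        by (rule ideal_genE[OF h(2)[unfolded max_ideal_def]])
      \<comment> \<open>As \<open>q\<close> is a power of the characteristic, the
        \<open>q\<close>-th power of an element of the ideal is a combination of the
        \<open>q\<close>-th powers of the variables.\<close>
      have "h ^ q = (\<Sum>j<r'. (c' j * v j) ^ q)"
        unfolding hs(1) by (rule freshmans_dream_sum'[of _ s]) (simp_all add: CHAR_mpoly p q)
      then have "c j * g j = (\<Sum>i<r'. (c j * c' i ^ q) * v i ^ q)"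
        unfolding h(1) by (simp add: sum_distrib_left power_mult_distrib mult.assoc)
      moreover have "box_coeffs N q ((c j * c' i ^ q) * v i ^ q) = 0" if "i < r'" for i
      proof -
        obtain l where "v i = Var l" "l < N" using hs(2) \<open>i < r'\<close> by blast
        then show ?thesis using box_coeffs_Var_power by simp
      qed
      ultimately have "box_coeffs N q (c j * g j) = 0" by (simp add: box_coeffs_sum)
      then show ?thesis using fv.subspace_0[OF subspace_quadric_image] by simp
    qed
  qed
  then show ?thesis unfolding f box_coeffs_sum by (intro fv.subspace_sum[OF subspace_quadric_image]) simp
qed

text \<open>A monomial outside the box is divisible by some x_i^q.\<close>

lemma frob_ideal_box_coeffs_0:
  fixes f :: "'k::field mpoly"
  assumes f: "f \<in> polys_in N" "box_coeffs N q f = 0"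
  shows "f \<in> frob_ideal N q"
proof -
  have "Poly_Mapping.single m (Poly_Mapping.lookup f m) \<in> frob_ideal N q" if m: "m \<in> Poly_Mapping.keys f" for m
  proof -
    have mN: "i < N" if "i \<in> Poly_Mapping.keys m" for i using f(1) m that unfolding polys_in_def by blast
    have "\<exists>i<N. q \<le> Poly_Mapping.lookup m i"
    proof (rule ccontr)
      assume *: "\<not> (\<exists>i<N. q \<le> Poly_Mapping.lookup m i)"
      let ?xs = "map (Poly_Mapping.lookup m) [0..<N]"
      have "inbox N q ?xs" using * by (auto simp: inbox_nth not_le)
      moreover have "Poly_Mapping.nth ?xs = m"
      proof (rule poly_mapping_eqI)
        show "Poly_Mapping.lookup (Poly_Mapping.nth ?xs) k = Poly_Mapping.lookup m k" for k
          using mN[of k] by (auto simp: nth_default_def in_keys_iff)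
      qed
      ultimately have "box_coeffs N q f ?xs = Poly_Mapping.lookup f m" by (simp add: box_coeffs_def)
      then show False using m f(2) by (simp add: in_keys_iff fun_app)
    qed
    then obtain i where i: "i < N" "q \<le> Poly_Mapping.lookup m i" by blast
    define m' where "m' = m - Poly_Mapping.single i q"
    have mm: "m = m' + Poly_Mapping.single i q"
      unfolding m'_def
    proof (rule poly_mapping_eqI)
      show "Poly_Mapping.lookup m k = Poly_Mapping.lookup (m - Poly_Mapping.single i q + Poly_Mapping.single i q) k" for k
        using i(2) by (cases "k = i") (simp_all add: lookup_add lookup_minus lookup_single)
    qed
    have "Poly_Mapping.single m (Poly_Mapping.lookup f m) = Poly_Mapping.single m' (Poly_Mapping.lookup f m) * Var i ^ q"
      unfolding Var_power mult_single by (simp flip: mm)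
    moreover have "Poly_Mapping.single m' (Poly_Mapping.lookup f m) \<in> polys_in N"
    proof (rule polys_in_single)
      fix k assume "k \<in> Poly_Mapping.keys m'"
      then have "Poly_Mapping.lookup m' k \<noteq> 0" by (simp add: in_keys_iff)
      then have "Poly_Mapping.lookup m k \<noteq> 0" using arg_cong[OF mm, of "\<lambda>m. Poly_Mapping.lookup m k"] by (simp add: lookup_add)
      then show "k < N" by (intro mN) (simp add: in_keys_iff)
    qed
    moreover have "(Var i :: 'k mpoly) \<in> max_ideal N"
      using ideal_gen_base[OF polys_in_Const[of 1 N], of "Var i :: 'k mpoly" "{Var i | i. i < N}"] i(1)
      by (auto simp: max_ideal_def Const_def)
    ultimately show ?thesis
    proof -
      assume *: "Poly_Mapping.single m (Poly_Mapping.lookup f m) = Poly_Mapping.single m' (Poly_Mapping.lookup f m) * Var i ^ q"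
        "Poly_Mapping.single m' (Poly_Mapping.lookup f m) \<in> polys_in N" "(Var i :: 'k mpoly) \<in> max_ideal N"
      show ?thesis unfolding frob_ideal_def *(1) using *(3) by (intro ideal_gen_base *(2)) blast
    qed
  qed
  moreover have "f = (\<Sum>m\<in>Poly_Mapping.keys f. Poly_Mapping.single m (Poly_Mapping.lookup f m))"
  proof (rule poly_mapping_eqI)
    show "Poly_Mapping.lookup f k = Poly_Mapping.lookup (\<Sum>m\<in>Poly_Mapping.keys f. Poly_Mapping.single m (Poly_Mapping.lookup f m)) k" for k
      by (simp add: lookup_sum lookup_single when_def sum.delta in_keys_iff)
  qed
  moreover have "(\<Sum>m\<in>Poly_Mapping.keys f. Poly_Mapping.single m (Poly_Mapping.lookup f m)) \<in> frob_ideal N q"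
    using calculation(1) unfolding frob_ideal_def by (rule ideal_gen_sum)
  ultimately show ?thesis by (simp only:)
qed

text \<open>For the converse, a preimage is lifted to a polynomial multiple of the sum of squares;
  the difference to \<open>f\<close> has no coefficients in the box.\<close>

lemma frob_ideal_iff:
  fixes f :: "'k::field mpoly"
  assumes p: "prime p" "CHAR('k) = p" and q: "q = p ^ s" and f: "f \<in> polys_in N"
  shows "f \<in> frob_ideal N q \<longleftrightarrow> box_coeffs N q f \<in> quadric_image N q"
proof
  assume "box_coeffs N q f \<in> quadric_image N q"
  then obtain v where v: "v \<in> boxfun (replicate N (q, 2))" "box_coeffs N q f = flip_box N q (shift (replicate N (q, 2)) v)"
    unfolding quadric_image_def by blast
  let ?g = "box_poly N q (flip_box N q v)"
  have "box_coeffs N q (?g * sum_squares N) = box_coeffs N q f"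
    unfolding box_coeffs_sum_squares v(2) using box_coeffs_box_poly[OF flip_box_boxfun[of N q v 2]] flip_box_flip_box[OF v(1)] by simp
  then have "f - ?g * sum_squares N \<in> frob_ideal N q"
    by (intro frob_ideal_box_coeffs_0 polys_in_diff polys_in_mult f box_poly_in sum_squares_in) (simp add: box_coeffs_diff)
  moreover have "?g * sum_squares N \<in> frob_ideal N q" unfolding frob_ideal_def by (rule ideal_gen_base[OF box_poly_in]) simp
  ultimately show "f \<in> frob_ideal N q" unfolding frob_ideal_def using ideal_gen_add[of "f - ?g * sum_squares N" N _ "?g * sum_squares N"] by simp
qed (rule box_coeffs_frob_ideal[OF p q])

lemma vdim_quadric_image: "vdim (quadric_image N q :: 'k::field lfun set) + snull (K :: 'k itself) (replicate N (q, 2)) = vdim (boxfun (replicate N (q, 2)) :: 'k lfun set)"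
proof -
  let ?L = "replicate N (q, 2)"
  have "{v \<in> boxfun ?L. flip_box N q (shift ?L v) = 0} = {v :: 'k lfun. v \<in> boxfun ?L \<and> shift ?L v = 0}"
  proof (intro Collect_cong conj_cong refl)
    fix v :: "'k lfun" assume "v \<in> boxfun ?L"
    then have "flip_box N q (flip_box N q (shift ?L v)) = shift ?L v" by (intro flip_box_flip_box[of _ N q 2] shift_boxfun)
    then show "flip_box N q (shift ?L v) = 0 \<longleftrightarrow> shift ?L v = 0" using flinear_0[OF flinear_flip_box] by metis
  qed
  then show ?thesis
    using rank_nullity[of "boxfun ?L :: 'k lfun set", OF subspace_boxfun fdim_boxfun flinear_flip_box_shift, of N q ?L] unfolding quadric_image_def snull_def by simp
qed

text \<open>The quotient is the cokernel of an endomorphism of the functions on the box, so its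
  dimension is the nullity. As \<open>quot_dim\<close> is a supremum over independent sets, both a
  bound and a set that attains it are needed.\<close>

lemma quot_dim_frob_ideal:
  assumes p: "prime p" "CHAR('k::field) = p" and q: "q = p ^ s"
  shows "quot_dim N (frob_ideal N q :: 'k mpoly set) = snull TYPE('k) (replicate N (q, 2))"
proof -
  let ?L = "replicate N (q, 2 :: nat)"
  define P where "P S \<longleftrightarrow> finite S \<and> S \<subseteq> polys_in N \<and>
      (\<forall>c :: 'k mpoly \<Rightarrow> 'k. (\<Sum>s\<in>S. Const (c s) * s) \<in> frob_ideal N q \<longrightarrow> (\<forall>s\<in>S. c s = 0))" for S
  have comb: "(\<Sum>s\<in>S. Const (c s) * s) \<in> frob_ideal N q \<longleftrightarrow> (\<Sum>s\<in>S. fscale (c s) (box_coeffs N q s)) \<in> quadric_image N q"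
    if "S \<subseteq> polys_in N" for S and c :: "'k mpoly \<Rightarrow> 'k"
  proof -
    have "(\<Sum>s\<in>S. Const (c s) * s) \<in> polys_in N"
      using that by (intro polys_in_sum polys_in_mult polys_in_Const) auto
    then show ?thesis using frob_ideal_iff[OF p q] by (simp add: box_coeffs_sum box_coeffs_Const)
  qed
  have upper: "card S \<le> snull TYPE('k) ?L" if S: "P S" for S
  proof -
    define n where "n = card S"
    obtain e where e: "bij_betw e {..<n} S"
      using ex_bij_betw_nat_finite[of S] S by (auto simp: P_def n_def atLeast0LessThan)
    \<comment> \<open>Linear combinations of \<open>S\<close> are encoded as functions supported on
      the singleton lists, since \<open>vdim_quot_inj\<close> works with functions on one index
      type.\<close>
    define B where "B = (\<lambda>i. [i]) ` {..<n}"
    have B: "finite B" "card B = n" unfolding B_def by (auto simp: card_image inj_on_def)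
    define Kf where "Kf = {v :: 'k lfun. \<forall>x. x \<notin> B \<longrightarrow> v x = 0}"
    define F where "F v = (\<Sum>i<n. fscale (v [i]) (box_coeffs N q (e i)))" for v :: "'k lfun"
    have F: "flinear F"
      by (rule flinearI) (simp_all add: F_def fun_app sum_fun_app sum.distrib sum_distrib_left algebra_simps)
    have sub: "fv.subspace Kf" unfolding Kf_def fv.subspace_def by (auto simp: fun_app)
    have "vdim Kf + vdim (quadric_image N q :: 'k lfun set) \<le> vdim {v \<in> Kf. F v \<in> quadric_image N q} + vdim (boxfun ?L :: 'k lfun set)"
    proof (rule vdim_quot_inj)
      show "fv.subspace Kf" by (rule sub)
      show "fdim Kf" unfolding Kf_def by (rule vdim_supported(1)[OF B(1)])
      show "F ` Kf \<subseteq> boxfun ?L"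
        unfolding F_def by (auto intro!: fv.subspace_sum[OF subspace_boxfun] fv.subspace_scale[OF subspace_boxfun] box_coeffs_boxfun)
    qed (rule subspace_boxfun fdim_boxfun F subspace_quadric_image quadric_image_boxfun)+
    moreover have "{v \<in> Kf. F v \<in> quadric_image N q} = {0}"
    proof (intro equalityI subsetI)
      fix v assume v: "v \<in> {v \<in> Kf. F v \<in> quadric_image N q}"
      define c where "c x = v [inv_into {..<n} e x]" for x
      have ce: "c (e i) = v [i]" if "i < n" for i
        using that e unfolding c_def bij_betw_def by (simp add: inv_into_f_f)
      have "F v = (\<Sum>i<n. fscale (c (e i)) (box_coeffs N q (e i)))" unfolding F_def by (rule sum.cong) (simp_all add: ce)
      also have "\<dots> = (\<Sum>x\<in>S. fscale (c x) (box_coeffs N q x))" by (rule sum.reindex_bij_betw[OF e])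
      finally have "(\<Sum>s\<in>S. Const (c s) * s) \<in> frob_ideal N q" using comb[of S c] S v by (simp add: P_def)
      then have "\<forall>x\<in>S. c x = 0" using S unfolding P_def by blast
      then have "v [i] = 0" if "i < n" for i using ce[OF that] e that unfolding bij_betw_def by (metis image_eqI lessThan_iff)
      then have "v x = 0" for x using v by (cases "x \<in> B") (auto simp: Kf_def B_def)
      then show "v \<in> {0}" by (auto simp: fun_eq_iff fun_app)
    next
      fix v :: "'k lfun" assume "v \<in> {0}"
      then show "v \<in> {v \<in> Kf. F v \<in> quadric_image N q}"
        using fv.subspace_0[OF sub] fv.subspace_0[OF subspace_quadric_image] flinear_0[OF F] by simp
    qed
    moreover have "vdim Kf = n" unfolding Kf_def using vdim_supported(2)[OF B(1)] B(2) by simp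
    ultimately show ?thesis using vdim_quadric_image[of N q "TYPE('k)"] by (simp add: n_def vdim_singleton_0)
  qed
  obtain T where T: "finite T" "T \<subseteq> quadric_image N q" "fv.independent T" "(quadric_image N q :: 'k lfun set) \<subseteq> fv.span T" "card T = vdim (quadric_image N q :: 'k lfun set)"
    using fdim_basis[OF fdim_subset[OF fdim_boxfun quadric_image_boxfun]] by metis
  obtain B where B: "T \<subseteq> B" "B \<subseteq> boxfun ?L" "fv.independent B" "(boxfun ?L :: 'k lfun set) \<subseteq> fv.span B"
    using fv.maximal_independent_subset_extend[of T "boxfun ?L"] T(2,3) quadric_image_boxfun by blast
  have cB: "card B = vdim (boxfun ?L :: 'k lfun set)" using B fv.basis_card_eq_dim by blast
  have fB: "finite B"
  proof -
    obtain C where "finite C" "(boxfun ?L :: 'k lfun set) \<subseteq> fv.span C" using fdim_boxfun unfolding fdim_def by blast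
    then show ?thesis using fv.independent_span_bound[of C B] B by blast
  qed
  \<comment> \<open>\<open>B\<close> extends a basis \<open>T\<close> of the image to a basis of all
    functions on the box, so the added vectors are independent modulo the image.\<close>
  define S where "S = box_poly N q ` (B - T)"
  have tp: "box_coeffs N q (box_poly N q b) = b" if "b \<in> B" for b using box_coeffs_box_poly[of b N q 2] that B(2) by blast
  have inj: "inj_on (box_poly N q) (B - T)" by (rule inj_on_inverseI[of _ "box_coeffs N q"]) (use tp in blast)
  have "card S = snull TYPE('k) ?L"
    unfolding S_def card_image[OF inj] using B(1) T(1,5) fB cB vdim_quadric_image[of N q "TYPE('k)"] by (simp add: card_Diff_subset)
  moreover have "P S"
    unfolding P_def
  proof (intro conjI allI impI)
    show "finite S" "S \<subseteq> polys_in N" using fB box_poly_in by (auto simp: S_def)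
    fix c :: "'k mpoly \<Rightarrow> 'k" assume "(\<Sum>s\<in>S. Const (c s) * s) \<in> frob_ideal N q"
    then have "(\<Sum>s\<in>S. fscale (c s) (box_coeffs N q s)) \<in> quadric_image N q" using comb \<open>S \<subseteq> polys_in N\<close> by blast
    also have "(\<Sum>s\<in>S. fscale (c s) (box_coeffs N q s)) = (\<Sum>b\<in>B - T. fscale (c (box_poly N q b)) b)"
      unfolding S_def sum.reindex[OF inj] by (rule sum.cong) (simp_all add: tp)
    finally have "(\<Sum>b\<in>B - T. fscale (c (box_poly N q b)) b) \<in> fv.span T" using T(4) by blast
    then obtain u where u: "(\<Sum>b\<in>B - T. fscale (c (box_poly N q b)) b) = (\<Sum>b\<in>T. fscale (u b) b)"
      unfolding fv.span_finite[OF T(1)] by blast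
    define w where "w b = (if b \<in> T then - u b else c (box_poly N q b))" for b
    have "(\<Sum>b\<in>B. fscale (w b) b) = (\<Sum>b\<in>B - T. fscale (w b) b) + (\<Sum>b\<in>T. fscale (w b) b)"
      using sum.subset_diff[OF B(1) fB] .
    also have "(\<Sum>b\<in>B - T. fscale (w b) b) = (\<Sum>b\<in>B - T. fscale (c (box_poly N q b)) b)"
      by (rule sum.cong) (simp_all add: w_def)
    also have "(\<Sum>b\<in>T. fscale (w b) b) = - (\<Sum>b\<in>T. fscale (u b) b)"
      unfolding sum_negf[symmetric] by (rule sum.cong) (simp_all add: w_def fv.scale_minus_left)
    also have "(\<Sum>b\<in>B - T. fscale (c (box_poly N q b)) b) + - (\<Sum>b\<in>T. fscale (u b) b) = 0" unfolding u by (rule right_minus)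
    finally have "(\<Sum>b\<in>B. fscale (w b) b) = 0" .
    then have "w b = 0" if "b \<in> B" for b using fv.independentD[OF B(3) fB order_refl] that by blast
    then have "c (box_poly N q b) = 0" if "b \<in> B - T" for b using that unfolding w_def by (metis DiffD1 DiffD2)
    then show "\<forall>s\<in>S. c s = 0" unfolding S_def by blast
  qed
  ultimately have "snull TYPE('k) ?L \<in> {card S | S. P S}" by (metis (mono_tags, lifting) mem_Collect_eq)
  moreover have "x \<le> snull TYPE('k) ?L" if "x \<in> {card S | S. P S}" for x using that upper by blast
  ultimately have "Sup {card S | S. P S} = snull TYPE('k) ?L" by (intro cSup_eq_maximum)
  then show ?thesis unfolding quot_dim_def P_def .
qed

section \<open>The Hilbert--Kunz limit\<close>

lemma half_wave_nonneg: "half_wave c n k \<ge> 0"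
  by (induction n arbitrary: k) (simp_all add: sum_nonneg)

text \<open>A side \<open>2 * b + 1\<close> of step width 2 has \<open>b + 1\<close> even and
  \<open>b\<close> odd positions.\<close>

lemma slot_sum_snull: "real (snull K (replicate m (2 * b + 1, 2) @ L)) = slot_sum 1 K m b L"
proof (induction m arbitrary: L)
  case (Suc m)
  let ?M = "replicate m (2 * b + 1, 2 :: nat)"
  have "snull K (replicate (Suc m) (2 * b + 1, 2) @ L) = snull K ((b + 1, 1) # ?M @ L) + snull K ((b, 1) # ?M @ L)"
  proof -
    have "{..<2 :: nat} = {0, 1}" by auto
    moreover have "(2 * b + 1 + 2 - 1 - 0) div 2 = b + 1" "(2 * b + 1 + 2 - 1 - 1) div 2 = b" by simp_all
    ultimately show ?thesis using snull_split[of 2 K "2 * b + 1" "?M @ L"] by simp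
  qed
  moreover have "snull K (x # ?M @ L) = snull K (?M @ x # L)" for x by (rule snull_perm) simp
  ultimately show ?case using Suc by simp
qed simp

lemma snull_size_0: "(0, e) \<in> set L \<Longrightarrow> snull (K :: 'k::field itself) L = 0"
proof -
  assume "(0, e) \<in> set L"
  then have "snull K L = snull K ((0, e) # remove1 (0, e) L)" by (intro snull_perm) simp
  moreover have "{v :: 'k lfun. v \<in> boxfun ((0, e) # remove1 (0, e) L) \<and> shift ((0, e) # remove1 (0, e) L) v = 0} = {0}"
  proof (intro equalityI subsetI)
    fix v :: "'k lfun" assume "v \<in> {v. v \<in> boxfun ((0, e) # remove1 (0, e) L) \<and> shift ((0, e) # remove1 (0, e) L) v = 0}"
    then have v: "v [] = 0" "\<And>x. slice x v = 0" by (auto simp: boxfun_Cons)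
    have "v = 0" by (rule lfun_eqI) (simp_all add: v slice_lin)
    then show "v \<in> {0}" by simp
  qed (simp add: fv.subspace_0[OF subspace_boxfun] shift_lin)
  ultimately show ?thesis by (simp add: snull_def vdim_singleton_0)
qed

lemma snull_ones: "snull (K :: 'k::field itself) (replicate k (1, 1)) = 1"
proof (induction k)
  case 0
  have "{v :: 'k lfun. v \<in> boxfun [] \<and> shift [] v = 0} = {v. \<forall>x. x \<notin> {[]} \<longrightarrow> v x = 0}"
    by (auto simp: shift.simps boxfun_def list_all2_Nil)
  then show ?case using vdim_supported(2)[of "{[] :: nat list}"] by (simp add: snull_def)
next
  case (Suc k)
  have "snull K ((1, 1) # replicate k (1, 1)) = snull K (replicate k (1, 1))"
    unfolding snull_power by (simp add: snull_def)
  then show ?case using Suc by simp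
qed

text \<open>A side of length 0 makes the nullity 0, so only the choice of length 1 in every slot
  survives.\<close>

lemma slot_sum_0: "slot_sum s K m 0 (replicate k (1, 1)) = 1"
proof (induction m arbitrary: k)
  case (Suc m)
  have z: "(0, 1) \<in> set L \<Longrightarrow> slot_sum s K m 0 L = 0" for m L
    by (induction m arbitrary: L) (simp_all add: snull_size_0)
  show ?case using Suc[of "Suc k"] z[of "(0, 1) # replicate k (1, 1)" m] by simp
qed (simp add: snull_ones[unfolded One_nat_def])

text \<open>After division by \<open>P ^ s\<close> the recursion adds the terms
  \<open>\<nu> s * X / P ^ Suc s\<close>, which lie between those of geometric series with ratios
  \<open>T / P\<close> and \<open>1 / p\<close>. Being nonnegative, they make the sequence
  increasing, so the limit exists and \<open>lim\<close> is meaningful.\<close>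

lemma limit_bounds:
  fixes D S \<nu> :: "nat \<Rightarrow> real"
  assumes D: "D 0 = 1" "\<And>s. D (Suc s) = P * D s + \<nu> s * X"
    and S: "S 0 = 1" "\<And>s. S (Suc s) = T * S s" "\<And>s. S s \<le> \<nu> s" "\<And>s. \<nu> s \<le> (P / p) ^ s"
    and p: "p > 1" and P: "P > 0" and T: "0 \<le> T" "T < P" and X: "X \<ge> 0"
  shows "1 + X / (P - T) \<le> lim (\<lambda>s. D s / P ^ s)" "lim (\<lambda>s. D s / P ^ s) \<le> 1 + X / P * (p / (p - 1))"
proof -
  define x where "x s = D s / P ^ s" for s
  have xs: "x (Suc s) = x s + \<nu> s * X / P ^ Suc s" for s
    using P by (simp add: x_def D(2) field_simps)
  have ST: "S s = T ^ s" for s by (induction s) (simp_all add: S)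
  have lo: "x s \<ge> 1 + X / P * (\<Sum>t<s. (T / P) ^ t)" for s
  proof (induction s)
    case (Suc s)
    have "T ^ s * X / P ^ Suc s \<le> \<nu> s * X / P ^ Suc s"
      using S(3)[of s] X P unfolding ST by (intro divide_right_mono mult_right_mono) auto
    moreover have "X / P * (T / P) ^ s = T ^ s * X / P ^ Suc s" by (simp add: power_divide field_simps)
    ultimately show ?case using Suc xs[of s] by (simp add: algebra_simps)
  qed (simp add: x_def D)
  have up: "x s \<le> 1 + X / P * (\<Sum>t<s. (1 / p) ^ t)" for s
  proof (induction s)
    case (Suc s)
    have "\<nu> s * X / P ^ Suc s \<le> (P / p) ^ s * X / P ^ Suc s"
      using S(4)[of s] X P by (intro divide_right_mono mult_right_mono) auto
    moreover have "X / P * (1 / p) ^ s = (P / p) ^ s * X / P ^ Suc s" using P p by (simp add: power_divide field_simps)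
    ultimately show ?case using Suc xs[of s] by (simp add: algebra_simps)
  qed (simp add: x_def D)
  have gs: "(\<lambda>s. 1 + X / P * (\<Sum>t<s. y ^ t)) \<longlonglongrightarrow> 1 + X / P * (1 / (1 - y))" if "0 \<le> y" "y < 1" for y :: real
    using that geometric_sums[of y] by (intro tendsto_intros) (simp add: sums_def)
  have up': "x s \<le> 1 + X / P * (1 / (1 - 1 / p))" for s
  proof -
    have "(\<Sum>t<s. (1 / p) ^ t) \<le> suminf (\<lambda>t. (1 / p) ^ t)"
      using p by (intro sum_le_suminf summable_geometric) auto
    then have "X / P * (\<Sum>t<s. (1 / p) ^ t) \<le> X / P * (1 / (1 - 1 / p))"
      using suminf_geometric[of "1 / p"] p X P by (intro mult_left_mono) auto
    then show ?thesis using up[of s] by simp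
  qed
  have "incseq x"
  proof (rule incseq_SucI)
    have "0 \<le> S s" for s using ST T(1) by simp
    then have "0 \<le> \<nu> s" for s using S(3) order_trans by blast
    then show "x s \<le> x (Suc s)" for s unfolding xs using X P by simp
  qed
  then obtain l where l: "x \<longlonglongrightarrow> l"
    using incseq_convergent[of x "1 + X / P * (1 / (1 - 1 / p))"] up' by blast
  then have ll: "lim (\<lambda>s. D s / P ^ s) = l" unfolding x_def[symmetric] by (rule limI)
  have "1 + X / P * (1 / (1 - T / P)) \<le> l"
    by (rule LIMSEQ_le[OF gs l]) (use T P lo in auto)
  moreover have "X / P * (1 / (1 - T / P)) = X / (P - T)" using P T by (simp add: field_simps)
  ultimately show "1 + X / (P - T) \<le> lim (\<lambda>s. D s / P ^ s)" by (simp only: ll)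
  have "l \<le> 1 + X / P * (1 / (1 - 1 / p))"
    by (rule LIMSEQ_le_const2[OF l]) (use up' in auto)
  moreover have "1 / (1 - 1 / p) = p / (p - 1)" using p by (simp add: field_simps)
  ultimately show "lim (\<lambda>s. D s / P ^ s) \<le> 1 + X / P * (p / (p - 1))" by (simp only: ll)
qed

theorem theorem1p1:
  fixes n p :: nat
  assumes "n \<ge> 3" and "prime p" and "odd p"
    and "even n \<Longrightarrow> p \<ge> n - 2"
    and "odd n \<Longrightarrow> p \<ge> 2 * n - 4"
    and "CHAR('k::field) = p"
    and "\<forall>a :: 'k. \<exists>b. b ^ p = a"
  shows "1 + sec_tan_coeff (n + 1) + (2 * real n - 4) / real p
           \<ge> e_HK p (n + 1) (n + 2) ((\<Sum>i<n + 2. Var i ^ 2) :: 'k mpoly) (max_ideal (n + 2))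
       \<and> e_HK p (n + 1) (n + 2) ((\<Sum>i<n + 2. Var i ^ 2) :: 'k mpoly) (max_ideal (n + 2))
           \<ge> 1 + sec_tan_coeff (n + 1)"
proof -
  interpret char_p "TYPE('k)" p using assms by unfold_locales
  obtain c where c: "p = 2 * c + 1" using \<open>odd p\<close> by (rule oddE)
  have c1: "c \<ge> 1" using p_ge_3 c by simp
  define k where "k = n - 1"
  have k: "k + 3 = n + 2" "k + 2 = n + 1" "n - 1 = k" using assms(1) by (simp_all add: k_def)
  let ?t = "\<lambda>s b. slot_sum s TYPE('k) (k + 3) b []"
  define U where "U = half_wave c (k + 2) 0"
  define T where "T = half_wave c k 0"
  \<comment> \<open>This is (p^s - 1)/2, and the recursion reflects p (2b + 1) = 2 (p b + c) +
    1.\<close>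
  define b where "b s = ((\<lambda>b. p * b + c) ^^ s) 0" for s
  have bq: "p ^ s = 2 * b s + 1" for s
  proof (induction s)
    case (Suc s)
    have "2 * b (Suc s) + 1 = p * (2 * b s + 1)" using c by (simp add: b_def)
    then show ?case using Suc by simp
  qed (simp add: b_def)
  have bS: "b (Suc s) = p * b s + c" for s by (simp add: b_def)
  have "\<exists>n0. ?t 1 (p * b' + c) = real p ^ (k + 2) * ?t 1 b' + n0 * (U - T) \<and>
      \<bar>?t (- 1) (p * b' + c)\<bar> = \<bar>T\<bar> * \<bar>?t (- 1) b'\<bar> \<and> \<bar>?t (- 1) b'\<bar> \<le> n0 \<and> n0 \<le> real (2 * b' + 1) ^ (k + 1)" for b'
    using slot_sum_recursion[OF c, of k b'] unfolding U_def T_def by metis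
  then obtain \<nu> where \<nu>: "\<And>b'. ?t 1 (p * b' + c) = real p ^ (k + 2) * ?t 1 b' + \<nu> b' * (U - T)"
      "\<And>b'. \<bar>?t (- 1) (p * b' + c)\<bar> = \<bar>T\<bar> * \<bar>?t (- 1) b'\<bar>"
      "\<And>b'. \<bar>?t (- 1) b'\<bar> \<le> \<nu> b'" "\<And>b'. \<nu> b' \<le> real (2 * b' + 1) ^ (k + 1)"
    by metis
  define P where "P = real p ^ (n + 1)"
  define D where "D s = ?t 1 (b s)" for s
  define S where "S s = \<bar>?t (- 1) (b s)\<bar>" for s
  have T0: "T \<ge> 0" unfolding T_def by (rule half_wave_nonneg)
  have t0: "?t s 0 = 1" for s using slot_sum_0[of s "TYPE('k)" "k + 3" 0] by simp
  have b0: "b 0 = 0" by (simp add: b_def)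
  have D0: "D 0 = 1" and S0: "S 0 = 1" by (simp_all add: D_def S_def b0 t0)
  have DS: "D (Suc s) = P * D s + \<nu> (b s) * (U - T)" for s
    using \<nu>(1)[of "b s"] unfolding D_def bS P_def k .
  have SS: "S (Suc s) = T * S s" for s
    unfolding S_def bS \<nu>(2) using T0 by simp
  have S\<nu>: "S s \<le> \<nu> (b s)" for s unfolding S_def by (rule \<nu>(3))
  have rp: "real p \<ge> 3" using p_ge_3 by simp
  have P0: "P > 0" using rp by (simp add: P_def)
  have Pp: "P / real p = real p ^ (k + 1)" using rp unfolding P_def k(2)[symmetric] by simp
  have \<nu>P: "\<nu> (b s) \<le> (P / real p) ^ s" for s
  proof -
    have "\<nu> (b s) \<le> real (p ^ s) ^ (k + 1)" unfolding bq by (rule \<nu>(4))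
    also have "\<dots> = (P / real p) ^ s" unfolding Pp of_nat_power power_mult[symmetric] mult.commute[of s] ..
    finally show ?thesis .
  qed
  \<comment> \<open>The two bounds on \<open>\<nu>\<close> at s = 1 already give this, as
    \<open>S 1\<close> is \<open>T\<close>.\<close>
  have "T \<le> P / real p" using SS[of 0] S0 S\<nu>[of 1] \<nu>P[of 1] by simp
  also have "\<dots> < P" using P0 rp by (simp add: field_simps)
  finally have TP: "T < P" .
  define f where "f j = stc j * (2 * real c + 1) ^ j" for j
  have UT: "U = compose_coeff (n + 1) f" "T = compose_coeff (n - 1) f"
    unfolding U_def T_def half_wave_compose_coeff f_def k by (simp_all only:)
  have ev: "even n \<Longrightarrow> p + 2 \<ge> n" and od: "odd n \<Longrightarrow> p + 4 \<ge> 2 * n" using assms(4,5) by linarith+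
  note qb = quadric_bounds[OF assms(1) c c1 ev od, folded f_def, folded UT P_def]
  have st: "stc (n + 1) > 0" by (rule stc_pos)
  have X0: "U - T \<ge> 0" using qb(1) st TP by (smt (verit) mult_nonneg_nonneg)
  note lb = limit_bounds[of D P "\<lambda>s. \<nu> (b s)" "U - T" S T "real p", OF D0 DS S0 SS S\<nu> \<nu>P _ P0 T0 TP X0]
  have hk: "real (hk_length (n + 2) (\<Sum>i<n + 2. Var i ^ 2 :: 'k mpoly) (max_ideal (n + 2)) (p ^ s)) / real (p ^ s) ^ (n + 1) = D s / P ^ s" for s
  proof -
    have "hk_length (n + 2) (\<Sum>i<n + 2. Var i ^ 2 :: 'k mpoly) (max_ideal (n + 2)) (p ^ s) = snull TYPE('k) (replicate (n + 2) (p ^ s, 2))"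
      using quot_dim_frob_ideal[OF p_prime char_K refl, of "n + 2" s] unfolding hk_length_def frob_ideal_def sum_squares_def .
    also have "real (snull TYPE('k) (replicate (n + 2) (p ^ s, 2))) = D s"
      using slot_sum_snull[of "TYPE('k)" "n + 2" "b s" "[]"] unfolding D_def bq k by (simp only: append_Nil2)
    finally have 1: "real (hk_length (n + 2) (\<Sum>i<n + 2. Var i ^ 2 :: 'k mpoly) (max_ideal (n + 2)) (p ^ s)) = D s" .
    have 2: "real (p ^ s) ^ (n + 1) = P ^ s"
      unfolding P_def of_nat_power power_mult[symmetric] mult.commute[of s] ..
    show ?thesis unfolding 1 2 ..
  qed
  have e: "e_HK p (n + 1) (n + 2) (\<Sum>i<n + 2. Var i ^ 2 :: 'k mpoly) (max_ideal (n + 2)) = lim (\<lambda>s. D s / P ^ s)"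
    unfolding e_HK_def hk ..
  have "stc (n + 1) \<le> (U - T) / (P - T)" using qb(1) TP by (simp add: field_simps)
  moreover have "1 + (U - T) / (P - T) \<le> lim (\<lambda>s. D s / P ^ s)" by (rule lb(1)) (use rp in simp)
  ultimately have lower: "1 + stc (n + 1) \<le> lim (\<lambda>s. D s / P ^ s)" by linarith
  have "lim (\<lambda>s. D s / P ^ s) \<le> 1 + (U - T) / P * (real p / (real p - 1))" by (rule lb(2)) (use rp in simp)
  also have "(U - T) / P * (real p / (real p - 1)) \<le> U / P * (real p / (real p - 1))"
    using T0 P0 rp by (intro mult_right_mono divide_right_mono) auto
  also have "\<dots> \<le> stc (n + 1) + (2 * real n - 4) / real p" by (rule qb(2))
  finally show ?thesis using lower unfolding e sec_tan_coeff_eq by simp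
qed

end
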